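(* Let $a\in\operatorname{M}_\Lambda$ and $b\in\operatorname{M}_\Lambda^\times$, and let $G\subset\operatorname{GL}_2(\mathbb C)$ be the difference Galois group over $(K,\phi)$ of the equation $\phi^2(y)+a\phi(y)+by=0$. Consider the Riccati equation $(\phi(u)+a)u=-b$ in the unknown $u$. Then: 1. $G$ is reducible if and only if the Riccati equation has at least one solution in $\operatorname{M}_{2\Lambda}$. 2. $G$ is completely reducible if and only if the Riccati equation has at least two solutions in $\operatorname{M}_{2\Lambda}$.
   Context: $\Lambda=\mathbb Z+\mathbb Z\tau\subset\mathbb C$ with $\Im(\tau)>0$; $h\in\mathbb C$ is such that $h\bmod\Lambda$ is not a torsion point of $\mathbb C/\Lambda$. For a lattice $\Lambda'\subset\mathbb C$, $\operatorname{M}_{\Lambda'}$ is the field of $\Lambda'$-periodic meromorphic functions on $\mathbb C$. The base difference field is $(K,\phi)$ with $K=\bigcup_{k\ge1}\operatorname{M}_{k\Lambda}$ (equivalently, the union of $\operatorname{M}_{\Lambda'}$ over all sub-lattices $\Lambda'$ of $\Lambda$) and $\phi(f)(z)=f(z+h)$; $K^\phi=\{f\in K:\phi(f)=f\}=\mathbb C$. Difference Galois group: for a system $\phi Y=MY$ with $M\in\operatorname{GL}_n(K)$, a Picard–Vessiot ring is a ring extension $R$ of $K$ with a ring automorphism (still denoted $\phi$) extending $\phi$ such that (1) there is $U\in\operatorname{GL}_n(R)$ with $\phi(U)=MU$; (2) $R$ is generated as a $K$-algebra by the entries of $U$ and $\det(U)^{-1}$; (3) the only ideals of $R$ stable under $\phi$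 are $\{0\}$ and $R$. It exists and is unique up to isomorphism. The difference Galois group is the group of $K$-linear ring automorphisms of $R$ commuting with $\phi$, identified with an algebraic subgroup of $\operatorname{GL}_n(\mathbb C)$ (up to conjugation) via $\sigma\mapsto C(\sigma)$, where $\sigma(U)=UC(\sigma)$. The group of $\phi^2(y)+a\phi(y)+by=0$ is that of $\phi Y=\begin{pmatrix}0&1\\-b&-a\end{pmatrix}Y$. A subgroup of $\operatorname{GL}_2(\mathbb C)$ is reducible if it is conjugate to a subgroup of the group of upper-triangular matrices, and completely reducible if it is conjugate to a subgroup of the group of diagonal matrices. *)

theory Defs
  imports "HOL-Complex_Analysis.Complex_Analysis"
begin

section \<open>The field of meromorphic functions on the complex plane\<close>

text \<open>
  A meromorphic function is represented by its unique representative that takes the value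
  \<open>0\<close> at every pole and is continuous everywhere else. Sums and products are formed
  pointwise and then normalised with \<^const>\<open>remove_sings\<close>, so equality on this type
  is equality of meromorphic functions.
\<close>

typedef mero = "{f :: complex \<Rightarrow> complex. f nicely_meromorphic_on UNIV}"
  morphisms mero_fun Abs_mero
  by (rule exI[of _ "\<lambda>_. 0"]) auto

setup_lifting type_definition_mero

lemma nicely_meromorphic_eqI:
  assumes f: "f nicely_meromorphic_on UNIV" and g: "g nicely_meromorphic_on UNIV"
    and ev: "\<And>z. eventually (\<lambda>w. f w = g w) (at z)"
  shows "f = g"
proof
  fix z
  have *: "remove_sings k z = k z" if "k nicely_meromorphic_on UNIV" for k
    using that unfolding nicely_meromorphic_on_def
    by (metis UNIV_I remove_sings_at_pole remove_sings_eqI)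
  have "remove_sings f z = remove_sings g z"
    by (rule remove_sings_cong) (use ev in auto)
  thus "f z = g z" using *[OF f] *[OF g] by simp
qed

lemma mero_eqI:
  assumes "\<And>z. eventually (\<lambda>w. mero_fun f w = mero_fun g w) (at z)"
  shows "f = g"
  using assms nicely_meromorphic_eqI[of "mero_fun f" "mero_fun g"]
    mero_fun[of f] mero_fun[of g] by (simp add: mero_fun_inject)

lemma mero_fun_meromorphic: "mero_fun f meromorphic_on A"
  using mero_fun[of f] meromorphic_on_subset[of "mero_fun f" UNIV A]
  by (auto simp: nicely_meromorphic_on_def)

lemma nicely_meromorphic_shift:
  assumes "f nicely_meromorphic_on UNIV"
  shows "(\<lambda>z. f (z + h)) nicely_meromorphic_on UNIV"
  unfolding nicely_meromorphic_on_def
proof (intro conjI ballI)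
  show "(\<lambda>z. f (z + h)) meromorphic_on UNIV"
    by (rule meromorphic_on_compose[where A = UNIV])
       (use assms in \<open>auto simp: nicely_meromorphic_on_def intro!: analytic_intros\<close>)
next
  fix z
  have ft: "filtermap (\<lambda>w. w + h) (at z) = at (z + h)"
    using filtermap_at_shift[of "-h" z] by simp
  have "(is_pole f (z + h) \<and> f (z + h) = 0) \<or> f \<midarrow>z + h\<rightarrow> f (z + h)"
    using assms unfolding nicely_meromorphic_on_def by blast
  moreover have "is_pole (\<lambda>w. f (w + h)) z \<longleftrightarrow> is_pole f (z + h)"
    unfolding is_pole_def ft[symmetric] by (simp add: filterlim_filtermap)
  moreover have "((\<lambda>w. f (w + h)) \<midarrow>z\<rightarrow> f (z + h)) \<longleftrightarrow> (f \<midarrow>z + h\<rightarrow> f (z + h))"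
    unfolding ft[symmetric] by (simp add: filterlim_filtermap)
  ultimately show "(is_pole (\<lambda>w. f (w + h)) z \<and> f (z + h) = 0) \<or>
      (\<lambda>w. f (w + h)) \<midarrow>z\<rightarrow> f (z + h)" by simp
qed

lift_definition mero_const :: "complex \<Rightarrow> mero" is "\<lambda>c _. c" by auto

lift_definition shift :: "complex \<Rightarrow> mero \<Rightarrow> mero" is "\<lambda>h f z. f (z + h)"
  by (auto intro: nicely_meromorphic_shift)

instantiation mero :: field
begin

lift_definition zero_mero :: mero is "\<lambda>_. 0" by auto

lift_definition one_mero :: mero is "\<lambda>_. 1" by auto

lift_definition plus_mero :: "mero \<Rightarrow> mero \<Rightarrow> mero" is
  "\<lambda>f g. remove_sings (\<lambda>z. f z + g z)"
  by (intro remove_sings_nicely_meromorphic meromorphic_intros)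
     (auto simp: nicely_meromorphic_on_def)

lift_definition times_mero :: "mero \<Rightarrow> mero \<Rightarrow> mero" is
  "\<lambda>f g. remove_sings (\<lambda>z. f z * g z)"
  by (intro remove_sings_nicely_meromorphic meromorphic_intros)
     (auto simp: nicely_meromorphic_on_def)

lift_definition uminus_mero :: "mero \<Rightarrow> mero" is "\<lambda>f z. - f z" by auto

lift_definition inverse_mero :: "mero \<Rightarrow> mero" is "\<lambda>f z. inverse (f z)"
  by (auto intro: nicely_meromorphic_on_inverse)

definition minus_mero :: "mero \<Rightarrow> mero \<Rightarrow> mero" where "minus_mero f g = f + - g"

definition divide_mero :: "mero \<Rightarrow> mero \<Rightarrow> mero" where "divide_mero f g = f * inverse g"

lemma mero_fun_add: "eventually (\<lambda>w. mero_fun (f + g) w = mero_fun f w + mero_fun g w) (at z)"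
proof -
  have "(\<lambda>w. mero_fun f w + mero_fun g w) meromorphic_on {z}"
    by (intro meromorphic_intros mero_fun_meromorphic)
  thus ?thesis
    using eventually_remove_sings_eq_at by (simp add: plus_mero.rep_eq meromorphic_at_iff)
qed

lemma mero_fun_mult: "eventually (\<lambda>w. mero_fun (f * g) w = mero_fun f w * mero_fun g w) (at z)"
proof -
  have "(\<lambda>w. mero_fun f w * mero_fun g w) meromorphic_on {z}"
    by (intro meromorphic_intros mero_fun_meromorphic)
  thus ?thesis
    using eventually_remove_sings_eq_at by (simp add: times_mero.rep_eq meromorphic_at_iff)
qed

lemma mero_fun_nonzero:
  assumes "f \<noteq> 0"
  shows "eventually (\<lambda>w. mero_fun f w \<noteq> 0) (at z)"
proof -
  have "(\<forall>x\<in>UNIV. mero_fun f x = 0) \<or> (\<forall>\<^sub>\<approx>x\<in>UNIV. mero_fun f x \<noteq> 0)"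
    by (rule nicely_meromorphic_imp_constant_or_avoid) (use mero_fun[of f] in auto)
  moreover have "\<not> (\<forall>x\<in>UNIV. mero_fun f x = 0)"
    using assms by (metis UNIV_I ext mero_fun_inject zero_mero.rep_eq)
  ultimately show ?thesis by (auto simp: eventually_cosparse_open_eq)
qed

instance
proof
  fix f g k :: mero
  show "f + g + k = f + (g + k)"
  proof (rule mero_eqI)
    fix z
    show "eventually (\<lambda>w. mero_fun (f + g + k) w = mero_fun (f + (g + k)) w) (at z)"
      using mero_fun_add[of "f + g" k z] mero_fun_add[of f g z]
        mero_fun_add[of f "g + k" z] mero_fun_add[of g k z]
      by eventually_elim simp
  qed
  show "f + g = g + f"
  proof (rule mero_eqI)
    fix z
    show "eventually (\<lambda>w. mero_fun (f + g) w = mero_fun (g + f) w) (at z)"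
      using mero_fun_add[of f g z] mero_fun_add[of g f z] by eventually_elim simp
  qed
  show "0 + f = f"
  proof (rule mero_eqI)
    fix z
    show "eventually (\<lambda>w. mero_fun (0 + f) w = mero_fun f w) (at z)"
      using mero_fun_add[of 0 f z] by eventually_elim (simp add: zero_mero.rep_eq)
  qed
  show "- f + f = 0"
  proof (rule mero_eqI)
    fix z
    show "eventually (\<lambda>w. mero_fun (- f + f) w = mero_fun 0 w) (at z)"
      using mero_fun_add[of "- f" f z]
      by eventually_elim (simp add: zero_mero.rep_eq uminus_mero.rep_eq)
  qed
  show "f - g = f + - g" by (simp add: minus_mero_def)
  show "f * g * k = f * (g * k)"
  proof (rule mero_eqI)
    fix z
    show "eventually (\<lambda>w. mero_fun (f * g * k) w = mero_fun (f * (g * k)) w) (at z)"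
      using mero_fun_mult[of "f * g" k z] mero_fun_mult[of f g z]
        mero_fun_mult[of f "g * k" z] mero_fun_mult[of g k z]
      by eventually_elim simp
  qed
  show "f * g = g * f"
  proof (rule mero_eqI)
    fix z
    show "eventually (\<lambda>w. mero_fun (f * g) w = mero_fun (g * f) w) (at z)"
      using mero_fun_mult[of f g z] mero_fun_mult[of g f z] by eventually_elim simp
  qed
  show "1 * f = f"
  proof (rule mero_eqI)
    fix z
    show "eventually (\<lambda>w. mero_fun (1 * f) w = mero_fun f w) (at z)"
      using mero_fun_mult[of 1 f z] by eventually_elim (simp add: one_mero.rep_eq)
  qed
  show "(f + g) * k = f * k + g * k"
  proof (rule mero_eqI)
    fix z
    show "eventually (\<lambda>w. mero_fun ((f + g) * k) w = mero_fun (f * k + g * k) w) (at z)"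
      using mero_fun_mult[of "f + g" k z] mero_fun_add[of f g z]
        mero_fun_add[of "f * k" "g * k" z] mero_fun_mult[of f k z] mero_fun_mult[of g k z]
      by eventually_elim (simp add: distrib_right)
  qed
  show "(0 :: mero) \<noteq> 1"
    by (metis mero_fun_inject one_mero.rep_eq zero_mero.rep_eq zero_neq_one)
  show "inverse f * f = 1" if "f \<noteq> 0"
  proof (rule mero_eqI)
    fix z
    show "eventually (\<lambda>w. mero_fun (inverse f * f) w = mero_fun 1 w) (at z)"
      using mero_fun_mult[of "inverse f" f z] mero_fun_nonzero[OF that, of z]
      by eventually_elim (simp add: one_mero.rep_eq inverse_mero.rep_eq)
  qed
  show "f div g = f * inverse g" by (simp add: divide_mero_def)
  show "inverse (0 :: mero) = 0"
    by (simp add: mero_fun_inject[symmetric] zero_mero.rep_eq inverse_mero.rep_eq)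
qed

end


section \<open>Lattices and the base difference field\<close>

definition lattice :: "complex \<Rightarrow> complex set" where
  "lattice \<tau> = {of_int m + of_int n * \<tau> | m n :: int. True}"

definition scaled :: "nat \<Rightarrow> complex set \<Rightarrow> complex set" where
  "scaled k \<Lambda> = (\<lambda>w. of_nat k * w) ` \<Lambda>"

definition periodic_mero :: "complex set \<Rightarrow> mero set" where
  "periodic_mero \<Lambda> = {f. \<forall>w\<in>\<Lambda>. \<forall>z. mero_fun f (z + w) = mero_fun f z}"

definition base_field :: "complex set \<Rightarrow> mero set" where
  "base_field \<Lambda> = (\<Union>k\<in>{1..}. periodic_mero (scaled k \<Lambda>))"


section \<open>Picard-Vessiot rings and difference Galois groups\<close>

definition ring_hom_on :: "'a::ring_1 set \<Rightarrow> ('a \<Rightarrow> 'b::ring_1) \<Rightarrow> bool" where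
  "ring_hom_on A f \<longleftrightarrow> f 1 = 1 \<and>
     (\<forall>x\<in>A. \<forall>y\<in>A. f (x + y) = f x + f y \<and> f (x * y) = f x * f y)"

definition ring_aut :: "('a::ring_1 \<Rightarrow> 'a) \<Rightarrow> bool" where
  "ring_aut f \<longleftrightarrow> ring_hom_on UNIV f \<and> bij f"

definition is_subring :: "'a::ring_1 set \<Rightarrow> bool" where
  "is_subring A \<longleftrightarrow> 1 \<in> A \<and> (\<forall>x\<in>A. \<forall>y\<in>A. x - y \<in> A \<and> x * y \<in> A)"

text \<open>
  The base difference field is a subfield \<open>K\<close> of a field type together with
  \<open>\<phi>\<close>; the ring \<open>R\<close> is the whole type \<open>'r\<close>. The map \<open>\<iota>\<close> is the inclusion of \<open>K\<close>
  into \<open>R\<close> (its values outside \<open>K\<close> are irrelevant) and \<open>\<Phi>\<close> is the automorphism of \<open>R\<close>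
  that extends \<open>\<phi>\<close>. Ideals of \<open>R\<close> are the submodules of \<open>R\<close> as a module over itself.
  The predicate says that \<open>R\<close> is a Picard-Vessiot ring for \<open>\<phi> Y = M Y\<close>
  and that \<open>U\<close> is a fundamental matrix as in its definition; it is meant for
  \<open>M\<close> in \<open>GL_n(K)\<close>.
\<close>

definition picard_vessiot ::
  "'k::field set \<Rightarrow> ('k \<Rightarrow> 'k) \<Rightarrow> 'k^'n^'n \<Rightarrow>
   ('k \<Rightarrow> 'r::comm_ring_1) \<Rightarrow> ('r \<Rightarrow> 'r) \<Rightarrow> 'r^'n^'n \<Rightarrow> bool" where
  "picard_vessiot K \<phi> M \<iota> \<Phi> U \<longleftrightarrow>
     ring_hom_on K \<iota> \<and> inj_on \<iota> K \<and>
     ring_aut \<Phi> \<and> (\<forall>x\<in>K. \<Phi> (\<iota> x) = \<iota> (\<phi> x)) \<and>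
     invertible U \<and> map_matrix \<Phi> U = map_matrix \<iota> M ** U \<and>
     is_subring hull (\<iota> ` K \<union> {U $ i $ j | i j. True} \<union> {d. d * det U = 1}) = UNIV \<and>
     (\<forall>I. module.subspace (*) I \<and> \<Phi> ` I \<subseteq> I \<longrightarrow> I = {0} \<or> I = UNIV)"

definition galois_automorphisms ::
  "'k set \<Rightarrow> ('k \<Rightarrow> 'r::comm_ring_1) \<Rightarrow> ('r \<Rightarrow> 'r) \<Rightarrow> ('r \<Rightarrow> 'r) set" where
  "galois_automorphisms K \<iota> \<Phi> =
     {\<sigma>. ring_aut \<sigma> \<and> (\<forall>x\<in>K. \<sigma> (\<iota> x) = \<iota> x) \<and> (\<forall>r. \<sigma> (\<Phi> r) = \<Phi> (\<sigma> r))}"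

text \<open>
  The group as a set of matrices \<open>C(\<sigma>)\<close>, with \<open>\<sigma>(U) = U C(\<sigma>)\<close>; complex matrices act on
  \<open>U\<close> through the constant functions.
\<close>

definition galois_group ::
  "mero set \<Rightarrow> (mero \<Rightarrow> 'r::comm_ring_1) \<Rightarrow> ('r \<Rightarrow> 'r) \<Rightarrow> 'r^'n^'n \<Rightarrow> (complex^'n^'n) set" where
  "galois_group K \<iota> \<Phi> U =
     {C. invertible C \<and> (\<exists>\<sigma>\<in>galois_automorphisms K \<iota> \<Phi>.
           map_matrix \<sigma> U = U ** map_matrix (\<iota> \<circ> mero_const) C)}"

definition companion_matrix :: "'k \<Rightarrow> 'k \<Rightarrow> 'k::ring_1^2^2" where
  "companion_matrix a b = vector [vector [0, 1], vector [- b, - a]]"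


section \<open>Reducibility of subgroups of the general linear group of degree two\<close>

definition conjugate_into :: "('a::field^'n^'n) set \<Rightarrow> ('a^'n^'n) set \<Rightarrow> bool" where
  "conjugate_into G H \<longleftrightarrow> (\<exists>P. invertible P \<and> (\<lambda>A. P ** A ** matrix_inv P) ` G \<subseteq> H)"

definition reducible :: "(complex^2^2) set \<Rightarrow> bool" where
  "reducible G \<longleftrightarrow> conjugate_into G {A. invertible A \<and> A $ 2 $ 1 = 0}"

definition completely_reducible :: "(complex^2^2) set \<Rightarrow> bool" where
  "completely_reducible G \<longleftrightarrow>
     conjugate_into G {A. invertible A \<and> A $ 1 $ 2 = 0 \<and> A $ 2 $ 1 = 0}"

end

theory Submission
  imports Defs "HOL-Library.Poly_Mapping"
    "HOL-Computational_Algebra.Fundamental_Theorem_Algebra"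
begin

text \<open>
  If \<open>u\<close> solves the Riccati equation, the row \<open>(-u, 1) U\<close> is multiplied by \<open>b / u\<close> under \<open>\<phi>\<close>; its
  entries have constant ratio, so it yields a common left eigenvector of \<open>G\<close>. Conversely, let \<open>G\<close>
  preserve the line of a vector \<open>v\<close> and let \<open>y\<close> be the first entry of \<open>U v\<close>. If \<open>y\<close> and \<open>\<phi> y\<close> were
  independent over \<open>K\<close>, a suitable maximal difference ideal of \<open>R \<otimes> R\<close> would define an
  automorphism of \<open>R\<close> moving that line; hence \<open>\<phi> y = u y\<close> with \<open>u \<in> K\<close>. That such an ideal defines an
  automorphism rests on the fact that constants of a countably generated simple
  difference algebra are complex numbers, since the complex numbers are uncountable.

  The lattice acts on the set of solutions in \<open>K\<close> through commuting translations of finite order. One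
  solution is fixed by all of them, two are at worst exchanged. With at least three, the solutions
  form a projective line on which each translation is a homography with two fixed points, and
  the second translation permutes the fixed points of the first; so two solutions are always
  fixed by the squares of both translations.
\<close>

section \<open>Congruences, difference fields and difference algebras\<close>

text \<open>No Galois correspondence is used, and \<open>R\<close> may have zero divisors, so
  division is available in \<open>K\<close> only. The automorphisms that are needed are made as
  points of R \<otimes> R: an automorphism \<sigma> is determined by the kernel of x \<otimes> y
  \<mapsto> x * \<sigma> y, and conversely a stable ideal is wanted whose quotient is R again. The
  obstacle is that the quotient could acquire new constants; then 1 \<otimes> p would not be a
  complex combination of the solutions p and q. The countability argument excludes this. To let
  \<sigma> keep a semi-invariant element s nonzero, maximality is asked among the stable ideals that
  contain no power of s, which amounts to inverting s without a localisation. Since R \<otimes> R is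
  not shown to be reduced, an element killed by all \<sigma> could still be nilpotent rather than
  zero; binary forms and their derivatives are there to deal with that case.\<close>

abbreviation ring_ideal :: "'a::comm_ring_1 set \<Rightarrow> bool" where
  "ring_ideal \<equiv> module.subspace (*)"

lemma ring_ideal_iff:
  "ring_ideal J \<longleftrightarrow> 0 \<in> J \<and> (\<forall>x\<in>J. \<forall>y\<in>J. x + y \<in> J) \<and> (\<forall>c. \<forall>x\<in>J. c * x \<in> J)"
proof -
  have "module ((*) :: 'a \<Rightarrow> 'a \<Rightarrow> 'a)"
    by unfold_locales (auto simp: algebra_simps)
  from module.subspace_def[OF this] show ?thesis .
qed

text \<open>The ideals of interest come from Zorn's lemma inside proofs, so their quotient rings are
  not types; arithmetic in a quotient is written as congruence.\<close>

locale ideal_congruence =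
  fixes m :: "'a::comm_ring_1 set"
  assumes ideal: "ring_ideal m"
begin

definition cong_mod (infix \<open>\<simeq>\<close> 50) where "x \<simeq> y \<longleftrightarrow> x - y \<in> m"

lemma zero_mem [simp]: "0 \<in> m"
  and add_mem: "x \<in> m \<Longrightarrow> y \<in> m \<Longrightarrow> x + y \<in> m"
  and mult_mem: "x \<in> m \<Longrightarrow> c * x \<in> m"
  using ideal by (auto simp: ring_ideal_iff)

lemma uminus_mem: "x \<in> m \<Longrightarrow> - x \<in> m"
  using mult_mem[of x "-1"] by simp

lemma diff_mem: "x \<in> m \<Longrightarrow> y \<in> m \<Longrightarrow> x - y \<in> m"
  using add_mem[of x "-y"] uminus_mem by simp

lemma sum_mem: "(\<And>i. i \<in> A \<Longrightarrow> f i \<in> m) \<Longrightarrow> sum f A \<in> m"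
  by (induction A rule: infinite_finite_induct) (auto intro: add_mem)

lemma cong_refl [simp]: "x \<simeq> x"
  by (simp add: cong_mod_def)

lemma cong_sym: "x \<simeq> y \<Longrightarrow> y \<simeq> x"
  using uminus_mem[of "x - y"] by (simp add: cong_mod_def)

lemma cong_trans [trans]: "x \<simeq> y \<Longrightarrow> y \<simeq> z \<Longrightarrow> x \<simeq> z"
  using add_mem[of "x - y" "y - z"] by (simp add: cong_mod_def)

lemma cong_add: "x \<simeq> y \<Longrightarrow> x' \<simeq> y' \<Longrightarrow> x + x' \<simeq> y + y'"
  using add_mem[of "x - y" "x' - y'"] by (simp add: cong_mod_def algebra_simps)

lemma cong_diff: "x \<simeq> y \<Longrightarrow> x' \<simeq> y' \<Longrightarrow> x - x' \<simeq> y - y'"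
  using diff_mem[of "x - y" "x' - y'"] by (simp add: cong_mod_def algebra_simps)

lemma cong_mult:
  assumes "x \<simeq> y" "x' \<simeq> y'"
  shows "x * x' \<simeq> y * y'"
proof -
  have "x * x' - y * y' = x' * (x - y) + y * (x' - y')" by (simp add: algebra_simps)
  thus ?thesis using assms by (auto simp: cong_mod_def intro: add_mem mult_mem)
qed

lemma cong_power: "x \<simeq> y \<Longrightarrow> x ^ n \<simeq> y ^ n"
  by (induction n) (auto intro: cong_mult)

lemma cong_sum: "(\<And>i. i \<in> A \<Longrightarrow> f i \<simeq> g i) \<Longrightarrow> sum f A \<simeq> sum g A"
  using sum_mem[of A "\<lambda>i. f i - g i"] by (simp add: cong_mod_def sum_subtractf)

lemma cong_0_iff: "x \<simeq> 0 \<longleftrightarrow> x \<in> m"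
  by (simp add: cong_mod_def)

lemma cong_mem_iff: "x \<simeq> y \<Longrightarrow> x \<in> m \<longleftrightarrow> y \<in> m"
  by (metis cong_0_iff cong_sym cong_trans)

end


text \<open>\<open>j\<close> embeds the complex constants. The assumption \<open>constants\<close>
  is the place where the non-torsion of the shift will enter.\<close>

locale difference_field =
  fixes K :: "'k::field set" and \<phi> :: "'k \<Rightarrow> 'k" and j :: "complex \<Rightarrow> 'k"
  assumes K_add: "x \<in> K \<Longrightarrow> y \<in> K \<Longrightarrow> x + y \<in> K"
    and K_mult: "x \<in> K \<Longrightarrow> y \<in> K \<Longrightarrow> x * y \<in> K"
    and K_inverse: "x \<in> K \<Longrightarrow> inverse x \<in> K"
    and \<phi>_K: "x \<in> K \<Longrightarrow> \<phi> x \<in> K"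
    and \<phi>_add: "\<phi> (x + y) = \<phi> x + \<phi> y"
    and \<phi>_mult: "\<phi> (x * y) = \<phi> x * \<phi> y"
    and \<phi>_one: "\<phi> 1 = 1"
    and j_K: "j c \<in> K"
    and j_one: "j 1 = 1"
    and j_add: "j (c + d) = j c + j d"
    and j_mult: "j (c * d) = j c * j d"
    and \<phi>_j: "\<phi> (j c) = j c"
    and constants: "x \<in> K \<Longrightarrow> \<phi> x = x \<Longrightarrow> x \<in> range j"
begin

lemma j_zero [simp]: "j 0 = 0"
  using j_add[of 0 0] by (metis add.right_neutral add_left_cancel)

lemma j_eq_0_iff [simp]: "j c = 0 \<longleftrightarrow> c = 0"
  by (metis j_mult j_one j_zero mult_zero_left right_inverse zero_neq_one)

lemma j_uminus: "j (- c) = - j c"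
  using j_add[of "-c" c] by (simp add: eq_neg_iff_add_eq_0)

lemma j_diff: "j (c - d) = j c - j d"
  using j_add[of c "-d"] by (simp add: j_uminus)

lemma K_zero [simp]: "0 \<in> K" and K_one [simp]: "1 \<in> K"
  using j_K[of 0] j_K[of 1] by (simp_all add: j_one)

lemma K_uminus: "x \<in> K \<Longrightarrow> - x \<in> K"
  using K_mult[OF j_K[of "-1"], of x] by (simp add: j_uminus j_one)

lemma K_diff: "x \<in> K \<Longrightarrow> y \<in> K \<Longrightarrow> x - y \<in> K"
  using K_add[of x "-y"] K_uminus by simp

lemma K_divide: "x \<in> K \<Longrightarrow> y \<in> K \<Longrightarrow> x / y \<in> K"
  by (simp add: divide_inverse K_mult K_inverse)

lemma K_sum: "(\<And>i. i \<in> A \<Longrightarrow> f i \<in> K) \<Longrightarrow> sum f A \<in> K"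
  by (induction A rule: infinite_finite_induct) (auto intro: K_add)

lemmas K_closed = K_add K_mult K_inverse K_uminus K_diff K_divide K_sum \<phi>_K j_K

lemma \<phi>_zero [simp]: "\<phi> 0 = 0"
  using \<phi>_add[of 0 0] by (metis add.right_neutral add_left_cancel)

lemma \<phi>_uminus: "\<phi> (- x) = - \<phi> x"
  using \<phi>_add[of "-x" x] by (simp add: eq_neg_iff_add_eq_0)

lemma \<phi>_diff: "\<phi> (x - y) = \<phi> x - \<phi> y"
  using \<phi>_add[of x "-y"] by (simp add: \<phi>_uminus)

lemma \<phi>_eq_0_iff [simp]: "\<phi> x = 0 \<longleftrightarrow> x = 0"
  by (metis \<phi>_mult \<phi>_one \<phi>_zero mult_zero_left right_inverse zero_neq_one)

lemma \<phi>_inverse: "\<phi> (inverse x) = inverse (\<phi> x)"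
  by (metis \<phi>_eq_0_iff \<phi>_mult \<phi>_one inverse_unique inverse_zero right_inverse)

lemma \<phi>_divide: "\<phi> (x / y) = \<phi> x / \<phi> y"
  by (simp add: divide_inverse \<phi>_mult \<phi>_inverse)

text \<open>Gaussian elimination on the coordinates in \<open>J\<close>, written with explicit
  coefficients so that they stay in the subfield \<open>K\<close>.\<close>

lemma linear_relation:
  fixes c :: "'i \<Rightarrow> 'j \<Rightarrow> 'k"
  assumes "finite J" "finite I" "card J < card I" "\<And>i k. i \<in> I \<Longrightarrow> k \<in> J \<Longrightarrow> c i k \<in> K"
  shows "\<exists>x. (\<forall>i. x i \<in> K) \<and> (\<exists>i\<in>I. x i \<noteq> 0) \<and> (\<forall>k\<in>J. (\<Sum>i\<in>I. x i * c i k) = 0)"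
  using assms
proof (induction J arbitrary: I c rule: finite_induct)
  case empty
  then obtain i where "i \<in> I" by fastforce
  thus ?case by (intro exI[of _ "\<lambda>_. 1"]) auto
next
  case (insert l J)
  show ?case
  proof (cases "\<exists>p\<in>I. c p l \<noteq> 0")
    case False
    have "card J < card I" using insert by simp
    then obtain x where "\<forall>i. x i \<in> K" "\<exists>i\<in>I. x i \<noteq> 0" "\<forall>k\<in>J. (\<Sum>i\<in>I. x i * c i k) = 0"
      using insert.IH[of I c] insert.prems by auto
    thus ?thesis using False by (intro exI[of _ x]) auto
  next
    case True
    then obtain p where p: "p \<in> I" "c p l \<noteq> 0" by blast
    define I' where "I' = I - {p}"
    have I: "I = insert p I'" "p \<notin> I'" "finite I'"
      using p insert.prems by (auto simp: I'_def)
    define c' where "c' = (\<lambda>i k. c i k - c i l / c p l * c p k)"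
    have "card J < card I'" using insert I by simp
    moreover have "c' i k \<in> K" if "i \<in> I'" "k \<in> J" for i k
      unfolding c'_def using that insert.prems p I by (intro K_closed) auto
    ultimately obtain x where x: "\<forall>i. x i \<in> K" "\<exists>i\<in>I'. x i \<noteq> 0"
        "\<forall>k\<in>J. (\<Sum>i\<in>I'. x i * c' i k) = 0"
      using insert.IH[of I' c'] I by auto
    \<comment> \<open>The pivot absorbs the multiples of row \<open>p\<close> that were subtracted
      to form \<open>c'\<close>.\<close>
    define y where "y = x(p := - (\<Sum>i\<in>I'. x i * (c i l / c p l)))"
    have y: "(\<Sum>i\<in>I. y i * c i k) = (\<Sum>i\<in>I'. x i * c' i k)" for k
    proof -
      have "(\<Sum>i\<in>I. y i * c i k) = y p * c p k + (\<Sum>i\<in>I'. y i * c i k)"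
        using I by simp
      also have "(\<Sum>i\<in>I'. y i * c i k) = (\<Sum>i\<in>I'. x i * c i k)"
        by (rule sum.cong) (use I in \<open>auto simp: y_def\<close>)
      finally show ?thesis
        by (simp add: y_def c'_def right_diff_distrib sum_subtractf sum_distrib_right mult.assoc)
    qed
    have "y i \<in> K" for i
      using x(1) insert.prems(3) I by (auto simp: y_def intro!: K_closed)
    moreover have "(\<Sum>i\<in>I. y i * c i l) = 0"
      using p by (simp add: y c'_def)
    moreover have "\<exists>i\<in>I. y i \<noteq> 0" using x(2) I by (auto simp: y_def)
    ultimately show ?thesis using x(3) y by (intro exI[of _ y]) auto
  qed
qed

end


text \<open>Only an endomorphism \<open>\<psi>\<close> is asked for, so that one theory serves both
  \<open>R\<close> and the monoid algebra that covers R \<otimes> R.\<close>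

locale difference_algebra = difference_field K \<phi> j
  for K :: "'k::field set" and \<phi> :: "'k \<Rightarrow> 'k" and j :: "complex \<Rightarrow> 'k" +
  fixes \<kappa> :: "'k \<Rightarrow> 'a::comm_ring_1" and \<psi> :: "'a \<Rightarrow> 'a"
  assumes \<kappa>_one: "\<kappa> 1 = 1"
    and \<kappa>_add: "x \<in> K \<Longrightarrow> y \<in> K \<Longrightarrow> \<kappa> (x + y) = \<kappa> x + \<kappa> y"
    and \<kappa>_mult: "x \<in> K \<Longrightarrow> y \<in> K \<Longrightarrow> \<kappa> (x * y) = \<kappa> x * \<kappa> y"
    and \<psi>_one: "\<psi> 1 = 1"
    and \<psi>_add: "\<psi> (u + v) = \<psi> u + \<psi> v"
    and \<psi>_mult: "\<psi> (u * v) = \<psi> u * \<psi> v"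
    and \<psi>_\<kappa>: "x \<in> K \<Longrightarrow> \<psi> (\<kappa> x) = \<kappa> (\<phi> x)"
begin

lemma \<kappa>_zero [simp]: "\<kappa> 0 = 0"
  using \<kappa>_add[of 0 0] by simp

lemma \<kappa>_uminus: "x \<in> K \<Longrightarrow> \<kappa> (- x) = - \<kappa> x"
  using \<kappa>_add[of "-x" x] by (simp add: eq_neg_iff_add_eq_0 K_uminus)

lemma \<kappa>_diff: "x \<in> K \<Longrightarrow> y \<in> K \<Longrightarrow> \<kappa> (x - y) = \<kappa> x - \<kappa> y"
  using \<kappa>_add[of x "-y"] by (simp add: \<kappa>_uminus K_uminus)

lemma \<kappa>_sum: "(\<And>i. i \<in> A \<Longrightarrow> f i \<in> K) \<Longrightarrow> \<kappa> (sum f A) = (\<Sum>i\<in>A. \<kappa> (f i))"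
  by (induction A rule: infinite_finite_induct) (auto simp: \<kappa>_add K_sum)

lemma \<kappa>_inverse: "x \<in> K \<Longrightarrow> x \<noteq> 0 \<Longrightarrow> \<kappa> (inverse x) * \<kappa> x = 1"
  by (metis K_inverse \<kappa>_mult \<kappa>_one left_inverse)

lemma \<psi>_zero [simp]: "\<psi> 0 = 0"
  using \<psi>_add[of 0 0] by simp

lemma \<psi>_uminus: "\<psi> (- x) = - \<psi> x"
  using \<psi>_add[of "-x" x] by (simp add: eq_neg_iff_add_eq_0)

lemma \<psi>_diff: "\<psi> (x - y) = \<psi> x - \<psi> y"
  using \<psi>_add[of x "-y"] by (simp add: \<psi>_uminus)

lemma \<psi>_power: "\<psi> (x ^ n) = \<psi> x ^ n"
  by (induction n) (auto simp: \<psi>_one \<psi>_mult)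

lemma \<psi>_sum: "\<psi> (sum f A) = (\<Sum>i\<in>A. \<psi> (f i))"
  by (induction A rule: infinite_finite_induct) (auto simp: \<psi>_add)

abbreviation scalar :: "complex \<Rightarrow> 'a" where "scalar c \<equiv> \<kappa> (j c)"

lemma scalar_add: "scalar (c + d) = scalar c + scalar d"
  and scalar_mult: "scalar (c * d) = scalar c * scalar d"
  and scalar_uminus: "scalar (- c) = - scalar c"
  and scalar_diff: "scalar (c - d) = scalar c - scalar d"
  and \<psi>_scalar: "\<psi> (scalar c) = scalar c"
  by (simp_all add: j_add j_mult j_uminus j_diff \<kappa>_add \<kappa>_mult \<kappa>_uminus \<kappa>_diff \<psi>_\<kappa> \<phi>_j j_K)

lemma scalar_one [simp]: "scalar 1 = 1" and scalar_zero [simp]: "scalar 0 = 0"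
  by (simp_all add: j_one \<kappa>_one)

lemma scalar_inverse: "c \<noteq> 0 \<Longrightarrow> scalar (inverse c) * scalar c = 1"
  by (metis scalar_mult left_inverse scalar_one)

definition eval_scalar :: "complex poly \<Rightarrow> 'a \<Rightarrow> 'a" where
  "eval_scalar P c = poly (map_poly (\<lambda>x. scalar x) P) c"

lemma eval_scalar_0 [simp]: "eval_scalar 0 c = 0"
  by (simp add: eval_scalar_def)

lemma eval_scalar_pCons [simp]: "eval_scalar (pCons x P) c = scalar x + c * eval_scalar P c"
  by (simp add: eval_scalar_def map_poly_pCons)

lemma eval_scalar_1 [simp]: "eval_scalar 1 c = 1"
  by (simp add: one_pCons)

lemma eval_scalar_add: "eval_scalar (P + Q) c = eval_scalar P c + eval_scalar Q c"
proof -
  have "map_poly (\<lambda>x. scalar x) (P + Q) = map_poly (\<lambda>x. scalar x) P + map_poly (\<lambda>x. scalar x) Q"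
    by (rule poly_eqI) (simp add: coeff_map_poly scalar_add)
  thus ?thesis by (simp add: eval_scalar_def)
qed

lemma eval_scalar_smult: "eval_scalar (smult x P) c = scalar x * eval_scalar P c"
  by (induction P) (auto simp: scalar_mult algebra_simps)

lemma eval_scalar_mult: "eval_scalar (P * Q) c = eval_scalar P c * eval_scalar Q c"
  by (induction P) (auto simp: eval_scalar_add eval_scalar_smult algebra_simps)

lemma eval_scalar_sum: "eval_scalar (sum P A) c = (\<Sum>i\<in>A. eval_scalar (P i) c)"
  by (induction A rule: infinite_finite_induct) (auto simp: eval_scalar_add)

lemma eval_scalar_prod: "eval_scalar (prod P A) c = (\<Prod>i\<in>A. eval_scalar (P i) c)"
  by (induction A rule: infinite_finite_induct) (auto simp: eval_scalar_mult)

end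

section \<open>Constants modulo a maximal stable ideal\<close>

context difference_algebra
begin

definition stable_ideal :: "'a set \<Rightarrow> bool" where
  "stable_ideal J \<longleftrightarrow> ring_ideal J \<and> \<psi> ` J \<subseteq> J"

text \<open>\<open>t\<close> is a sequence, so if this is everything, the quotient by
  \<open>m\<close> has countable dimension over \<open>K\<close>; the uncountability of the complex
  numbers is played off against that.\<close>

definition spanned_mod :: "'a set \<Rightarrow> (nat \<Rightarrow> 'a) \<Rightarrow> 'a set" where
  "spanned_mod m t = {x. \<exists>n k. (\<forall>i. k i \<in> K) \<and> x - (\<Sum>i<n. \<kappa> (k i) * t i) \<in> m}"

end

text \<open>The quotient by \<open>m\<close> with \<open>s\<close> inverted is a simple difference
  ring; the assumptions express this without forming the localisation.\<close>

locale maximal_stable_ideal = difference_algebra K \<phi> j \<kappa> \<psi>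
  for K :: "'k::field set" and \<phi> :: "'k \<Rightarrow> 'k" and j :: "complex \<Rightarrow> 'k"
    and \<kappa> :: "'k \<Rightarrow> 'a::comm_ring_1" and \<psi> :: "'a \<Rightarrow> 'a" +
  fixes m :: "'a set" and s e e' :: 'a and t :: "nat \<Rightarrow> 'a"
  assumes stable: "stable_ideal m"
    and semi_invariant: "\<psi> s - e * s \<in> m"
    and unit: "e * e' = 1"
    and avoid: "s ^ n \<notin> m"
    and maximal: "stable_ideal J \<Longrightarrow> m \<subseteq> J \<Longrightarrow> (\<And>n. s ^ n \<notin> J) \<Longrightarrow> J = m"
    and countably_spanned: "spanned_mod m t = UNIV"
begin

sublocale ideal_congruence m
  using stable by unfold_locales (simp add: stable_ideal_def)

lemma \<psi>_mem: "x \<in> m \<Longrightarrow> \<psi> x \<in> m"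
  using stable by (auto simp: stable_ideal_def)

lemma cong_\<psi>: "x \<simeq> y \<Longrightarrow> \<psi> x \<simeq> \<psi> y"
  using \<psi>_mem[of "x - y"] by (simp add: cong_mod_def \<psi>_diff)

lemma \<psi>_s: "\<psi> s \<simeq> e * s"
  using semi_invariant by (simp add: cong_mod_def)

lemma one_not_mem: "1 \<notin> m"
  using avoid[of 0] by simp

lemma unit_power: "e ^ k * e' ^ k = 1"
  by (metis power_mult_distrib power_one unit)

lemma \<psi>_s_power: "\<psi> (s ^ k) \<simeq> e ^ k * s ^ k"
  using cong_power[OF \<psi>_s, of k] by (simp add: \<psi>_power power_mult_distrib)

lemma unit_cancel: "e ^ k * x \<in> m \<Longrightarrow> x \<in> m"
  using mult_mem[of "e ^ k * x" "e' ^ k"] unit_power[of k]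
  by (metis mult.assoc mult.commute mult_1)

text \<open>The saturation of \<open>m\<close> at \<open>s\<close> is stable because
  \<open>e\<close> is a unit, and it still contains no power of \<open>s\<close>; maximality makes
  it equal to \<open>m\<close>. So \<open>s\<close> is not a zero divisor modulo
  \<open>m\<close>.\<close>

lemma saturated:
  assumes "s ^ n * f \<in> m"
  shows "f \<in> m"
proof -
  define J where "J = {f. \<exists>k. s ^ k * f \<in> m}"
  have "ring_ideal J"
    unfolding ring_ideal_iff
  proof (intro conjI ballI allI)
    show "0 \<in> J" by (simp add: J_def)
    show "c * x \<in> J" if x: "x \<in> J" for c x
    proof -
      from x obtain k where "s ^ k * x \<in> m" by (auto simp: J_def)
      from mult_mem[OF this, of c] show ?thesis by (auto simp: J_def mult.left_commute)
    qed
    show "x + y \<in> J" if xy: "x \<in> J" "y \<in> J" for x y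
    proof -
      from xy obtain k l where "s ^ k * x \<in> m" "s ^ l * y \<in> m" by (auto simp: J_def)
      hence "s ^ l * (s ^ k * x) + s ^ k * (s ^ l * y) \<in> m" using add_mem mult_mem by blast
      hence "s ^ (k + l) * (x + y) \<in> m" by (simp add: power_add algebra_simps)
      thus ?thesis by (auto simp: J_def)
    qed
  qed
  moreover have "\<psi> x \<in> J" if x: "x \<in> J" for x
  proof -
    from x obtain k where k: "s ^ k * x \<in> m" by (auto simp: J_def)
    have "\<psi> (s ^ k * x) \<simeq> e ^ k * s ^ k * \<psi> x"
      using cong_mult[OF \<psi>_s_power, of "\<psi> x" "\<psi> x" k] by (simp add: \<psi>_mult)
    hence "e ^ k * (s ^ k * \<psi> x) \<in> m"
      using \<psi>_mem[OF k] cong_mem_iff by (simp add: mult.assoc)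
    thus ?thesis using unit_cancel by (auto simp: J_def)
  qed
  moreover have "m \<subseteq> J"
  proof
    fix x assume "x \<in> m"
    thus "x \<in> J" unfolding J_def by (auto intro: exI[of _ 0])
  qed
  moreover have "s ^ n \<notin> J" for n
  proof
    assume "s ^ n \<in> J"
    then obtain k where "s ^ k * s ^ n \<in> m" by (auto simp: J_def)
    thus False using avoid[of "k + n"] by (simp add: power_add)
  qed
  ultimately have "J = m"
    by (intro maximal) (auto simp: stable_ideal_def)
  thus ?thesis using assms by (auto simp: J_def)
qed

text \<open>The ideal generated by \<open>m\<close> and \<open>c\<close> is stable and larger than
  \<open>m\<close>, so it must contain a power of \<open>s\<close>. Constants outside
  \<open>m\<close> thus become units once \<open>s\<close> is inverted.\<close>

lemma constant_power_multiple:
  assumes c: "\<psi> c \<simeq> c" and "c \<notin> m"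
  shows "\<exists>n r. s ^ n \<simeq> r * c"
proof -
  define J where "J = {x. \<exists>r. x \<simeq> r * c}"
  have "ring_ideal J"
    unfolding ring_ideal_iff
  proof (intro conjI ballI allI)
    show "0 \<in> J" unfolding J_def by (auto intro: exI[of _ 0])
    show "a * x \<in> J" if x: "x \<in> J" for a x
    proof -
      from x obtain r where "x \<simeq> r * c" by (auto simp: J_def)
      from cong_mult[OF cong_refl this, of a] have "a * x \<simeq> (a * r) * c" by (simp add: algebra_simps)
      thus ?thesis by (auto simp: J_def)
    qed
    show "x + y \<in> J" if xy: "x \<in> J" "y \<in> J" for x y
    proof -
      from xy obtain r q where "x \<simeq> r * c" "y \<simeq> q * c" by (auto simp: J_def)
      from cong_add[OF this] have "x + y \<simeq> (r + q) * c" by (simp add: algebra_simps)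
      thus ?thesis by (auto simp: J_def)
    qed
  qed
  moreover have "\<psi> x \<in> J" if x: "x \<in> J" for x
  proof -
    from x obtain r where "x \<simeq> r * c" by (auto simp: J_def)
    from cong_\<psi>[OF this] have "\<psi> x \<simeq> \<psi> r * \<psi> c" by (simp add: \<psi>_mult)
    also have "\<psi> r * \<psi> c \<simeq> \<psi> r * c" using c by (intro cong_mult) auto
    finally show ?thesis by (auto simp: J_def)
  qed
  moreover have "m \<subseteq> J"
  proof
    fix x assume "x \<in> m"
    thus "x \<in> J" unfolding J_def by (auto simp: cong_0_iff intro: exI[of _ 0])
  qed
  moreover have "J \<noteq> m"
  proof -
    have "c \<in> J" unfolding J_def by (auto intro: exI[of _ 1])
    thus ?thesis using \<open>c \<notin> m\<close> by auto
  qed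
  ultimately have "\<exists>n. s ^ n \<in> J"
    using maximal[of J] by (auto simp: stable_ideal_def)
  thus ?thesis by (auto simp: J_def)
qed

text \<open>Linear factors of \<open>P\<close> are stripped off one at a time: either
  \<open>c\<close> is congruent to the root, or \<open>c - scalar \<alpha>\<close> divides a power
  of \<open>s\<close> and can be cancelled by \<open>saturated\<close>.\<close>

lemma root_mod:
  assumes c: "\<psi> c \<simeq> c" and "P \<noteq> 0" "eval_scalar P c \<in> m"
  shows "\<exists>\<mu>. c \<simeq> scalar \<mu>"
  using assms(2,3)
proof (induction "degree P" arbitrary: P rule: less_induct)
  case less
  show ?case
  proof (cases "degree P = 0")
    case True
    then obtain x where "P = [:x:]" by (metis degree_eq_zeroE)
    hence "x \<noteq> 0" "scalar x \<in> m" using less by auto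
    hence "1 \<in> m" using mult_mem[of "scalar x" "scalar (inverse x)"] scalar_inverse by simp
    thus ?thesis using one_not_mem by simp
  next
    case False
    then obtain \<alpha> where "poly P \<alpha> = 0"
      using fundamental_theorem_of_algebra[of P] constant_degree[of P] by metis
    then obtain Q where Q: "P = [:-\<alpha>, 1:] * Q" by (metis dvdE poly_eq_0_iff_dvd)
    have "Q \<noteq> 0" using Q less by auto
    hence deg: "degree Q < degree P" by (simp add: Q degree_mult_eq del: mult_pCons_left)
    have ev: "(c - scalar \<alpha>) * eval_scalar Q c \<in> m"
      using less(3) by (simp add: Q eval_scalar_mult scalar_uminus del: mult_pCons_left)
    show ?thesis
    proof (cases "c \<simeq> scalar \<alpha>")
      case False
      have "\<psi> (c - scalar \<alpha>) \<simeq> c - scalar \<alpha>"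
        using c by (simp add: cong_mod_def \<psi>_diff \<psi>_scalar)
      from constant_power_multiple[OF this] False obtain n r
        where "s ^ n \<simeq> r * (c - scalar \<alpha>)" by (auto simp: cong_mod_def)
      from cong_mult[OF this, of "eval_scalar Q c" "eval_scalar Q c"]
      have "s ^ n * eval_scalar Q c \<simeq> r * ((c - scalar \<alpha>) * eval_scalar Q c)"
        by (simp add: mult.assoc)
      hence "s ^ n * eval_scalar Q c \<in> m" using mult_mem[OF ev, of r] cong_mem_iff by blast
      from saturated[OF this] show ?thesis using less(1)[OF deg \<open>Q \<noteq> 0\<close>] by blast
    qed blast
  qed
qed

text \<open>Infinitely many of the elements \<open>r l\<close> use the same number \<open>n\<close>
  of generators, and \<open>n + 1\<close> vectors in a space spanned by \<open>n\<close> are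
  dependent.\<close>

lemma relation_of_uncountable:
  fixes r :: "complex \<Rightarrow> 'a"
  assumes "uncountable L"
  shows "\<exists>F x. finite F \<and> F \<noteq> {} \<and> F \<subseteq> L \<and> (\<forall>l\<in>F. x l \<in> K \<and> x l \<noteq> 0) \<and>
           (\<Sum>l\<in>F. \<kappa> (x l) * r l) \<in> m"
proof -
  have "\<exists>n k. (\<forall>i. k i \<in> K) \<and> r l \<simeq> (\<Sum>i<n. \<kappa> (k i) * t i)" for l
    using countably_spanned unfolding spanned_mod_def cong_mod_def by blast
  then obtain N k where Nk: "\<And>l i. k l i \<in> K"
      "\<And>l. r l \<simeq> (\<Sum>i<N l. \<kappa> (k l i) * t i)" for l :: complex
    by metis
  have "\<exists>n. infinite {l\<in>L. N l = n}"
  proof (rule ccontr)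
    assume "\<not> ?thesis"
    hence "countable (\<Union>n. {l\<in>L. N l = n})" by (intro countable_UN) (auto intro: countable_finite)
    moreover have "(\<Union>n. {l\<in>L. N l = n}) = L" by auto
    ultimately show False using assms by simp
  qed
  then obtain n where "infinite {l\<in>L. N l = n}" by blast
  then obtain I where I: "I \<subseteq> {l\<in>L. N l = n}" "card I = Suc n" "finite I"
    using infinite_arbitrarily_large by blast
  from linear_relation[of "{..<n}" I k] Nk I have "\<exists>x. (\<forall>i. x i \<in> K) \<and> (\<exists>i\<in>I. x i \<noteq> 0) \<and>
      (\<forall>i\<in>{..<n}. (\<Sum>l\<in>I. x l * k l i) = 0)" by simp
  then obtain x where x: "\<forall>i. x i \<in> K"
      "\<exists>i\<in>I. x i \<noteq> 0" "\<forall>i\<in>{..<n}. (\<Sum>l\<in>I. x l * k l i) = 0" by blast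
  \<comment> \<open>Only the support is kept, so that the cardinality of \<open>F\<close> measures
    the length of the relation.\<close>
  define F where "F = {l\<in>I. x l \<noteq> 0}"
  have "(\<Sum>l\<in>F. \<kappa> (x l) * r l) = (\<Sum>l\<in>I. \<kappa> (x l) * r l)"
    using I by (intro sum.mono_neutral_left) (auto simp: F_def)
  also have "\<dots> \<simeq> (\<Sum>l\<in>I. \<kappa> (x l) * (\<Sum>i<n. \<kappa> (k l i) * t i))"
  proof (intro cong_sum cong_mult)
    fix l assume "l \<in> I"
    thus "r l \<simeq> (\<Sum>i<n. \<kappa> (k l i) * t i)" using Nk(2)[of l] I by auto
  qed auto
  also have "(\<Sum>l\<in>I. \<kappa> (x l) * (\<Sum>i<n. \<kappa> (k l i) * t i)) =
      (\<Sum>i<n. \<kappa> (\<Sum>l\<in>I. x l * k l i) * t i)"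
    using x(1) Nk(1)
    by (simp add: \<kappa>_sum \<kappa>_mult K_mult sum_distrib_left sum_distrib_right mult.assoc)
       (rule sum.swap)
  also have "\<dots> = 0" using x(3) by simp
  finally have "(\<Sum>l\<in>F. \<kappa> (x l) * r l) \<in> m" by (simp add: cong_0_iff)
  moreover have "finite F" "F \<noteq> {}" "F \<subseteq> L" "\<forall>l\<in>F. x l \<in> K \<and> x l \<noteq> 0"
    using I x by (auto simp: F_def)
  ultimately show ?thesis by blast
qed

text \<open>
  If no \<open>c - \<mu>\<close> lies in \<open>m\<close>, every \<open>c - \<mu>\<close> divides a power of \<open>s\<close> modulo \<open>m\<close>. The uncountably
  many cofactors are linearly dependent over \<open>K\<close>, and a shortest relation between them
  has constant coefficients. Clearing denominators gives \<open>P(c) \<in> m\<close> for a complex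
  polynomial \<open>P\<close>, which splits.
\<close>

lemma constant_mod:
  assumes c: "\<psi> c \<simeq> c"
  shows "\<exists>\<mu>. c \<simeq> scalar \<mu>"
proof (rule ccontr)
  assume none: "\<not> ?thesis"
  have "\<exists>n r. s ^ n \<simeq> r * (c - scalar \<mu>)" for \<mu>
    by (rule constant_power_multiple)
       (use none c in \<open>auto simp: cong_mod_def \<psi>_diff \<psi>_scalar\<close>)
  then obtain N r where r: "\<And>\<mu>. s ^ N \<mu> \<simeq> r \<mu> * (c - scalar \<mu>)" by metis
  \<comment> \<open>The cofactors must share one exponent, because modulo \<open>m\<close> the map
    \<open>\<psi>\<close> multiplies \<open>r l\<close> by \<open>e ^ N l\<close>.\<close>
  have "\<exists>n. uncountable {\<mu>. N \<mu> = n}"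
  proof (rule ccontr)
    assume "\<not> ?thesis"
    hence "countable (\<Union>n. {\<mu>. N \<mu> = n})" by (intro countable_UN) auto
    moreover have "(\<Union>n. {\<mu>. N \<mu> = n}) = UNIV" by auto
    ultimately show False using uncountable_UNIV_complex by simp
  qed
  then obtain n where n: "uncountable {\<mu>. N \<mu> = n}" by blast
  define rel where "rel = (\<lambda>F x. finite F \<and> F \<noteq> {} \<and> F \<subseteq> {\<mu>. N \<mu> = n} \<and>
    (\<forall>l\<in>F. x l \<in> K \<and> x l \<noteq> 0) \<and> (\<Sum>l\<in>F. \<kappa> (x l) * r l) \<in> m)"
  have "\<exists>F. \<exists>x. rel F x" using relation_of_uncountable[OF n, of r] by (auto simp: rel_def)
  then obtain F where F: "\<exists>x. rel F x" and min: "\<And>F'. card F' < card F \<Longrightarrow> \<not> (\<exists>x. rel F' x)"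
    using ex_has_least_nat[of "\<lambda>F. \<exists>x. rel F x" _ card] by (metis not_less)
  from F obtain x where x: "rel F x" by blast
  then obtain l0 where l0: "l0 \<in> F" by (auto simp: rel_def)
  \<comment> \<open>With coefficient 1 at \<open>l0\<close>, the relation and its image under
    \<open>\<psi>\<close>, divided by \<open>e ^ n\<close>, have the same term there, so their
    difference is shorter.\<close>
  define y where "y = (\<lambda>l. x l / x l0)"
  have xK: "x l \<in> K" "x l \<noteq> 0" if "l \<in> F" for l using x that by (auto simp: rel_def)
  have yK: "y l \<in> K" "y l \<noteq> 0" if "l \<in> F" for l
    using xK that l0 by (auto simp: y_def intro!: K_closed)
  have fin: "finite F" using x by (simp add: rel_def)
  have "\<kappa> (inverse (x l0)) * (\<Sum>l\<in>F. \<kappa> (x l) * r l) \<in> m"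
    using x by (intro mult_mem) (simp add: rel_def)
  also have "\<kappa> (inverse (x l0)) * (\<Sum>l\<in>F. \<kappa> (x l) * r l) = (\<Sum>l\<in>F. \<kappa> (y l) * r l)"
    unfolding sum_distrib_left y_def
    by (intro sum.cong refl) (use xK l0 in \<open>simp add: \<kappa>_mult K_inverse divide_inverse mult.assoc mult.left_commute\<close>)
  finally have y: "(\<Sum>l\<in>F. \<kappa> (y l) * r l) \<in> m" .
  \<comment> \<open>Modulo \<open>m\<close>, \<open>r l\<close> is \<open>s ^ n\<close> divided by
    the constant \<open>c - scalar l\<close>, so it inherits the factor of
    \<open>s ^ n\<close>.\<close>
  have rinv: "\<psi> (r l) \<simeq> e ^ n * r l" if "l \<in> F" for l
  proof -
    have Nl: "N l = n" using that x by (auto simp: rel_def)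
    have "\<psi> (s ^ n) \<simeq> \<psi> (r l) * \<psi> (c - scalar l)"
      using cong_\<psi>[OF r[of l]] by (simp add: Nl \<psi>_mult)
    also have "\<dots> \<simeq> \<psi> (r l) * (c - scalar l)"
      using cong_diff[OF c cong_refl] by (intro cong_mult) (auto simp: \<psi>_diff \<psi>_scalar)
    finally have 1: "\<psi> (r l) * (c - scalar l) \<simeq> \<psi> (s ^ n)" by (rule cong_sym)
    also have "\<dots> \<simeq> e ^ n * s ^ n" by (rule \<psi>_s_power)
    also have "\<dots> \<simeq> e ^ n * (r l * (c - scalar l))"
      using r[of l] Nl by (intro cong_mult) auto
    finally have 1: "(\<psi> (r l) - e ^ n * r l) * (c - scalar l) \<in> m"
      by (simp add: cong_mod_def algebra_simps)
    have "(\<psi> (r l) - e ^ n * r l) * s ^ n \<simeq> (\<psi> (r l) - e ^ n * r l) * (r l * (c - scalar l))"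
      using r[of l] Nl by (intro cong_mult) auto
    also have "\<dots> = r l * ((\<psi> (r l) - e ^ n * r l) * (c - scalar l))" by (simp add: ac_simps)
    finally have "s ^ n * (\<psi> (r l) - e ^ n * r l) \<in> m"
      using mult_mem[OF 1, of "r l"] cong_mem_iff by (metis mult.commute)
    thus ?thesis unfolding cong_mod_def by (rule saturated)
  qed
  have "e ^ n * (\<Sum>l\<in>F. \<kappa> (\<phi> (y l)) * r l) = (\<Sum>l\<in>F. \<kappa> (\<phi> (y l)) * (e ^ n * r l))"
    by (simp add: sum_distrib_left mult.left_commute)
  also have "\<dots> \<simeq> (\<Sum>l\<in>F. \<kappa> (\<phi> (y l)) * \<psi> (r l))"
    by (intro cong_sum cong_mult cong_sym[OF rinv]) auto
  also have "\<dots> = \<psi> (\<Sum>l\<in>F. \<kappa> (y l) * r l)"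
    unfolding \<psi>_sum \<psi>_mult by (intro sum.cong refl) (simp add: \<psi>_\<kappa> yK)
  finally have "(\<Sum>l\<in>F. \<kappa> (\<phi> (y l)) * r l) \<in> m"
    using \<psi>_mem[OF y] cong_mem_iff unit_cancel by blast
  from diff_mem[OF this y] have "(\<Sum>l\<in>F. \<kappa> (\<phi> (y l)) * r l - \<kappa> (y l) * r l) \<in> m"
    by (simp add: sum_subtractf)
  also have "(\<Sum>l\<in>F. \<kappa> (\<phi> (y l)) * r l - \<kappa> (y l) * r l) = (\<Sum>l\<in>F. \<kappa> (\<phi> (y l) - y l) * r l)"
    by (intro sum.cong refl) (simp add: \<kappa>_diff yK \<phi>_K left_diff_distrib)
  also have "\<dots> = (\<Sum>l\<in>{l\<in>F. \<phi> (y l) - y l \<noteq> 0}. \<kappa> (\<phi> (y l) - y l) * r l)"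
    using fin by (intro sum.mono_neutral_right) auto
  finally have "rel {l\<in>F. \<phi> (y l) - y l \<noteq> 0} (\<lambda>l. \<phi> (y l) - y l)"
    if "{l\<in>F. \<phi> (y l) - y l \<noteq> 0} \<noteq> {}"
    using that x fin yK by (auto simp: rel_def K_diff \<phi>_K)
  moreover have "card {l\<in>F. \<phi> (y l) - y l \<noteq> 0} < card F"
  proof (intro psubset_card_mono psubsetI)
    have "y l0 = 1" using xK l0 by (simp add: y_def)
    hence "l0 \<notin> {l\<in>F. \<phi> (y l) - y l \<noteq> 0}" by (simp add: \<phi>_one)
    thus "{l\<in>F. \<phi> (y l) - y l \<noteq> 0} \<noteq> F" using l0 by metis
  qed (use fin in auto)
  ultimately have "\<forall>l\<in>F. \<phi> (y l) = y l" using min by auto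
  hence "\<forall>l\<in>F. \<exists>z. y l = j z" using constants yK by blast
  then obtain z where z: "\<And>l. l \<in> F \<Longrightarrow> y l = j (z l)" by metis
  \<comment> \<open>The numerator of the sum of the fractions z_l / (X - l) over their common
    denominator. It is not zero, since at \<open>l0\<close> only one summand survives.\<close>
  define P where "P = (\<Sum>l\<in>F. smult (z l) (\<Prod>k\<in>F - {l}. [:- k, 1:]))"
  have "poly P l0 = (\<Sum>l\<in>F. if l = l0 then z l0 * (\<Prod>k\<in>F - {l0}. l0 - k) else 0)"
    unfolding P_def poly_sum
    by (intro sum.cong refl) (use l0 fin in \<open>auto simp: poly_prod prod_zero_iff\<close>)
  also have "\<dots> = z l0 * (\<Prod>k\<in>F - {l0}. l0 - k)"
    using l0 fin by (simp add: sum.delta)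
  also have "\<dots> \<noteq> 0"
  proof -
    have "j (z l0) \<noteq> 0" using z[OF l0] yK(2)[OF l0] by simp
    hence "z l0 \<noteq> 0" by auto
    thus ?thesis using fin by (auto simp: prod_zero_iff)
  qed
  finally have "P \<noteq> 0" by auto
  have "s ^ n * eval_scalar P c \<simeq> (\<Prod>k\<in>F. c - scalar k) * (\<Sum>l\<in>F. scalar (z l) * r l)"
  proof -
    have "s ^ n * eval_scalar P c =
        (\<Sum>l\<in>F. scalar (z l) * (s ^ n * (\<Prod>k\<in>F - {l}. c - scalar k)))"
      by (simp add: P_def eval_scalar_sum eval_scalar_smult eval_scalar_prod sum_distrib_left
          scalar_uminus mult.left_commute)
    also have "\<dots> \<simeq> (\<Sum>l\<in>F. scalar (z l) * (r l * (c - scalar l) * (\<Prod>k\<in>F - {l}. c - scalar k)))"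
    proof (intro cong_sum cong_mult)
      fix l assume "l \<in> F"
      thus "s ^ n \<simeq> r l * (c - scalar l)" using r[of l] x by (auto simp: rel_def)
    qed auto
    also have "\<dots> = (\<Prod>k\<in>F. c - scalar k) * (\<Sum>l\<in>F. scalar (z l) * r l)"
      unfolding sum_distrib_left
      by (intro sum.cong refl) (use fin in \<open>simp add: prod.remove ac_simps\<close>)
    finally show ?thesis .
  qed
  moreover have "(\<Sum>l\<in>F. scalar (z l) * r l) \<in> m"
    using y z by simp
  ultimately have "s ^ n * eval_scalar P c \<in> m"
    using mult_mem cong_mem_iff by blast
  from saturated[OF this] root_mod[OF c \<open>P \<noteq> 0\<close>] none show False by blast
qed

end

section \<open>The tensor square\<close>

text \<open>The multiplicative monoid of the ring in additive notation, since the product of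
  \<open>Poly_Mapping\<close> is a convolution over an additive monoid.\<close>

typedef 'a mul = "UNIV :: 'a set"
  morphisms of_mul Mul by simp

instantiation mul :: (comm_monoid_mult) comm_monoid_add
begin

definition zero_mul :: "'a mul" where "0 = Mul 1"

definition plus_mul :: "'a mul \<Rightarrow> 'a mul \<Rightarrow> 'a mul" where
  "x + y = Mul (of_mul x * of_mul y)"

instance
  by standard (auto simp: zero_mul_def plus_mul_def Mul_inverse of_mul_inverse ac_simps)

end

text \<open>
  The tensor square of a \<open>K\<close>-algebra \<open>R\<close> is presented as a quotient of the monoid algebra
  \<open>R[(R, *)]\<close>; the generator \<open>tens a b\<close> stands for \<open>a \<otimes> b\<close>.
\<close>

type_synonym 'a monoid_algebra = "'a mul \<Rightarrow>\<^sub>0 'a"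

definition tens :: "'a::comm_ring_1 \<Rightarrow> 'a \<Rightarrow> 'a monoid_algebra" where
  "tens a b = Poly_Mapping.single (Mul b) a"

lemma tens_mult: "tens a b * tens c d = tens (a * c) (b * d)"
  by (simp add: tens_def mult_single plus_mul_def Mul_inverse)

lemma tens_one: "tens 1 1 = 1"
  by (simp add: tens_def zero_mul_def[symmetric])

lemma tens_add: "tens (a + a') b = tens a b + tens a' b"
  by (simp add: tens_def single_add)

lemma tens_zero [simp]: "tens 0 b = 0"
  by (simp add: tens_def)

lemma tens_uminus: "tens (- a) b = - tens a b"
  by (simp add: tens_def single_uminus)

lemma tens_diff: "tens (a - a') b = tens a b - tens a' b"
  by (simp add: tens_def single_diff)

lemma tens_sum: "tens (sum f A) b = (\<Sum>i\<in>A. tens (f i) b)"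
  by (induction A rule: infinite_finite_induct) (auto simp: tens_add)

lemma tens_power: "tens a b ^ n = tens (a ^ n) (b ^ n)"
  by (induction n) (auto simp: tens_one tens_mult)

lemma monoid_algebra_induct [case_names zero tens add]:
  fixes f :: "'a::comm_ring_1 monoid_algebra"
  assumes "P 0" "\<And>a b. P (tens a b)" "\<And>f g. P f \<Longrightarrow> P g \<Longrightarrow> P (f + g)"
  shows "P f"
proof -
  have eq: "f = (\<Sum>k\<in>Poly_Mapping.keys f. tens (Poly_Mapping.lookup f k) (of_mul k))"
  proof (rule poly_mapping_eqI)
    fix x
    have "(\<Sum>k\<in>Poly_Mapping.keys f. Poly_Mapping.lookup (tens (Poly_Mapping.lookup f k) (of_mul k)) x) =
          (\<Sum>k\<in>Poly_Mapping.keys f. if k = x then Poly_Mapping.lookup f x else 0)"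
      by (intro sum.cong) (auto simp: tens_def of_mul_inverse lookup_single when_def)
    also have "\<dots> = Poly_Mapping.lookup f x"
      by (simp add: sum.delta in_keys_iff)
    finally show "Poly_Mapping.lookup f x =
        Poly_Mapping.lookup (\<Sum>k\<in>Poly_Mapping.keys f. tens (Poly_Mapping.lookup f k) (of_mul k)) x"
      by (simp add: lookup_sum)
  qed
  have "P (\<Sum>k\<in>A. tens (Poly_Mapping.lookup f k) (of_mul k))" if "finite A" for A
    using that by induction (auto intro: assms)
  from this[OF finite_keys[of f]] show ?thesis unfolding eq[symmetric] .
qed

text \<open>Second entries are free generators, so additivity in the second factor is imposed later,
  through \<open>tensor_kernel\<close>. Linear functionals, the endomorphism of the tensor square
  and specialisations all act by maps of this kind.\<close>

definition tens_lift :: "('a::comm_ring_1 \<Rightarrow> 'b::comm_ring_1) \<Rightarrow> ('a \<Rightarrow> 'b) \<Rightarrow> 'a monoid_algebra \<Rightarrow> 'b" where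
  "tens_lift p q f = (\<Sum>k\<in>Poly_Mapping.keys f. p (Poly_Mapping.lookup f k) * q (of_mul k))"

lemma additive_0:
  fixes p :: "'a::monoid_add \<Rightarrow> 'b::ab_group_add"
  assumes "\<And>x y. p (x + y) = p x + p y"
  shows "p 0 = 0"
  using assms[of 0 0] by simp

lemma tens_lift_superset:
  assumes "p 0 = 0" "finite A" "Poly_Mapping.keys f \<subseteq> A"
  shows "tens_lift p q f = (\<Sum>k\<in>A. p (Poly_Mapping.lookup f k) * q (of_mul k))"
  unfolding tens_lift_def
proof (rule sum.mono_neutral_left)
  show "\<forall>k\<in>A - Poly_Mapping.keys f. p (Poly_Mapping.lookup f k) * q (of_mul k) = 0"
    using assms(1) by (metis DiffD2 in_keys_iff mult_zero_left)
qed (use assms in auto)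

lemma tens_lift_zero [simp]: "tens_lift p q 0 = 0"
  by (simp add: tens_lift_def)

lemma tens_lift_add:
  assumes p: "\<And>x y. p (x + y) = p x + p y"
  shows "tens_lift p q (f + g) = tens_lift p q f + tens_lift p q g"
proof -
  let ?A = "Poly_Mapping.keys f \<union> Poly_Mapping.keys g"
  have p0: "p 0 = 0" using p by (rule additive_0)
  have "tens_lift p q h = (\<Sum>k\<in>?A. p (Poly_Mapping.lookup h k) * q (of_mul k))"
    if "Poly_Mapping.keys h \<subseteq> ?A" for h
    by (rule tens_lift_superset) (use p0 that in auto)
  note lift = this
  have "tens_lift p q (f + g) = (\<Sum>k\<in>?A. p (Poly_Mapping.lookup (f + g) k) * q (of_mul k))"
    by (rule lift) (rule keys_add)
  also have "\<dots> = (\<Sum>k\<in>?A. p (Poly_Mapping.lookup f k) * q (of_mul k)) +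
      (\<Sum>k\<in>?A. p (Poly_Mapping.lookup g k) * q (of_mul k))"
    by (simp only: lookup_add p sum.distrib distrib_right)
  also have "\<dots> = tens_lift p q f + tens_lift p q g"
    by (simp only: lift Un_upper1 Un_upper2)
  finally show ?thesis .
qed

lemma tens_lift_tens:
  assumes p: "\<And>x y. p (x + y) = p x + p y"
  shows "tens_lift p q (tens a b) = p a * q b"
proof -
  have "p 0 = 0" using p by (rule additive_0)
  thus ?thesis by (simp add: tens_lift_def tens_def Mul_inverse)
qed

lemma tens_lift_mult:
  assumes p: "\<And>x y. p (x + y) = p x + p y" "\<And>x y. p (x * y) = p x * p y"
    and q: "\<And>x y. q (x * y) = q x * q y"
  shows "tens_lift p q (f * g) = tens_lift p q f * tens_lift p q g"
proof (induction f rule: monoid_algebra_induct)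
  case (tens a b)
  show ?case
    by (induction g rule: monoid_algebra_induct)
       (simp_all add: tens_mult tens_lift_tens[OF p(1)] tens_lift_add[OF p(1)] p(2) q
         distrib_left distrib_right ac_simps)
qed (simp_all add: distrib_right tens_lift_add[OF p(1)])


section \<open>Linear functionals and binary forms over \<open>K\<close>\<close>

context difference_algebra
begin

text \<open>Values in \<open>R\<close> rather than in \<open>K\<close> allow products
  \<open>T a * b\<close> and keep the class closed under conjugation by
  \<open>\<psi>\<close>.\<close>

definition K_linear :: "('a \<Rightarrow> 'a) \<Rightarrow> bool" where
  "K_linear T \<longleftrightarrow> (\<forall>x y. T (x + y) = T x + T y) \<and> (\<forall>k\<in>K. \<forall>x. T (\<kappa> k * x) = \<kappa> k * T x)"

definition K_subspace :: "'a set \<Rightarrow> bool" where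
  "K_subspace W \<longleftrightarrow> 0 \<in> W \<and> (\<forall>x\<in>W. \<forall>y\<in>W. x + y \<in> W) \<and> (\<forall>k\<in>K. \<forall>x\<in>W. \<kappa> k * x \<in> W)"

text \<open>A subspace \<open>V\<close> that is maximal among those containing \<open>W\<close> but
  not \<open>y\<close> is a complement of the line of \<open>y\<close>; the functional is the
  coefficient of \<open>y\<close>.\<close>

lemma K_linear_functional:
  assumes W: "K_subspace W" and "y \<notin> W"
  shows "\<exists>T. K_linear T \<and> T y = 1 \<and> (\<forall>w\<in>W. T w = 0)"
proof -
  define \<A> where "\<A> = {V. K_subspace V \<and> W \<subseteq> V \<and> y \<notin> V}"
  have "\<exists>M\<in>\<A>. \<forall>X\<in>\<A>. M \<subseteq> X \<longrightarrow> X = M"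
  proof (rule subset_Zorn_nonempty)
    show "\<A> \<noteq> {}" using assms unfolding \<A>_def by blast
    fix C assume C: "C \<noteq> {}" "subset.chain \<A> C"
    have chain: "X \<subseteq> Y \<or> Y \<subseteq> X" if "X \<in> C" "Y \<in> C" for X Y
      using C(2) that by (auto simp: subset.chain_def)
    have mem: "K_subspace X" "W \<subseteq> X" "y \<notin> X" if "X \<in> C" for X
      using C(2) that by (auto simp: subset.chain_def \<A>_def)
    have "u + v \<in> \<Union>C" if uv: "u \<in> \<Union>C" "v \<in> \<Union>C" for u v
    proof -
      from uv obtain X Y where "X \<in> C" "Y \<in> C" "u \<in> X" "v \<in> Y" by blast
      then obtain Z where "Z \<in> C" "u \<in> Z" "v \<in> Z" using chain by blast
      thus ?thesis using mem(1)[of Z] by (auto simp: K_subspace_def)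
    qed
    moreover have "0 \<in> \<Union>C" using C(1) mem(1) by (auto simp: K_subspace_def)
    moreover have "\<kappa> k * u \<in> \<Union>C" if "u \<in> \<Union>C" "k \<in> K" for u k
      using that mem(1) unfolding K_subspace_def by blast
    ultimately have "K_subspace (\<Union>C)" by (auto simp: K_subspace_def)
    thus "\<Union>C \<in> \<A>" using C(1) mem(2,3) by (auto simp: \<A>_def)
  qed
  then obtain V where V: "K_subspace V" "W \<subseteq> V" "y \<notin> V"
    and max: "\<And>X. K_subspace X \<Longrightarrow> V \<subseteq> X \<Longrightarrow> y \<notin> X \<Longrightarrow> X = V"
    by (auto simp: \<A>_def)
  have V0: "0 \<in> V" and Vadd: "u \<in> V \<Longrightarrow> v \<in> V \<Longrightarrow> u + v \<in> V"
    and Vs: "k \<in> K \<Longrightarrow> u \<in> V \<Longrightarrow> \<kappa> k * u \<in> V" for u v k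
    using V(1) by (auto simp: K_subspace_def)
  have Vdiff: "u - v \<in> V" if "u \<in> V" "v \<in> V" for u v
    using Vadd[OF that(1) Vs[OF j_K[of "-1"] that(2)]] by (simp add: scalar_uminus)
  have ex: "\<exists>k\<in>K. x - \<kappa> k * y \<in> V" for x
  proof (cases "x \<in> V")
    case True
    thus ?thesis by (intro bexI[of _ 0]) auto
  next
    case False
    \<comment> \<open>Maximality of \<open>V\<close> puts \<open>y\<close> into V + K x, and the
      resulting relation is solved for \<open>x\<close>.\<close>
    define X where "X = {v + \<kappa> k * x | v k. v \<in> V \<and> k \<in> K}"
    have "K_subspace X"
      unfolding K_subspace_def
    proof (intro conjI ballI)
      show "0 \<in> X" unfolding X_def using V0 by (auto intro!: exI[of _ 0])
      show "u + v \<in> X" if uv: "u \<in> X" "v \<in> X" for u v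
      proof -
        from uv obtain u' k v' l where "u = u' + \<kappa> k * x" "v = v' + \<kappa> l * x"
          "u' \<in> V" "v' \<in> V" "k \<in> K" "l \<in> K" by (auto simp: X_def)
        thus ?thesis unfolding X_def
          by (auto simp: \<kappa>_add algebra_simps intro!: exI[of _ "u' + v'"] exI[of _ "k + l"]
              Vadd K_add)
      qed
      show "\<kappa> l * u \<in> X" if "l \<in> K" "u \<in> X" for l u
      proof -
        from that obtain u' k where "u = u' + \<kappa> k * x" "u' \<in> V" "k \<in> K" by (auto simp: X_def)
        thus ?thesis unfolding X_def using that
          by (auto simp: \<kappa>_mult algebra_simps intro!: exI[of _ "\<kappa> l * u'"] exI[of _ "l * k"]
              Vs K_mult)
      qed
    qed
    moreover have "V \<subseteq> X"
    proof
      fix v assume "v \<in> V"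
      thus "v \<in> X" unfolding X_def by (intro CollectI exI[of _ v] exI[of _ 0]) auto
    qed
    moreover have "x \<in> X" unfolding X_def using V0 
      by (intro CollectI exI[of _ "0 :: 'a"] exI[of _ "1 :: 'k"]) (auto simp: \<kappa>_one)
    ultimately have "y \<in> X" using max[of X] False by auto
    then obtain v k where vk: "y = v + \<kappa> k * x" "v \<in> V" "k \<in> K" by (auto simp: X_def)
    hence "k \<noteq> 0" using V(3) by auto
    hence inv: "\<kappa> (inverse k) * \<kappa> k = 1" using vk \<kappa>_inverse by simp
    have "x - \<kappa> (inverse k) * y = 0 - \<kappa> (inverse k) * v"
      unfolding vk(1) using inv by (simp add: distrib_left mult.assoc[symmetric])
    also have "\<dots> \<in> V" using vk by (intro Vdiff Vs V0 K_inverse)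
    finally show ?thesis using vk K_inverse by blast
  qed
  have uniq: "k = l" if kl: "k \<in> K" "l \<in> K" "x - \<kappa> k * y \<in> V" "x - \<kappa> l * y \<in> V" for x k l
  proof (rule ccontr)
    assume "k \<noteq> l"
    have "\<kappa> (l - k) * y \<in> V"
      using Vdiff[OF kl(3,4)] kl by (simp add: \<kappa>_diff algebra_simps)
    from Vs[OF K_inverse[OF K_diff[OF kl(2,1)]] this] have "y \<in> V"
      using \<kappa>_inverse[OF K_diff[OF kl(2,1)]] \<open>k \<noteq> l\<close> by (simp add: mult.assoc[symmetric])
    thus False using V(3) by simp
  qed
  obtain c where c: "\<And>x. c x \<in> K" "\<And>x. x - \<kappa> (c x) * y \<in> V" using ex by metis
  have cI: "c x = k" if "k \<in> K" "x - \<kappa> k * y \<in> V" for x k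
    using uniq[OF c(1) that(1) c(2) that(2)] .
  have add: "c (x + z) = c x + c z" for x z
  proof (rule cI)
    show "x + z - \<kappa> (c x + c z) * y \<in> V"
      using Vadd[OF c(2)[of x] c(2)[of z]] c(1) by (simp add: \<kappa>_add algebra_simps)
  qed (intro K_add c)
  have scale: "c (\<kappa> k * x) = k * c x" if "k \<in> K" for k x
  proof (rule cI)
    show "\<kappa> k * x - \<kappa> (k * c x) * y \<in> V"
      using Vs[OF that c(2)[of x]] c(1) that by (simp add: \<kappa>_mult algebra_simps)
  qed (intro K_mult c that)
  have "K_linear (\<lambda>x. \<kappa> (c x))"
    using c(1) by (auto simp: K_linear_def add scale \<kappa>_add \<kappa>_mult)
  moreover have "c y = 1" by (rule cI) (auto simp: \<kappa>_one V0)
  moreover have "c w = 0" if "w \<in> W" for w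
    by (rule cI) (use that V(2) in auto)
  ultimately show ?thesis by (intro exI[of _ "\<lambda>x. \<kappa> (c x)"]) (auto simp: \<kappa>_one)
qed

definition form :: "(nat \<Rightarrow> 'k) \<Rightarrow> nat \<Rightarrow> 'a \<Rightarrow> 'a \<Rightarrow> 'a" where
  "form f n x y = (\<Sum>k\<le>n. \<kappa> (f k) * (x ^ (n - k) * y ^ k))"

text \<open>A linear dependence over \<open>K\<close> between the monomials of degree
  \<open>n\<close>; in degree 1 it is a dependence of \<open>x\<close> and \<open>y\<close>
  themselves.\<close>

definition form_vanishes :: "nat \<Rightarrow> 'a \<Rightarrow> 'a \<Rightarrow> bool" where
  "form_vanishes n x y \<longleftrightarrow> (\<exists>f. (\<forall>k. f k \<in> K) \<and> (\<exists>k\<le>n. f k \<noteq> 0) \<and> form f n x y = 0)"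

text \<open>
  Since \<open>K\<close> is a field, an element of \<open>R \<otimes> R\<close> vanishes if and only if all maps
  \<open>x \<otimes> y \<mapsto> T x * y\<close> with \<open>T\<close> linear over \<open>K\<close> kill it.
\<close>

definition tensor_kernel :: "'a monoid_algebra set" where
  "tensor_kernel = {f. \<forall>T. K_linear T \<longrightarrow> tens_lift T id f = 0}"

lemma scalar_of_nat: "scalar (of_nat n) = of_nat n"
  by (induction n) (auto simp: scalar_add)

lemma K_subspace_combinations:
  "K_subspace {x. \<exists>f. (\<forall>k. f k \<in> K) \<and> x = (\<Sum>k\<in>S. \<kappa> (f k) * g k)}"
  unfolding K_subspace_def
proof (intro conjI ballI)
  fix x y
  assume "x \<in> {x. \<exists>f. (\<forall>k. f k \<in> K) \<and> x = (\<Sum>k\<in>S. \<kappa> (f k) * g k)}"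
    and "y \<in> {x. \<exists>f. (\<forall>k. f k \<in> K) \<and> x = (\<Sum>k\<in>S. \<kappa> (f k) * g k)}"
  then obtain f f' where "\<forall>k. f k \<in> K" "x = (\<Sum>k\<in>S. \<kappa> (f k) * g k)"
    "\<forall>k. f' k \<in> K" "y = (\<Sum>k\<in>S. \<kappa> (f' k) * g k)" by auto
  thus "x + y \<in> {x. \<exists>f. (\<forall>k. f k \<in> K) \<and> x = (\<Sum>k\<in>S. \<kappa> (f k) * g k)}"
    by (auto intro!: exI[of _ "\<lambda>k. f k + f' k"] simp: K_add \<kappa>_add distrib_right sum.distrib)
next
  fix l x
  assume "x \<in> {x. \<exists>f. (\<forall>k. f k \<in> K) \<and> x = (\<Sum>k\<in>S. \<kappa> (f k) * g k)}" and l: "l \<in> K"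
  then obtain f where "\<forall>k. f k \<in> K" "x = (\<Sum>k\<in>S. \<kappa> (f k) * g k)" by auto
  thus "\<kappa> l * x \<in> {x. \<exists>f. (\<forall>k. f k \<in> K) \<and> x = (\<Sum>k\<in>S. \<kappa> (f k) * g k)}"
    using l by (auto intro!: exI[of _ "\<lambda>k. l * f k"] simp: K_mult \<kappa>_mult sum_distrib_left mult.assoc)
qed (auto intro!: exI[of _ "\<lambda>_. 0"])

text \<open>The leading monomial is separated from the others by a linear functional.\<close>

lemma wronskian_power_in_kernel:
  assumes "(tens x y - tens y x) ^ n \<in> tensor_kernel"
  shows "form_vanishes n x y"
proof -
  define W where "W = {z. \<exists>f. (\<forall>k. f k \<in> K) \<and> z = (\<Sum>k\<in>{1..n}. \<kappa> (f k) * (x ^ (n - k) * y ^ k))}"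
  have atMost_insert: "{..n} = insert 0 {1..n}" by auto
  have split: "form f n x y = \<kappa> (f 0) * x ^ n + (\<Sum>k\<in>{1..n}. \<kappa> (f k) * (x ^ (n - k) * y ^ k))" for f
    unfolding form_def atMost_insert by simp
  show ?thesis
  proof (cases "x ^ n \<in> W")
    case True
    then obtain f where f: "\<forall>k. f k \<in> K" "x ^ n = (\<Sum>k\<in>{1..n}. \<kappa> (f k) * (x ^ (n - k) * y ^ k))"
      by (auto simp: W_def)
    let ?f = "f(0 := - 1)"
    have "form ?f n x y = 0"
      unfolding split using f(2) by (simp add: \<kappa>_uminus \<kappa>_one)
    thus ?thesis unfolding form_vanishes_def
      using f(1) by (intro exI[of _ ?f]) (auto simp: K_uminus)
  next
    case False
    have W: "K_subspace W" unfolding W_def by (rule K_subspace_combinations)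
    from K_linear_functional[OF W False] obtain T
      where T: "K_linear T" "T (x ^ n) = 1" "\<And>w. w \<in> W \<Longrightarrow> T w = 0" by blast
    have T_add: "\<And>u v. T (u + v) = T u + T v"
      and T_scale: "\<And>k u. k \<in> K \<Longrightarrow> T (\<kappa> k * u) = \<kappa> k * T u"
      using T(1) by (auto simp: K_linear_def)
    have lift_sum: "tens_lift T id (sum F A) = (\<Sum>i\<in>A. tens_lift T id (F i))"
      for F :: "nat \<Rightarrow> 'a monoid_algebra" and A
      by (induction A rule: infinite_finite_induct) (auto simp: tens_lift_add[OF T_add])
    have mono: "x ^ (n - k) * y ^ k \<in> W" if "k \<in> {1..n}" for k
    proof -
      have "(\<Sum>i\<in>{1..n}. \<kappa> (if i = k then 1 else 0) * (x ^ (n - i) * y ^ i)) =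
            (\<Sum>i\<in>{1..n}. if i = k then x ^ (n - k) * y ^ k else 0)"
        by (intro sum.cong) (auto simp: \<kappa>_one)
      thus ?thesis using that
        unfolding W_def by (auto intro!: exI[of _ "\<lambda>i. if i = k then 1 else 0"] simp: sum.delta)
    qed
    \<comment> \<open>Of the binomial expansion \<open>T\<close> retains only the term with left
      entry \<open>x ^ n\<close>, whose right entry is \<open>y ^ n\<close>. So
      \<open>y ^ n = 0\<close>, which is again a vanishing form.\<close>
    have "(tens x y - tens y x) ^ n = (tens (- y) x + tens x y) ^ n"
      by (simp add: tens_uminus)
    also have "\<dots> = (\<Sum>k\<le>n. of_nat (n choose k) * tens (- y) x ^ k * tens x y ^ (n - k))"
      by (rule binomial_ring)
    also have "\<dots> = (\<Sum>k\<le>n. tens (scalar (of_nat (n choose k) * (-1) ^ k) * (x ^ (n - k) * y ^ k))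
                        (x ^ k * y ^ (n - k)))"
    proof (intro sum.cong refl)
      fix k
      have *: "of_nat c * tens u v = tens (of_nat c * u) v" for c u v
        by (induction c) (auto simp: tens_add distrib_right)
      have "scalar ((-1) ^ k) = (-1) ^ k"
        by (induction k) (auto simp: scalar_mult scalar_uminus)
      thus "of_nat (n choose k) * tens (- y) x ^ k * tens x y ^ (n - k) =
        tens (scalar (of_nat (n choose k) * (-1) ^ k) * (x ^ (n - k) * y ^ k)) (x ^ k * y ^ (n - k))"
        by (simp add: tens_power tens_mult * scalar_mult scalar_of_nat power_minus[of y] ac_simps)
    qed
    finally have "tens_lift T id ((tens x y - tens y x) ^ n) =
      (\<Sum>k\<le>n. scalar (of_nat (n choose k) * (-1) ^ k) * T (x ^ (n - k) * y ^ k) * (x ^ k * y ^ (n - k)))"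
      by (simp add: lift_sum tens_lift_tens[OF T_add] T_scale[OF j_K])
    also have "\<dots> = y ^ n + (\<Sum>k\<in>{1..n}. scalar (of_nat (n choose k) * (-1) ^ k) * T (x ^ (n - k) * y ^ k) * (x ^ k * y ^ (n - k)))"
      unfolding atMost_insert by (simp add: T(2))
    also have "\<dots> = y ^ n" using T(3)[OF mono] by simp
    finally have "y ^ n = 0" using assms T(1) by (simp add: tensor_kernel_def)
    have "form (\<lambda>k. if k = n then 1 else 0) n x y = (\<Sum>k\<le>n. if k = n then y ^ n else 0)"
      unfolding form_def by (intro sum.cong) (auto simp: \<kappa>_one)
    also have "\<dots> = 0" using \<open>y ^ n = 0\<close> by (simp add: sum.delta)
    finally show ?thesis
      unfolding form_vanishes_def by (intro exI[of _ "\<lambda>k. if k = n then 1 else 0"]) auto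
  qed
qed

end

section \<open>Countable spans and the existence of maximal stable ideals\<close>

context difference_algebra
begin

lemma K_subspace_sum:
  assumes "K_subspace W" "\<And>i. i \<in> A \<Longrightarrow> c i \<in> K" "\<And>i. i \<in> A \<Longrightarrow> x i \<in> W"
  shows "(\<Sum>i\<in>A. \<kappa> (c i) * x i) \<in> W"
  using assms(2,3)
  by (induction A rule: infinite_finite_induct) (use assms(1) in \<open>auto simp: K_subspace_def\<close>)

lemma spanned_mod_K_subspace:
  assumes "ring_ideal m"
  shows "K_subspace (spanned_mod m t)"
    and "t i \<in> spanned_mod m t"
    and "x - y \<in> m \<Longrightarrow> y \<in> spanned_mod m t \<Longrightarrow> x \<in> spanned_mod m t"
proof -
  interpret ideal_congruence m by unfold_locales fact
  have pad: "(\<Sum>i<n. \<kappa> (k i) * t i) = (\<Sum>i<N. \<kappa> (if i < n then k i else 0) * t i)"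
    if "n \<le> N" for n N k
  proof -
    have "(\<Sum>i<N. \<kappa> (if i < n then k i else 0) * t i) =
        (\<Sum>i<n. \<kappa> (if i < n then k i else 0) * t i)"
      using that by (intro sum.mono_neutral_right) auto
    thus ?thesis by simp
  qed
  show "K_subspace (spanned_mod m t)"
    unfolding K_subspace_def
  proof (intro conjI ballI)
    show "0 \<in> spanned_mod m t"
      unfolding spanned_mod_def by (auto intro!: exI[of _ 0] exI[of _ "\<lambda>_. 0"])
  next
    fix x y assume "x \<in> spanned_mod m t" "y \<in> spanned_mod m t"
    then obtain n k n' k' where k: "\<forall>i. k i \<in> K" "x \<simeq> (\<Sum>i<n. \<kappa> (k i) * t i)"
      and k': "\<forall>i. k' i \<in> K" "y \<simeq> (\<Sum>i<n'. \<kappa> (k' i) * t i)"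
      by (auto simp: spanned_mod_def cong_mod_def)
    define N where "N = max n n'"
    let ?l = "\<lambda>i. (if i < n then k i else 0) + (if i < n' then k' i else 0)"
    have "x + y \<simeq> (\<Sum>i<n. \<kappa> (k i) * t i) + (\<Sum>i<n'. \<kappa> (k' i) * t i)"
      by (intro cong_add k k')
    also have "\<dots> = (\<Sum>i<N. \<kappa> (?l i) * t i)"
      using k(1) k'(1)
      by (subst (1 2) pad[of _ N]) (auto simp: N_def \<kappa>_add sum.distrib[symmetric] distrib_right intro!: sum.cong)
    finally show "x + y \<in> spanned_mod m t"
      unfolding spanned_mod_def cong_mod_def using k(1) k'(1)
      by (auto intro!: exI[of _ N] exI[of _ ?l] K_add)
  next
    fix l x assume l: "l \<in> K" and "x \<in> spanned_mod m t"
    then obtain n k where k: "\<forall>i. k i \<in> K" "x \<simeq> (\<Sum>i<n. \<kappa> (k i) * t i)"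
      by (auto simp: spanned_mod_def cong_mod_def)
    have "\<kappa> l * x \<simeq> \<kappa> l * (\<Sum>i<n. \<kappa> (k i) * t i)"
      by (intro cong_mult k cong_refl)
    also have "\<dots> = (\<Sum>i<n. \<kappa> (l * k i) * t i)"
      using k l by (simp add: sum_distrib_left \<kappa>_mult mult.assoc)
    finally show "\<kappa> l * x \<in> spanned_mod m t"
      unfolding spanned_mod_def cong_mod_def using k(1) l
      by (auto intro!: exI[of _ n] exI[of _ "\<lambda>i. l * k i"] K_mult)
  qed
  have "(\<Sum>k<Suc i. \<kappa> (if k = i then 1 else 0) * t k) = (\<Sum>k<Suc i. if k = i then t i else 0)"
    by (intro sum.cong) (auto simp: \<kappa>_one)
  also have "\<dots> = t i" by (simp add: sum.delta)
  finally have "t i \<simeq> (\<Sum>k<Suc i. \<kappa> (if k = i then 1 else 0) * t k)" by (simp del: sum.lessThan_Suc)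
  thus "t i \<in> spanned_mod m t"
    unfolding spanned_mod_def cong_mod_def
    by (intro CollectI exI[of _ "Suc i"] exI[of _ "\<lambda>k. if k = i then 1 else 0"]) auto
  show "x \<in> spanned_mod m t" if "x - y \<in> m" "y \<in> spanned_mod m t"
  proof -
    from that(2) obtain n k where k: "\<forall>i. k i \<in> K" "y \<simeq> (\<Sum>i<n. \<kappa> (k i) * t i)"
      by (auto simp: spanned_mod_def cong_mod_def)
    have "x \<simeq> (\<Sum>i<n. \<kappa> (k i) * t i)"
      using that(1) k(2) by (auto simp: cong_mod_def[of x y, symmetric] intro: cong_trans)
    thus ?thesis unfolding spanned_mod_def cong_mod_def using k(1) by blast
  qed
qed

text \<open>Zorn's lemma applies because the union of a chain contains a power of \<open>s\<close>
  only if a member does.\<close>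

lemma ex_maximal_stable_ideal:
  assumes "stable_ideal J0" "\<And>n. s ^ n \<notin> J0"
  shows "\<exists>m. stable_ideal m \<and> J0 \<subseteq> m \<and> (\<forall>n. s ^ n \<notin> m) \<and>
    (\<forall>J. stable_ideal J \<longrightarrow> m \<subseteq> J \<longrightarrow> (\<forall>n. s ^ n \<notin> J) \<longrightarrow> J = m)"
proof -
  define \<A> where "\<A> = {J. stable_ideal J \<and> J0 \<subseteq> J \<and> (\<forall>n. s ^ n \<notin> J)}"
  have "\<exists>M\<in>\<A>. \<forall>X\<in>\<A>. M \<subseteq> X \<longrightarrow> X = M"
  proof (rule subset_Zorn_nonempty)
    show "\<A> \<noteq> {}" using assms unfolding \<A>_def by blast
    fix C assume C: "C \<noteq> {}" "subset.chain \<A> C"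
    have chain: "X \<subseteq> Y \<or> Y \<subseteq> X" if "X \<in> C" "Y \<in> C" for X Y
      using C(2) that by (auto simp: subset.chain_def)
    have mem: "ring_ideal X" "\<psi> ` X \<subseteq> X" "J0 \<subseteq> X" "s ^ n \<notin> X" if "X \<in> C" for X n
      using C(2) that unfolding subset.chain_def \<A>_def stable_ideal_def by blast+
    have "u + v \<in> \<Union>C" if uv: "u \<in> \<Union>C" "v \<in> \<Union>C" for u v
    proof -
      from uv obtain X Y where "X \<in> C" "Y \<in> C" "u \<in> X" "v \<in> Y" by blast
      then obtain Z where "Z \<in> C" "u \<in> Z" "v \<in> Z" using chain by blast
      thus ?thesis using mem(1)[of Z] unfolding ring_ideal_iff by blast
    qed
    moreover have "0 \<in> \<Union>C" using C(1) mem(1) unfolding ring_ideal_iff by blast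
    moreover have "c * u \<in> \<Union>C" if "u \<in> \<Union>C" for u c
      using that mem(1) unfolding ring_ideal_iff by blast
    ultimately have "ring_ideal (\<Union>C)" unfolding ring_ideal_iff by blast
    moreover have "\<psi> ` (\<Union>C) \<subseteq> \<Union>C" using mem(2) by blast
    ultimately show "\<Union>C \<in> \<A>" using C(1) mem(3,4) unfolding \<A>_def stable_ideal_def by blast
  qed
  then obtain M where M: "M \<in> \<A>" "\<And>X. X \<in> \<A> \<Longrightarrow> M \<subseteq> X \<Longrightarrow> X = M" by blast
  have "J = M" if "stable_ideal J" "M \<subseteq> J" "\<forall>n. s ^ n \<notin> J" for J
    using that M unfolding \<A>_def by blast
  thus ?thesis using M(1) unfolding \<A>_def by blast
qed

end


locale simple_difference_algebra = difference_algebra K \<phi> j \<kappa> \<psi>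
  for K :: "'k::field set" and \<phi> :: "'k \<Rightarrow> 'k" and j :: "complex \<Rightarrow> 'k"
    and \<kappa> :: "'k \<Rightarrow> 'a::comm_ring_1" and \<psi> :: "'a \<Rightarrow> 'a" +
  fixes t :: "nat \<Rightarrow> 'a"
  assumes bij: "bij \<psi>"
    and simple: "stable_ideal J \<Longrightarrow> J = {0} \<or> J = UNIV"
    and spanned: "spanned_mod {0} t = UNIV"
begin

text \<open>In a simple algebra the zero ideal is maximal among the stable ideals without 1. This
  instance, with \<open>s = 1\<close>, makes the constants of \<open>R\<close> complex
  numbers.\<close>

sublocale own: maximal_stable_ideal K \<phi> j \<kappa> \<psi> "{0}" 1 1 1 t
proof unfold_locales
  show "J = {0}" if "stable_ideal J" "{0} \<subseteq> J" "\<And>n. 1 ^ n \<notin> J" for J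
    using simple[OF that(1)] that(3) by auto
qed (auto simp: stable_ideal_def ring_ideal_iff \<psi>_one spanned)

lemma constant_scalar: "\<psi> c = c \<Longrightarrow> \<exists>\<mu>. c = scalar \<mu>"
  using own.constant_mod[of c] by (simp add: own.cong_mod_def)

text \<open>The principal ideal of a semi-invariant element is stable, so it is the whole ring as
  soon as it is nonzero.\<close>

lemma ex_unit:
  assumes "w \<noteq> 0" "\<psi> w = c * w"
  shows "\<exists>w'. w' * w = 1"
proof -
  have "stable_ideal (range (\<lambda>r. r * w))"
    unfolding stable_ideal_def ring_ideal_iff
  proof (intro conjI ballI allI subsetI)
    show "0 \<in> range (\<lambda>r. r * w)" by (rule range_eqI[of _ _ 0]) simp
  next
    fix x y assume "x \<in> range (\<lambda>r. r * w)" "y \<in> range (\<lambda>r. r * w)"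
    then obtain r q where "x = r * w" "y = q * w" by auto
    thus "x + y \<in> range (\<lambda>r. r * w)" by (intro range_eqI[of _ _ "r + q"]) (simp add: distrib_right)
  next
    fix r x assume "x \<in> range (\<lambda>r. r * w)"
    then obtain q where "x = q * w" by auto
    thus "r * x \<in> range (\<lambda>r. r * w)" by (intro range_eqI[of _ _ "r * q"]) (simp add: mult.assoc)
  next
    fix x assume "x \<in> \<psi> ` range (\<lambda>r. r * w)"
    then obtain q where "x = \<psi> (q * w)" by auto
    thus "x \<in> range (\<lambda>r. r * w)"
      by (intro range_eqI[of _ _ "\<psi> q * c"]) (simp add: \<psi>_mult assms mult.assoc)
  qed
  moreover have "w \<in> range (\<lambda>r. r * w)" by (rule range_eqI[of _ _ 1]) simp
  ultimately have "range (\<lambda>r. r * w) = UNIV" using simple assms(1) by blast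
  thus ?thesis by (metis UNIV_I image_iff)
qed

lemma inv_\<psi>: "\<psi> (inv \<psi> x) = x" "inv \<psi> (\<psi> x) = x"
  using bij by (simp_all add: bij_is_inj bij_is_surj surj_f_inv_f)

text \<open>\<open>K\<close> acts through the left factor; the action through the right one agrees
  with it modulo \<open>tensor_kernel\<close>.\<close>

definition tens_\<kappa> :: "'k \<Rightarrow> 'a monoid_algebra" where
  "tens_\<kappa> k = tens (\<kappa> k) 1"

definition tens_\<psi> :: "'a monoid_algebra \<Rightarrow> 'a monoid_algebra" where
  "tens_\<psi> = tens_lift (\<lambda>a. tens (\<psi> a) 1) (\<lambda>b. tens 1 (\<psi> b))"

lemma tens_\<psi>_tens: "tens_\<psi> (tens a b) = tens (\<psi> a) (\<psi> b)"
  unfolding tens_\<psi>_def by (subst tens_lift_tens) (auto simp: \<psi>_add tens_add tens_mult)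

lemma tens_\<psi>_add: "tens_\<psi> (f + g) = tens_\<psi> f + tens_\<psi> g"
  unfolding tens_\<psi>_def by (rule tens_lift_add) (simp add: \<psi>_add tens_add)

sublocale tensor: difference_algebra K \<phi> j tens_\<kappa> tens_\<psi>
proof unfold_locales
  show "tens_\<psi> (f * g) = tens_\<psi> f * tens_\<psi> g" for f g
    unfolding tens_\<psi>_def
    by (rule tens_lift_mult) (simp_all add: \<psi>_add tens_add \<psi>_mult tens_mult)
  show "tens_\<psi> 1 = 1" by (metis tens_one tens_\<psi>_tens \<psi>_one)
qed (simp_all add: tens_\<psi>_add tens_\<psi>_tens tens_\<kappa>_def tens_one \<kappa>_one \<kappa>_add \<kappa>_mult tens_add
    tens_mult \<psi>_\<kappa> \<psi>_one)

lemma K_linearD: "K_linear T \<Longrightarrow> T (x + y) = T x + T y"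
  "K_linear T \<Longrightarrow> k \<in> K \<Longrightarrow> T (\<kappa> k * x) = \<kappa> k * T x"
  by (auto simp: K_linear_def)

text \<open>Linear maps are closed under composition with multiplication by \<open>a\<close>, which
  gives the ideal property, and under conjugation by \<open>\<psi>\<close>, which gives
  stability.\<close>

lemma tensor_kernel_stable: "tensor.stable_ideal tensor_kernel"
  unfolding tensor.stable_ideal_def ring_ideal_iff
proof (intro conjI ballI allI subsetI)
  show "0 \<in> tensor_kernel" by (simp add: tensor_kernel_def)
next
  fix f g assume "f \<in> tensor_kernel" "g \<in> tensor_kernel"
  thus "f + g \<in> tensor_kernel" by (auto simp: tensor_kernel_def tens_lift_add K_linearD)
next
  fix f g :: "'a monoid_algebra" assume g: "g \<in> tensor_kernel"
  show "f * g \<in> tensor_kernel"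
    unfolding tensor_kernel_def
  proof (intro CollectI allI impI)
    fix T assume T: "K_linear T"
    show "tens_lift T id (f * g) = 0"
    proof (induction f rule: monoid_algebra_induct)
      case (tens a b)
      have T': "K_linear (\<lambda>x. T (a * x))"
        using K_linearD[OF T] by (auto simp: K_linear_def distrib_left mult.left_commute[of a])
      have "tens_lift T id (tens a b * g) = b * tens_lift (\<lambda>x. T (a * x)) id g"
      proof (induction g rule: monoid_algebra_induct)
        case (tens c d)
        show ?case
          by (simp add: tens_mult tens_lift_tens K_linearD[OF T] K_linearD[OF T'] mult.left_commute)
      qed (simp_all add: distrib_left tens_lift_add K_linearD[OF T] K_linearD[OF T'])
      moreover have "tens_lift (\<lambda>x. T (a * x)) id g = 0"
        using g T' unfolding tensor_kernel_def by blast
      ultimately show ?case by (simp only: mult_zero_right)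
    qed (simp_all add: distrib_right tens_lift_add K_linearD[OF T])
  qed
next
  fix f assume "f \<in> tens_\<psi> ` tensor_kernel"
  then obtain g where g: "g \<in> tensor_kernel" "f = tens_\<psi> g" by auto
  show "f \<in> tensor_kernel"
    unfolding tensor_kernel_def
  proof (intro CollectI allI impI)
    fix T assume T: "K_linear T"
    define T' where "T' = (\<lambda>x. inv \<psi> (T (\<psi> x)))"
    have inv_add: "inv \<psi> (x + y) = inv \<psi> x + inv \<psi> y" for x y
      by (metis inv_\<psi> \<psi>_add)
    have "inv \<psi> (\<kappa> (\<phi> k) * x) = \<kappa> k * inv \<psi> x" if "k \<in> K" for k x
      by (metis inv_\<psi> \<psi>_mult \<psi>_\<kappa> that)
    hence T': "K_linear T'"
      using K_linearD[OF T]
      by (auto simp: K_linear_def T'_def inv_add \<psi>_add \<psi>_mult \<psi>_\<kappa> \<phi>_K)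
    have "tens_lift T id (tens_\<psi> g) = \<psi> (tens_lift T' id g)"
    proof (induction g rule: monoid_algebra_induct)
      case zero
      show ?case using tensor.\<psi>_zero by simp
    next
      case (tens a b)
      show ?case
        by (simp add: tens_\<psi>_tens tens_lift_tens K_linearD[OF T] K_linearD[OF T'] \<psi>_mult)
           (simp add: T'_def inv_\<psi>)
    qed (simp add: tens_\<psi>_add tens_lift_add K_linearD[OF T] K_linearD[OF T'] \<psi>_add)
    thus "tens_lift T id f = 0" using g T' by (simp add: tensor_kernel_def)
  qed
qed

lemma tens_right_add: "tens a (b + b') - (tens a b + tens a b') \<in> tensor_kernel"
  and tens_right_scale: "k \<in> K \<Longrightarrow> tens a (\<kappa> k * b) - tens (\<kappa> k * a) b \<in> tensor_kernel"
proof -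
  have *: "tens_lift T id (tens a b - f) = T a * b - tens_lift T id f" if "K_linear T" for T a b f
  proof -
    have "tens_lift T id (tens a b) = tens_lift T id (tens a b - f) + tens_lift T id f"
      by (subst tens_lift_add[symmetric]) (auto simp: K_linearD[OF that])
    thus ?thesis by (simp add: tens_lift_tens K_linearD[OF that])
  qed
  show "tens a (b + b') - (tens a b + tens a b') \<in> tensor_kernel"
    by (auto simp: tensor_kernel_def * tens_lift_add tens_lift_tens K_linearD algebra_simps)
  show "tens a (\<kappa> k * b) - tens (\<kappa> k * a) b \<in> tensor_kernel" if "k \<in> K"
    using that by (auto simp: tensor_kernel_def * tens_lift_tens K_linearD)
qed

definition tens_span :: "nat \<Rightarrow> 'a monoid_algebra" where
  "tens_span n = (case prod_decode n of (i, k) \<Rightarrow> tens (t i) (t k))"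

text \<open>As \<open>t\<close> spans \<open>R\<close>, the products t_i \<otimes> t_k span the
  tensor square, and pairs of indices can be enumerated. Sums in the right entry may be expanded
  only modulo \<open>m\<close>.\<close>

lemma tensor_spanned:
  assumes m: "ring_ideal m" "tensor_kernel \<subseteq> m"
  shows "tensor.spanned_mod m tens_span = UNIV"
proof -
  interpret ideal_congruence m by unfold_locales fact
  note sp = tensor.spanned_mod_K_subspace[OF m(1), where t = tens_span]
  have repr: "\<exists>n k. (\<forall>i. k i \<in> K) \<and> x = (\<Sum>i<n. \<kappa> (k i) * t i)" for x
  proof -
    have "x \<in> spanned_mod {0} t" using spanned by simp
    thus ?thesis by (simp add: spanned_mod_def)
  qed
  have tt: "tens (t i) (t k) \<in> tensor.spanned_mod m tens_span" for i k
    using sp(2)[of "prod_encode (i, k)"] by (simp add: tens_span_def)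
  have at: "tens a (t k) \<in> tensor.spanned_mod m tens_span" for a k
  proof -
    obtain n c where c: "\<forall>i. c i \<in> K" "a = (\<Sum>i<n. \<kappa> (c i) * t i)" using repr by blast
    have "tens a (t k) = (\<Sum>i<n. tens_\<kappa> (c i) * tens (t i) (t k))"
      by (simp add: c tens_sum tens_\<kappa>_def tens_mult)
    also have "\<dots> \<in> tensor.spanned_mod m tens_span"
      using c(1) by (intro tensor.K_subspace_sum[OF sp(1)] tt) auto
    finally show ?thesis .
  qed
  have ab: "tens a b \<in> tensor.spanned_mod m tens_span" for a b
  proof -
    obtain n c where c: "\<forall>i. c i \<in> K" "b = (\<Sum>i<n. \<kappa> (c i) * t i)" using repr by blast
    have "tens a (\<Sum>i<n. \<kappa> (c i) * t i) - (\<Sum>i<n. tens_\<kappa> (c i) * tens a (t i)) \<in> m"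
    proof (induction n)
      case 0
      \<comment> \<open>In the monoid algebra \<open>tens a 0\<close> is in general not zero;
        additivity at 0 + 0 is what puts it into \<open>m\<close>.\<close>
      have "tens a (0 + 0) - (tens a 0 + tens a 0) \<in> m"
        using tens_right_add m(2) by blast
      thus ?case using uminus_mem by fastforce
    next
      case (Suc n)
      have "tens a (\<Sum>i<Suc n. \<kappa> (c i) * t i) \<simeq>
          tens a (\<Sum>i<n. \<kappa> (c i) * t i) + tens a (\<kappa> (c n) * t n)"
        unfolding cong_mod_def using tens_right_add m(2) by auto
      also have "\<dots> \<simeq> (\<Sum>i<n. tens_\<kappa> (c i) * tens a (t i)) + tens (\<kappa> (c n) * a) (t n)"
        using Suc tens_right_scale[of "c n" a "t n"] c(1) m(2)
        by (intro cong_add) (auto simp: cong_mod_def)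
      also have "\<dots> = (\<Sum>i<Suc n. tens_\<kappa> (c i) * tens a (t i))"
        by (simp add: tens_\<kappa>_def tens_mult)
      finally show ?case by (simp add: cong_mod_def)
    qed
    from sp(3)[OF this tensor.K_subspace_sum[OF sp(1)]] show ?thesis
      using at c by auto
  qed
  have "f \<in> tensor.spanned_mod m tens_span" for f
  proof (induction f rule: monoid_algebra_induct)
    case zero
    show ?case using sp(1) by (simp add: tensor.K_subspace_def)
  next
    case (add f g)
    thus ?case using sp(1) by (simp add: tensor.K_subspace_def)
  qed (rule ab)
  thus ?thesis by blast
qed

end

section \<open>Second-order Picard-Vessiot rings\<close>

context difference_field
begin

lemma of_nat_K_eq_0_iff [simp]: "(of_nat n :: 'k) = 0 \<longleftrightarrow> n = 0"
proof -
  have "of_nat n = j (of_nat n)" by (induction n) (auto simp: j_add j_one)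
  thus ?thesis by simp
qed

lemma of_nat_K: "of_nat n \<in> K"
  by (induction n) (auto intro: K_add)

end


section \<open>Partial derivatives and Taylor expansion of binary forms\<close>

definition form_dx :: "nat \<Rightarrow> (nat \<Rightarrow> 'k::comm_ring_1) \<Rightarrow> nat \<Rightarrow> 'k" where
  "form_dx d f k = of_nat (Suc d - k) * f k"

definition form_dy :: "(nat \<Rightarrow> 'k::comm_ring_1) \<Rightarrow> nat \<Rightarrow> 'k" where
  "form_dy f k = of_nat (Suc k) * f (Suc k)"


context difference_algebra
begin

lemma \<kappa>_of_nat: "\<kappa> (of_nat n) = of_nat n"
  by (induction n) (auto simp: \<kappa>_one \<kappa>_add of_nat_K)

text \<open>Taylor expansion to first order in \<open>L\<close>. At \<open>i = 0\<close> or
  \<open>l = 0\<close> the truncated exponents are harmless, since their terms carry the factor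
  \<open>of_nat 0\<close>.\<close>

lemma power_mult_expand:
  fixes x y u w N L :: 'a
  shows "\<exists>h. (x * N + u * L) ^ i * (y * N + w * L) ^ l = x ^ i * y ^ l * N ^ (i + l) +
    L * (N ^ (i + l - 1) * (of_nat i * x ^ (i - 1) * y ^ l * u + of_nat l * x ^ i * y ^ (l - 1) * w) + L * h)"
proof -
  have single: "\<exists>h. (x * N + u * L) ^ i = x ^ i * N ^ i +
      L * (N ^ (i - 1) * (of_nat i * x ^ (i - 1) * u) + L * h)" for x u :: 'a and i
  proof (induction i)
    case (Suc i)
    then obtain h where h: "(x * N + u * L) ^ i = x ^ i * N ^ i +
      L * (N ^ (i - 1) * (of_nat i * x ^ (i - 1) * u) + L * h)" by blast
    have *: "of_nat i * (x * N) * (N ^ (i - 1) * x ^ (i - 1)) = of_nat i * (N ^ i * x ^ i)"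
      by (cases i) (auto simp: algebra_simps)
    have "(x * N + u * L) ^ Suc i = (x * N + u * L) * (x ^ i * N ^ i +
      L * (N ^ (i - 1) * (of_nat i * x ^ (i - 1) * u) + L * h))" by (simp add: h)
    also have "\<dots> = x ^ Suc i * N ^ Suc i + L * (of_nat i * (x * N) * (N ^ (i - 1) * x ^ (i - 1)) * u
       + u * x ^ i * N ^ i + L * (u * (N ^ (i - 1) * (of_nat i * x ^ (i - 1) * u) + L * h) + x * N * h))"
      by (simp add: algebra_simps)
    also have "\<dots> = x ^ Suc i * N ^ Suc i + L * (N ^ i * (of_nat (Suc i) * x ^ i * u)
       + L * (u * (N ^ (i - 1) * (of_nat i * x ^ (i - 1) * u) + L * h) + x * N * h))"
      unfolding * by (simp add: algebra_simps)
    finally show ?case by (auto simp del: of_nat_Suc)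
  qed (auto intro: exI[of _ 0])
  obtain g where g: "(x * N + u * L) ^ i = x ^ i * N ^ i +
      L * (N ^ (i - 1) * (of_nat i * x ^ (i - 1) * u) + L * g)" using single by blast
  obtain h where h: "(y * N + w * L) ^ l = y ^ l * N ^ l +
      L * (N ^ (l - 1) * (of_nat l * y ^ (l - 1) * w) + L * h)" using single by blast
  define A B where "A = N ^ (i - 1) * (of_nat i * x ^ (i - 1) * u)"
    and "B = N ^ (l - 1) * (of_nat l * y ^ (l - 1) * w)"
  have "(x * N + u * L) ^ i * (y * N + w * L) ^ l =
      (x ^ i * N ^ i + L * (A + L * g)) * (y ^ l * N ^ l + L * (B + L * h))"
    by (simp add: g h A_def B_def)
  also have "\<dots> = x ^ i * y ^ l * N ^ (i + l) + L * ((A * (y ^ l * N ^ l) + x ^ i * N ^ i * B) +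
     L * (A * B + x ^ i * N ^ i * h + g * (y ^ l * N ^ l) + L * (A * h + g * B + L * g * h)))"
    by (simp add: algebra_simps power_add)
  also have "A * (y ^ l * N ^ l) + x ^ i * N ^ i * B = N ^ (i + l - 1) *
      (of_nat i * x ^ (i - 1) * y ^ l * u + of_nat l * x ^ i * y ^ (l - 1) * w)"
    by (cases i; cases l) (simp_all add: A_def B_def algebra_simps power_add)
  finally show ?thesis by blast
qed

lemma form_dx_sum:
  assumes "\<And>k. f k \<in> K"
  shows "form (form_dx d f) d x y =
    (\<Sum>k\<le>Suc d. \<kappa> (f k) * (of_nat (Suc d - k) * x ^ (Suc d - k - 1) * y ^ k))"
proof -
  have "(\<Sum>k\<le>Suc d. \<kappa> (f k) * (of_nat (Suc d - k) * x ^ (Suc d - k - 1) * y ^ k)) =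
      (\<Sum>k\<le>d. \<kappa> (f k) * (of_nat (Suc d - k) * x ^ (d - k) * y ^ k))"
    by simp
  also have "\<dots> = form (form_dx d f) d x y"
    unfolding form_def form_dx_def \<kappa>_mult[OF of_nat_K assms] \<kappa>_of_nat
    by (simp only: ac_simps)
  finally show ?thesis by simp
qed

lemma form_dy_sum:
  assumes "\<And>k. f k \<in> K"
  shows "form (form_dy f) d x y =
    (\<Sum>k\<le>Suc d. \<kappa> (f k) * (of_nat k * x ^ (Suc d - k) * y ^ (k - 1)))"
proof -
  have "(\<Sum>k\<le>Suc d. \<kappa> (f k) * (of_nat k * x ^ (Suc d - k) * y ^ (k - 1))) =
    (\<Sum>k\<le>d. \<kappa> (f (Suc k)) * (of_nat (Suc k) * x ^ (d - k) * y ^ k))"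
    by (subst sum.atMost_Suc_shift) simp
  thus ?thesis
    by (simp add: form_def form_dy_def \<kappa>_mult assms of_nat_K \<kappa>_of_nat ac_simps del: of_nat_Suc)
qed

text \<open>Euler's identity. At a zero of the form it is a linear equation between the two partial
  derivatives.\<close>

lemma form_euler:
  assumes "\<And>k. f k \<in> K"
  shows "x * form (form_dx d f) d x y + y * form (form_dy f) d x y = of_nat (Suc d) * form f (Suc d) x y"
  unfolding form_dx_sum[OF assms] form_dy_sum[OF assms] form_def[of f] sum_distrib_left
    sum.distrib[symmetric]
proof (intro sum.cong refl)
  fix k assume "k \<in> {..Suc d}"
  hence k: "k \<le> Suc d" by simp
  have 1: "x * (of_nat (Suc d - k) * x ^ (Suc d - k - 1)) = of_nat (Suc d - k) * x ^ (Suc d - k)"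
    by (cases "Suc d - k") (simp_all add: mult.left_commute)
  have 2: "y * (of_nat k * y ^ (k - 1)) = of_nat k * y ^ k"
    by (cases k) (simp_all add: mult.left_commute)
  have 3: "(of_nat (Suc d) :: 'a) = of_nat (Suc d - k) + of_nat k"
    using k by (metis le_add_diff_inverse2 of_nat_add)
  have "x * (\<kappa> (f k) * (of_nat (Suc d - k) * x ^ (Suc d - k - 1) * y ^ k)) +
      y * (\<kappa> (f k) * (of_nat k * x ^ (Suc d - k) * y ^ (k - 1))) =
    \<kappa> (f k) * y ^ k * (x * (of_nat (Suc d - k) * x ^ (Suc d - k - 1))) +
    \<kappa> (f k) * x ^ (Suc d - k) * (y * (of_nat k * y ^ (k - 1)))"
    by (simp only: ac_simps)
  also have "\<dots> = of_nat (Suc d) * (\<kappa> (f k) * (x ^ (Suc d - k) * y ^ k))"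
    unfolding 1 2 3 by (simp only: distrib_left distrib_right ac_simps)
  finally show "x * (\<kappa> (f k) * (of_nat (Suc d - k) * x ^ (Suc d - k - 1) * y ^ k)) +
      y * (\<kappa> (f k) * (of_nat k * x ^ (Suc d - k) * y ^ (k - 1))) =
    of_nat (Suc d) * (\<kappa> (f k) * (x ^ (Suc d - k) * y ^ k))" .
qed

text \<open>\<open>N\<close> is kept as a variable because the copy of a point in the right tensor
  factor will have coordinates of the shape \<open>x * N + u * L\<close>.\<close>

lemma form_taylor:
  assumes f: "\<And>k. f k \<in> K"
  shows "\<exists>h. form f (Suc d) (x * N + u * L) (y * N + w * L) = form f (Suc d) x y * N ^ Suc d +
    L * (N ^ d * (u * form (form_dx d f) d x y + w * form (form_dy f) d x y) + L * h)"
proof -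
  have "\<exists>h. (x * N + u * L) ^ (Suc d - k) * (y * N + w * L) ^ k = x ^ (Suc d - k) * y ^ k * N ^ Suc d +
    L * (N ^ d * (of_nat (Suc d - k) * x ^ (Suc d - k - 1) * y ^ k * u +
      of_nat k * x ^ (Suc d - k) * y ^ (k - 1) * w) + L * h)" if "k \<le> Suc d" for k
    using power_mult_expand[of x N u L "Suc d - k" y w k] that by simp
  then obtain h where h: "\<And>k. k \<le> Suc d \<Longrightarrow>
     (x * N + u * L) ^ (Suc d - k) * (y * N + w * L) ^ k = x ^ (Suc d - k) * y ^ k * N ^ Suc d +
    L * (N ^ d * (of_nat (Suc d - k) * x ^ (Suc d - k - 1) * y ^ k * u +
      of_nat k * x ^ (Suc d - k) * y ^ (k - 1) * w) + L * h k)" by metis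
  have "form f (Suc d) (x * N + u * L) (y * N + w * L) =
    (\<Sum>k\<le>Suc d. \<kappa> (f k) * (x ^ (Suc d - k) * y ^ k * N ^ Suc d +
    L * (N ^ d * (of_nat (Suc d - k) * x ^ (Suc d - k - 1) * y ^ k * u +
      of_nat k * x ^ (Suc d - k) * y ^ (k - 1) * w) + L * h k)))"
    unfolding form_def by (intro sum.cong refl) (subst h, auto)
  also have "\<dots> = (\<Sum>k\<le>Suc d. \<kappa> (f k) * (x ^ (Suc d - k) * y ^ k)) * N ^ Suc d +
    L * (N ^ d * (u * (\<Sum>k\<le>Suc d. \<kappa> (f k) * (of_nat (Suc d - k) * x ^ (Suc d - k - 1) * y ^ k)) +
      w * (\<Sum>k\<le>Suc d. \<kappa> (f k) * (of_nat k * x ^ (Suc d - k) * y ^ (k - 1)))) +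
      L * (\<Sum>k\<le>Suc d. \<kappa> (f k) * h k))"
    unfolding sum_distrib_left sum_distrib_right sum.distrib[symmetric]
    by (intro sum.cong refl) (simp only: distrib_left distrib_right ac_simps)
  finally show ?thesis
    unfolding form_dx_sum[OF f] form_dy_sum[OF f] form_def[of f] by blast
qed

lemma spanned_mod_0: "x \<in> spanned_mod {0} t \<longleftrightarrow> (\<exists>n k. (\<forall>i. k i \<in> K) \<and> x = (\<Sum>i<n. \<kappa> (k i) * t i))"
  by (simp add: spanned_mod_def)

end


text \<open>\<open>p\<close> and \<open>q\<close> form the first row of the fundamental matrix,
  their images under \<open>\<psi>\<close> the second row, and \<open>d\<close> is the inverse of
  its determinant.\<close>

locale second_order_pv = difference_algebra K \<phi> j \<kappa> \<psi>
  for K :: "'k::field set" and \<phi> :: "'k \<Rightarrow> 'k" and j :: "complex \<Rightarrow> 'k"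
    and \<kappa> :: "'k \<Rightarrow> 'a::comm_ring_1" and \<psi> :: "'a \<Rightarrow> 'a" +
  fixes a b :: 'k and p q d :: 'a
  assumes pv_bij: "bij \<psi>"
    and pv_simple: "stable_ideal J \<Longrightarrow> J = {0} \<or> J = UNIV"
    and a_K: "a \<in> K" and b_K: "b \<in> K" and b_nz: "b \<noteq> 0"
    and eq_p: "\<psi> (\<psi> p) = - \<kappa> a * \<psi> p - \<kappa> b * p"
    and eq_q: "\<psi> (\<psi> q) = - \<kappa> a * \<psi> q - \<kappa> b * q"
    and casoratian: "(p * \<psi> q - q * \<psi> p) * d = 1"
    and generated: "is_subring S \<Longrightarrow> \<kappa> ` K \<subseteq> S \<Longrightarrow> {p, q, \<psi> p, \<psi> q, d} \<subseteq> S \<Longrightarrow> S = UNIV"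
begin

text \<open>An enumeration, with repetitions, of all words in the five generators; every letter
  above 3 stands for \<open>d\<close>.\<close>

definition monomial :: "nat \<Rightarrow> 'a" where
  "monomial n = prod_list (map (\<lambda>i. if i = 0 then p else if i = 1 then q else
     if i = 2 then \<psi> p else if i = 3 then \<psi> q else d) (list_decode n))"

lemma monomial_encode: "monomial (list_encode xs) = prod_list (map (\<lambda>i. if i = 0 then p else
    if i = 1 then q else if i = 2 then \<psi> p else if i = 3 then \<psi> q else d) xs)"
  by (simp add: monomial_def)

lemma monomial_mult: "monomial i * monomial k = monomial (list_encode (list_decode i @ list_decode k))"
  by (simp add: monomial_def)

lemma monomials_span: "spanned_mod {0} monomial = UNIV"
proof (rule generated)
  have "ring_ideal {0 :: 'a}" by (simp add: ring_ideal_iff)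
  note sp = spanned_mod_K_subspace[OF this, where t = monomial]
  have mem: "prod_list (map (\<lambda>i. if i = 0 then p else
    if i = 1 then q else if i = 2 then \<psi> p else if i = 3 then \<psi> q else d) xs) \<in> spanned_mod {0} monomial"
    for xs :: "nat list"
    unfolding monomial_encode[symmetric] by (rule sp)
  show "{p, q, \<psi> p, \<psi> q, d} \<subseteq> spanned_mod {0} monomial"
    using mem[of "[0]"] mem[of "[1]"] mem[of "[2]"] mem[of "[3]"] mem[of "[4]"] by simp
  have one: "1 \<in> spanned_mod {0} monomial" using mem[of "[]"] by simp
  have scale: "\<kappa> k * x \<in> spanned_mod {0} monomial" if "k \<in> K" "x \<in> spanned_mod {0} monomial" for k x
    using sp(1) that by (simp add: K_subspace_def)
  show "\<kappa> ` K \<subseteq> spanned_mod {0} monomial" using scale[OF _ one] by auto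
  have mono: "x * monomial k \<in> spanned_mod {0} monomial" if x: "x \<in> spanned_mod {0} monomial" for x k
  proof -
    from x obtain n c where c: "\<forall>i. c i \<in> K" "x = (\<Sum>i<n. \<kappa> (c i) * monomial i)"
      by (auto simp: spanned_mod_0)
    have "x * monomial k = (\<Sum>i<n. \<kappa> (c i) * (monomial i * monomial k))"
      by (simp add: c sum_distrib_right mult.assoc)
    also have "\<dots> \<in> spanned_mod {0} monomial"
      unfolding monomial_mult using c(1) by (intro K_subspace_sum[OF sp(1)] sp(2)) auto
    finally show ?thesis .
  qed
  have mult: "x * y \<in> spanned_mod {0} monomial"
    if x: "x \<in> spanned_mod {0} monomial" and y: "y \<in> spanned_mod {0} monomial" for x y
  proof -
    from y obtain n c where c: "\<forall>i. c i \<in> K" "y = (\<Sum>i<n. \<kappa> (c i) * monomial i)"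
      by (auto simp: spanned_mod_0)
    have "x * y = (\<Sum>i<n. \<kappa> (c i) * (x * monomial i))"
      by (simp add: c sum_distrib_left mult.left_commute)
    also have "\<dots> \<in> spanned_mod {0} monomial"
      using c(1) by (intro K_subspace_sum[OF sp(1)] mono[OF x]) auto
    finally show ?thesis .
  qed
  have "x - y \<in> spanned_mod {0} monomial"
    if x: "x \<in> spanned_mod {0} monomial" and y: "y \<in> spanned_mod {0} monomial" for x y
  proof -
    have "x + \<kappa> (j (-1)) * y \<in> spanned_mod {0} monomial"
      using sp(1) x scale[OF j_K y] by (simp add: K_subspace_def)
    thus ?thesis by (simp add: scalar_uminus)
  qed
  thus "is_subring (spanned_mod {0} monomial)" using one mult by (simp add: is_subring_def)
qed

sublocale simple_difference_algebra K \<phi> j \<kappa> \<psi> monomial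
  by unfold_locales (use pv_bij pv_simple monomials_span in auto)

end

section \<open>Specialisations of the tensor square\<close>

context simple_difference_algebra
begin

sublocale ker: ideal_congruence "tensor_kernel :: 'a monoid_algebra set"
  using tensor_kernel_stable by unfold_locales (simp add: tensor.stable_ideal_def)

end

context second_order_pv
begin

definition solution :: "'a \<Rightarrow> bool" where
  "solution y \<longleftrightarrow> \<psi> (\<psi> y) = - \<kappa> a * \<psi> y - \<kappa> b * y"

lemma solution_p: "solution p" and solution_q: "solution q"
  by (simp_all add: solution_def eq_p eq_q)

text \<open>The Casoratian of \<open>x\<close> in the left factor and \<open>y\<close> in the right
  one. Under r \<otimes> z \<mapsto> r * \<sigma> z it becomes the Casoratian of \<open>x\<close>
  and \<sigma> y.\<close>

definition wronskian :: "'a \<Rightarrow> 'a \<Rightarrow> 'a monoid_algebra" where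
  "wronskian x y = tens x (\<psi> y) - tens (\<psi> x) y"

lemma \<psi>_d: "\<psi> d * \<kappa> b = d"
proof -
  have "\<psi> (p * \<psi> q - q * \<psi> p) = \<kappa> b * (p * \<psi> q - q * \<psi> p)"
    by (simp add: \<psi>_diff \<psi>_mult eq_p eq_q algebra_simps)
  hence "\<psi> d * \<kappa> b * (p * \<psi> q - q * \<psi> p) = 1"
    using arg_cong[OF casoratian, of \<psi>] by (simp add: \<psi>_mult \<psi>_one ac_simps)
  hence "\<psi> d * \<kappa> b * ((p * \<psi> q - q * \<psi> p) * d) = d"
    by (metis mult.assoc mult_1)
  thus ?thesis by (simp add: casoratian)
qed

text \<open>The terms in \<open>a\<close> cancel and the determinant \<open>b\<close> of the
  companion matrix comes out. The right entry is linear over \<open>K\<close> only modulo the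
  kernel.\<close>

lemma wronskian_kernel:
  assumes x: "solution x" and y: "solution y"
  shows "tens_\<psi> (wronskian x y) - tens_\<kappa> b * wronskian x y \<in> tensor_kernel"
proof -
  have "tens (\<psi> x) (\<psi> (\<psi> y)) = tens (\<psi> x) (\<kappa> (- a) * \<psi> y + \<kappa> (- b) * y)"
    using y by (simp add: solution_def \<kappa>_uminus a_K b_K)
  also have "ker.cong_mod \<dots> (tens (\<psi> x) (\<kappa> (- a) * \<psi> y) + tens (\<psi> x) (\<kappa> (- b) * y))"
    unfolding ker.cong_mod_def by (rule tens_right_add)
  also have "ker.cong_mod \<dots> (tens (\<kappa> (- a) * \<psi> x) (\<psi> y) + tens (\<kappa> (- b) * \<psi> x) y)"
    by (intro ker.cong_add) (simp_all only: ker.cong_mod_def tens_right_scale K_uminus a_K b_K)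
  finally have "ker.cong_mod (tens (\<psi> x) (\<psi> (\<psi> y)) - tens (\<psi> (\<psi> x)) (\<psi> y))
      (tens (\<kappa> (- a) * \<psi> x) (\<psi> y) + tens (\<kappa> (- b) * \<psi> x) y - tens (\<psi> (\<psi> x)) (\<psi> y))"
    by (rule ker.cong_diff) simp
  thus ?thesis
    using x
    by (simp add: wronskian_def tensor.\<psi>_diff tens_\<psi>_tens solution_def tens_diff tens_uminus
        \<kappa>_uminus a_K b_K tens_\<kappa>_def tens_mult right_diff_distrib ker.cong_mod_def)
qed

lemma galois_action:
  assumes "\<sigma> \<in> galois_automorphisms K \<kappa> \<psi>"
  shows "\<sigma> (x + y) = \<sigma> x + \<sigma> y" "\<sigma> (x * y) = \<sigma> x * \<sigma> y" "\<sigma> 1 = 1" "bij \<sigma>"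
    "k \<in> K \<Longrightarrow> \<sigma> (\<kappa> k) = \<kappa> k" "\<sigma> (\<psi> x) = \<psi> (\<sigma> x)"
  using assms by (auto simp: galois_automorphisms_def ring_aut_def ring_hom_on_def)

end

locale tensor_maximal_ideal = second_order_pv K \<phi> j \<kappa> \<psi> a b p q d
  for K :: "'k::field set" and \<phi> :: "'k \<Rightarrow> 'k" and j :: "complex \<Rightarrow> 'k"
    and \<kappa> :: "'k \<Rightarrow> 'a::comm_ring_1" and \<psi> :: "'a \<Rightarrow> 'a"
    and a b :: 'k and p q d :: 'a +
  fixes m :: "'a monoid_algebra set" and s e e' :: "'a monoid_algebra"
  assumes kernel: "tensor_kernel \<subseteq> m"
    and max_ideal: "maximal_stable_ideal K \<phi> j tens_\<kappa> tens_\<psi> m s e e' tens_span"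
begin

sublocale M: maximal_stable_ideal K \<phi> j tens_\<kappa> tens_\<psi> m s e e' tens_span
  by (rule max_ideal)

notation M.cong_mod (infix \<open>\<simeq>\<close> 50)

lemma right_add: "tens x (y + z) \<simeq> tens x y + tens x z"
  using tens_right_add[of x y z] kernel by (auto simp: M.cong_mod_def)

lemma right_scale: "k \<in> K \<Longrightarrow> tens x (\<kappa> k * y) \<simeq> tens (\<kappa> k * x) y"
  using tens_right_scale[of k x y] kernel by (auto simp: M.cong_mod_def)

text \<open>The elements \<open>r\<close> with \<open>tens r 1\<close> in \<open>m\<close> form a
  proper stable ideal of the simple ring \<open>R\<close>. Hence \<open>R\<close> embeds into the
  quotient by \<open>m\<close> through the left factor.\<close>

lemma left_eq_0: "tens r 1 \<in> m \<Longrightarrow> r = 0"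
proof -
  have "stable_ideal {r. tens r 1 \<in> m}"
    unfolding stable_ideal_def ring_ideal_iff
  proof (intro conjI ballI allI subsetI)
    show "0 \<in> {r. tens r 1 \<in> m}" by simp
    show "x + y \<in> {r. tens r 1 \<in> m}" if "x \<in> {r. tens r 1 \<in> m}" "y \<in> {r. tens r 1 \<in> m}" for x y
      using that M.add_mem by (simp add: tens_add)
    show "c * x \<in> {r. tens r 1 \<in> m}" if "x \<in> {r. tens r 1 \<in> m}" for c x
      using that M.mult_mem[of "tens x 1" "tens c 1"] by (simp add: tens_mult)
    show "x \<in> {r. tens r 1 \<in> m}" if "x \<in> \<psi> ` {r. tens r 1 \<in> m}" for x
      using that M.\<psi>_mem by (auto simp: tens_\<psi>_tens \<psi>_one dest: M.\<psi>_mem)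
  qed
  moreover have "{r. tens r 1 \<in> m} \<noteq> UNIV"
    using M.one_not_mem tens_one by (metis UNIV_I mem_Collect_eq)
  ultimately have "{r. tens r 1 \<in> m} = {0}" using simple by blast
  thus "tens r 1 \<in> m \<Longrightarrow> r = 0" by blast
qed

lemma left_eq: "tens r 1 \<simeq> tens r' 1 \<Longrightarrow> r = r'"
  using left_eq_0[of "r - r'"] by (simp add: M.cong_mod_def tens_diff)

lemma wronskian_cong:
  "solution x \<Longrightarrow> solution y \<Longrightarrow> tens_\<psi> (wronskian x y) \<simeq> tens_\<kappa> b * wronskian x y"
  using wronskian_kernel kernel by (auto simp: M.cong_mod_def)

text \<open>The factor \<open>b\<close> of the Casoratian cancels against that of \<open>d\<close>,
  so the product is a constant modulo \<open>m\<close>.\<close>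

lemma wronskian_constant:
  assumes "solution x" "solution y"
  shows "\<exists>\<mu>. tens d 1 * wronskian x y \<simeq> tens (scalar \<mu>) 1"
proof -
  have "tens_\<psi> (tens d 1 * wronskian x y) = tens (\<psi> d) 1 * tens_\<psi> (wronskian x y)"
    by (simp add: tensor.\<psi>_mult tens_\<psi>_tens \<psi>_one)
  also have "\<dots> \<simeq> tens (\<psi> d) 1 * (tens_\<kappa> b * wronskian x y)"
    by (intro M.cong_mult wronskian_cong assms M.cong_refl)
  also have "\<dots> = tens d 1 * wronskian x y"
    by (simp add: tens_\<kappa>_def mult.assoc[symmetric] tens_mult \<psi>_d)
  finally show ?thesis using M.constant_mod by (simp add: tens_\<kappa>_def)
qed

text \<open>Cramer's rule: \<open>z\<close> is recovered from its Casoratians with \<open>p\<close>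
  and \<open>q\<close>. The identity is exact because only left entries are added.\<close>

lemma right_expand:
  "tens 1 z = tens q 1 * (tens d 1 * wronskian p z) - tens p 1 * (tens d 1 * wronskian q z)"
proof -
  have "tens q 1 * (tens d 1 * wronskian p z) - tens p 1 * (tens d 1 * wronskian q z) =
      tens ((p * \<psi> q - q * \<psi> p) * d) z"
    by (simp add: wronskian_def right_diff_distrib tens_mult tens_diff[symmetric])
       (simp add: algebra_simps tens_diff)
  thus ?thesis by (simp add: casoratian)
qed

text \<open>By \<open>left_eq\<close> there is at most one such \<open>r\<close>. Once the left
  factor is seen to fill the quotient by \<open>m\<close>, this is the right factor read in the left
  one.\<close>

definition specialize :: "'a \<Rightarrow> 'a" where
  "specialize z = (THE r. tens 1 z \<simeq> tens r 1)"

definition specializable :: "'a set" where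
  "specializable = {z. \<exists>r. tens 1 z \<simeq> tens r 1}"

lemma specialize_eqI: "tens 1 z \<simeq> tens r 1 \<Longrightarrow> specialize z = r"
  unfolding specialize_def
  by (rule the_equality) (auto intro: left_eq M.cong_trans M.cong_sym)

lemma specialize: "z \<in> specializable \<Longrightarrow> tens 1 z \<simeq> tens (specialize z) 1"
  using specialize_eqI by (auto simp: specializable_def)

lemma specializableI: "tens 1 z \<simeq> tens r 1 \<Longrightarrow> z \<in> specializable"
  by (auto simp: specializable_def)

lemma add_cong:
  assumes "tens 1 x \<simeq> tens r 1" "tens 1 y \<simeq> tens r' 1"
  shows "tens 1 (x + y) \<simeq> tens (r + r') 1"
proof -
  have "tens 1 (x + y) \<simeq> tens 1 x + tens 1 y" by (rule right_add)
  also have "\<dots> \<simeq> tens r 1 + tens r' 1" by (intro M.cong_add assms)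
  finally show ?thesis by (simp add: tens_add)
qed

lemma mult_cong:
  assumes "tens 1 x \<simeq> tens r 1" "tens 1 y \<simeq> tens r' 1"
  shows "tens 1 (x * y) \<simeq> tens (r * r') 1"
  using M.cong_mult[OF assms] by (simp add: tens_mult)

lemma \<kappa>_cong: "k \<in> K \<Longrightarrow> tens 1 (\<kappa> k) \<simeq> tens (\<kappa> k) 1"
  using right_scale[of k 1 1] by simp

lemma \<psi>_cong: "tens 1 x \<simeq> tens r 1 \<Longrightarrow> tens 1 (\<psi> x) \<simeq> tens (\<psi> r) 1"
  using M.cong_\<psi>[of "tens 1 x" "tens r 1"] by (simp add: tens_\<psi>_tens \<psi>_one)

lemma uminus_cong:
  assumes "tens 1 x \<simeq> tens r 1"
  shows "tens 1 (- x) \<simeq> tens (- r) 1"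
  using mult_cong[OF \<kappa>_cong[OF j_K[of "-1"]] assms] by (simp add: scalar_uminus)

lemma solution_cong:
  assumes "solution z"
  shows "\<exists>\<mu> \<nu>. tens 1 z \<simeq> tens (scalar \<mu> * p + scalar \<nu> * q) 1"
proof -
  obtain \<mu> \<nu> where *: "tens d 1 * wronskian p z \<simeq> tens (scalar \<mu>) 1"
    "tens d 1 * wronskian q z \<simeq> tens (scalar \<nu>) 1"
    using wronskian_constant solution_p solution_q assms by meson
  have "tens 1 z \<simeq> tens q 1 * tens (scalar \<mu>) 1 - tens p 1 * tens (scalar \<nu>) 1"
    by (subst right_expand[of z]) (intro M.cong_diff M.cong_mult * M.cong_refl)
  also have "\<dots> = tens (scalar (- \<nu>) * p + scalar \<mu> * q) 1"
    by (simp add: tens_mult tens_diff[symmetric] scalar_uminus algebra_simps)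
  finally show ?thesis by blast
qed

text \<open>The images of \<open>p\<close> and \<open>q\<close> have the Casoratian of
  \<open>p\<close> and \<open>q\<close> times the complex determinant. Modulo \<open>m\<close> this
  is the Casoratian of the right factor, which is a unit, so the determinant is not 0.\<close>

lemma specialization_coefficients:
  obtains c11 c12 c21 c22 where
    "tens 1 p \<simeq> tens (scalar c11 * p + scalar c21 * q) 1"
    "tens 1 q \<simeq> tens (scalar c12 * p + scalar c22 * q) 1"
    "c11 * c22 - c12 * c21 \<noteq> 0"
    "tens 1 d \<simeq> tens (scalar (inverse (c11 * c22 - c12 * c21)) * d) 1"
proof -
  obtain c11 c21 where cp: "tens 1 p \<simeq> tens (scalar c11 * p + scalar c21 * q) 1"
    using solution_cong[OF solution_p] by blast
  obtain c12 c22 where cq: "tens 1 q \<simeq> tens (scalar c12 * p + scalar c22 * q) 1"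
    using solution_cong[OF solution_q] by blast
  define \<delta> where "\<delta> = c11 * c22 - c12 * c21"
  have "tens 1 (p * \<psi> q + - (q * \<psi> p)) \<simeq> tens ((scalar c11 * p + scalar c21 * q) *
      \<psi> (scalar c12 * p + scalar c22 * q) + - ((scalar c12 * p + scalar c22 * q) *
      \<psi> (scalar c11 * p + scalar c21 * q))) 1"
    by (intro add_cong uminus_cong mult_cong \<psi>_cong cp cq)
  also have "(scalar c11 * p + scalar c21 * q) *
      \<psi> (scalar c12 * p + scalar c22 * q) + - ((scalar c12 * p + scalar c22 * q) *
      \<psi> (scalar c11 * p + scalar c21 * q)) = scalar \<delta> * (p * \<psi> q - q * \<psi> p)"
    by (simp add: \<psi>_add \<psi>_mult \<psi>_scalar \<delta>_def scalar_diff scalar_mult algebra_simps)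
  finally have D: "tens 1 (p * \<psi> q - q * \<psi> p) \<simeq> tens (scalar \<delta> * (p * \<psi> q - q * \<psi> p)) 1"
    by simp
  have "tens 1 ((p * \<psi> q - q * \<psi> p) * d) \<simeq> tens (scalar \<delta> * (p * \<psi> q - q * \<psi> p)) 1 * tens 1 d"
    using M.cong_mult[OF D M.cong_refl, of "tens 1 d"] by (simp add: tens_mult)
  hence one: "1 \<simeq> tens (scalar \<delta> * (p * \<psi> q - q * \<psi> p)) 1 * tens 1 d"
    by (simp add: casoratian tens_one)
  have "\<delta> \<noteq> 0"
  proof
    assume "\<delta> = 0"
    thus False using one M.one_not_mem by (simp add: M.cong_0_iff)
  qed
  have "tens (scalar (inverse \<delta>) * d) 1 * 1 \<simeq>
      tens (scalar (inverse \<delta>) * d) 1 * (tens (scalar \<delta> * (p * \<psi> q - q * \<psi> p)) 1 * tens 1 d)"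
    by (intro M.cong_mult one M.cong_refl)
  also have "\<dots> = tens ((scalar (inverse \<delta>) * scalar \<delta>) * ((p * \<psi> q - q * \<psi> p) * d)) d"
    by (simp add: tens_mult ac_simps)
  also have "\<dots> = tens 1 d" by (simp only: scalar_inverse[OF \<open>\<delta> \<noteq> 0\<close>] casoratian mult_1)
  finally have "tens 1 d \<simeq> tens (scalar (inverse \<delta>) * d) 1"
    by (simp add: M.cong_sym)
  with cp cq \<open>\<delta> \<noteq> 0\<close> show ?thesis using that unfolding \<delta>_def by blast
qed

lemma specializable_UNIV: "specializable = UNIV"
proof (rule generated)
  obtain c11 c12 c21 c22 where c:
    "tens 1 p \<simeq> tens (scalar c11 * p + scalar c21 * q) 1"
    "tens 1 q \<simeq> tens (scalar c12 * p + scalar c22 * q) 1"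
    "tens 1 d \<simeq> tens (scalar (inverse (c11 * c22 - c12 * c21)) * d) 1"
    using specialization_coefficients by metis
  show "{p, q, \<psi> p, \<psi> q, d} \<subseteq> specializable"
    using c \<psi>_cong[OF c(1)] \<psi>_cong[OF c(2)] by (auto intro: specializableI)
  show "\<kappa> ` K \<subseteq> specializable" using \<kappa>_cong by (auto intro: specializableI)
  have "x - y \<in> specializable" "x * y \<in> specializable"
    if xy: "x \<in> specializable" "y \<in> specializable" for x y
  proof -
    from xy obtain r r' where r: "tens 1 x \<simeq> tens r 1" "tens 1 y \<simeq> tens r' 1"
      by (auto simp: specializable_def)
    show "x - y \<in> specializable"
      using add_cong[OF r(1) uminus_cong[OF r(2)]] by (auto intro: specializableI)
    show "x * y \<in> specializable" using mult_cong[OF r] by (rule specializableI)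
  qed
  moreover have "1 \<in> specializable" by (rule specializableI[of _ 1]) simp
  ultimately show "is_subring specializable" by (auto simp: is_subring_def)
qed

lemma specialize_cong: "tens 1 z \<simeq> tens (specialize z) 1"
  by (rule specialize) (simp add: specializable_UNIV)

lemma specialize_add: "specialize (x + y) = specialize x + specialize y"
  and specialize_mult: "specialize (x * y) = specialize x * specialize y"
  and specialize_\<kappa>: "k \<in> K \<Longrightarrow> specialize (\<kappa> k) = \<kappa> k"
  and specialize_\<psi>: "specialize (\<psi> x) = \<psi> (specialize x)"
  by (intro specialize_eqI add_cong mult_cong \<kappa>_cong \<psi>_cong specialize_cong; assumption)+

lemma specialize_one: "specialize 1 = 1"
  by (rule specialize_eqI) simp

lemma specialize_coefficients:
  obtains c11 c12 c21 c22 where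
    "specialize p = scalar c11 * p + scalar c21 * q"
    "specialize q = scalar c12 * p + scalar c22 * q"
    "c11 * c22 - c12 * c21 \<noteq> 0"
    "specialize d = scalar (inverse (c11 * c22 - c12 * c21)) * d"
  using specialization_coefficients specialize_eqI by metis

text \<open>The kernel is a proper stable ideal, hence zero. For surjectivity it is enough to reach
  the generators, and Cramer's rule for the complex matrix gives preimages.\<close>

lemma specialize_galois: "specialize \<in> galois_automorphisms K \<kappa> \<psi>"
proof -
  have zero: "specialize 0 = 0" using specialize_add[of 0 0] by simp
  have uminus: "specialize (- x) = - specialize x" for x
    using specialize_add[of "-x" x] zero by (simp add: eq_neg_iff_add_eq_0)
  have diff: "specialize (x - y) = specialize x - specialize y" for x y
    using specialize_add[of x "- y"] by (simp add: uminus)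
  have "stable_ideal {x. specialize x = 0}"
    unfolding stable_ideal_def ring_ideal_iff
    by (auto simp: zero specialize_add specialize_mult specialize_\<psi>)
  moreover have "{x. specialize x = 0} \<noteq> UNIV"
    using specialize_one by (metis UNIV_I mem_Collect_eq zero_neq_one)
  ultimately have "{x. specialize x = 0} = {0}" using simple by blast
  hence inj: "inj specialize"
    by (intro injI) (metis (mono_tags, lifting) diff eq_iff_diff_eq_0 mem_Collect_eq singletonD)
  obtain c11 c12 c21 c22 where c:
    "specialize p = scalar c11 * p + scalar c21 * q"
    "specialize q = scalar c12 * p + scalar c22 * q"
    "c11 * c22 - c12 * c21 \<noteq> 0"
    "specialize d = scalar (inverse (c11 * c22 - c12 * c21)) * d"
    using specialize_coefficients by metis
  define \<delta> where "\<delta> = c11 * c22 - c12 * c21"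
  have \<delta>: "scalar (inverse \<delta>) * scalar \<delta> = 1" using c(3) by (simp add: scalar_inverse \<delta>_def)
  have "range specialize = UNIV"
  proof (rule generated)
    show "is_subring (range specialize)"
      unfolding is_subring_def
    proof (intro conjI ballI)
      show "1 \<in> range specialize" by (metis rangeI specialize_one)
    next
      fix x y assume "x \<in> range specialize" "y \<in> range specialize"
      then obtain x' y' where "x = specialize x'" "y = specialize y'" by blast
      thus "x - y \<in> range specialize" "x * y \<in> range specialize"
        by (auto intro: range_eqI[of _ _ "x' - y'"] range_eqI[of _ _ "x' * y'"]
            simp: specialize_mult diff)
    qed
    show "\<kappa> ` K \<subseteq> range specialize" by (metis image_subsetI rangeI specialize_\<kappa>)
    have "specialize (scalar (inverse \<delta>) * (scalar c22 * p - scalar c21 * q)) =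
        scalar (inverse \<delta>) * scalar \<delta> * p"
      by (simp add: specialize_mult specialize_add diff specialize_\<kappa> j_K c \<delta>_def scalar_diff
          scalar_mult algebra_simps)
    hence p: "p = specialize (scalar (inverse \<delta>) * (scalar c22 * p - scalar c21 * q))"
      by (simp add: \<delta>)
    have "specialize (scalar (inverse \<delta>) * (scalar c11 * q - scalar c12 * p)) =
        scalar (inverse \<delta>) * scalar \<delta> * q"
      by (simp add: specialize_mult specialize_add diff specialize_\<kappa> j_K c \<delta>_def scalar_diff
          scalar_mult algebra_simps)
    hence q: "q = specialize (scalar (inverse \<delta>) * (scalar c11 * q - scalar c12 * p))"
      by (simp add: \<delta>)
    have "specialize (scalar \<delta> * d) = scalar (inverse \<delta>) * scalar \<delta> * d"
      by (simp add: specialize_mult specialize_\<kappa> j_K c(4) \<delta>_def)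
    hence d: "d = specialize (scalar \<delta> * d)" by (simp add: \<delta>)
    show "{p, q, \<psi> p, \<psi> q, d} \<subseteq> range specialize"
      using p q d by (metis empty_subsetI insert_subset rangeI specialize_\<psi>)
  qed
  with inj show ?thesis
    by (auto simp: galois_automorphisms_def ring_aut_def ring_hom_on_def bij_def specialize_one
        specialize_add specialize_mult specialize_\<kappa> specialize_\<psi>)
qed

text \<open>Modulo \<open>m\<close> the right entry moves to the left through
  \<open>specialize\<close>. Hence \<open>m\<close> is exactly the kernel of r \<otimes> z \<mapsto>
  r * specialize z.\<close>

lemma specialize_tensor: "f \<simeq> tens (tens_lift id specialize f) 1"
proof (induction f rule: monoid_algebra_induct)
  case (tens x y)
  have "tens x 1 * tens 1 y \<simeq> tens x 1 * tens (specialize y) 1"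
    by (intro M.cong_mult M.cong_refl specialize_cong)
  thus ?case by (simp add: tens_mult tens_lift_tens)
qed (auto simp: tens_lift_add tens_add intro: M.cong_add)

lemma specialize_tensor_eq_0_iff: "tens_lift id specialize f = 0 \<longleftrightarrow> f \<in> m"
  using M.cong_mem_iff[OF specialize_tensor[of f]] left_eq_0 by auto

end


context second_order_pv
begin

text \<open>Automorphisms as points of the tensor square: the zero set of \<open>J0\<close> has a
  point at which \<open>s\<close> does not vanish.\<close>

lemma specialization:
  assumes J0: "tensor.stable_ideal J0" "tensor_kernel \<subseteq> J0" "\<And>n. s ^ n \<notin> J0"
    and s: "tens_\<psi> s - e * s \<in> J0" "e * e' = 1"
  obtains \<sigma> c11 c12 c21 c22 where
    "\<sigma> \<in> galois_automorphisms K \<kappa> \<psi>" "\<sigma> p = scalar c11 * p + scalar c21 * q"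
    "\<sigma> q = scalar c12 * p + scalar c22 * q" "c11 * c22 - c12 * c21 \<noteq> 0"
    "\<And>f. f \<in> J0 \<Longrightarrow> tens_lift id \<sigma> f = 0" "tens_lift id \<sigma> s \<noteq> 0"
proof -
  obtain m where m: "tensor.stable_ideal m" "J0 \<subseteq> m" "\<And>n. s ^ n \<notin> m"
    "\<And>J. tensor.stable_ideal J \<Longrightarrow> m \<subseteq> J \<Longrightarrow> (\<And>n. s ^ n \<notin> J) \<Longrightarrow> J = m"
    using tensor.ex_maximal_stable_ideal[OF J0(1,3)] by metis
  have max: "maximal_stable_ideal K \<phi> j tens_\<kappa> tens_\<psi> m s e e' tens_span"
  proof unfold_locales
    show "tensor.spanned_mod m tens_span = UNIV"
      using m J0(2) by (intro tensor_spanned) (auto simp: tensor.stable_ideal_def)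
  qed (use m s in auto)
  interpret tensor_maximal_ideal K \<phi> j \<kappa> \<psi> a b p q d m s e e'
    by (intro tensor_maximal_ideal.intro tensor_maximal_ideal_axioms.intro second_order_pv_axioms)
       (use max m(2) J0(2) in auto)
  obtain c11 c12 c21 c22 where
    "specialize p = scalar c11 * p + scalar c21 * q"
    "specialize q = scalar c12 * p + scalar c22 * q"
    "c11 * c22 - c12 * c21 \<noteq> 0"
    using specialize_coefficients by metis
  moreover have "s \<notin> m" using m(3)[of 1] by simp
  ultimately show ?thesis
    using that specialize_galois specialize_tensor_eq_0_iff m(2) by blast
qed

end

section \<open>Invariant lines and the Riccati equation\<close>

context difference_algebra
begin

lemma \<kappa>_cancel: "k \<in> K \<Longrightarrow> \<kappa> k * x = 0 \<Longrightarrow> k = 0 \<or> x = 0"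
  by (metis \<kappa>_inverse mult.assoc mult_1 mult_zero_right)

lemma \<kappa>_eq_0_iff: "k \<in> K \<Longrightarrow> \<kappa> k = 0 \<longleftrightarrow> k = 0"
  using \<kappa>_cancel[of k 1] by auto

lemma scalar_eq_0_iff [simp]: "scalar c = 0 \<longleftrightarrow> c = 0"
  by (simp add: \<kappa>_eq_0_iff j_K)

text \<open>Both derivatives have degree \<open>d\<close>, in which no form vanishes, so their
  coefficients are zero. In characteristic 0 the first derivative then clears \<open>f k\<close> for
  \<open>k \<le> d\<close>, and the second the remaining \<open>f (Suc d)\<close>.\<close>

lemma form_derivatives_zero:
  assumes "\<And>k. f k \<in> K" "\<not> form_vanishes d x y"
    and "form (form_dx d f) d x y = 0" "form (form_dy f) d x y = 0"
    and "k \<le> Suc d"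
  shows "f k = 0"
proof -
  have vanish: "g k = 0" if "\<And>k. g k \<in> K" "form g d x y = 0" "k \<le> d" for g k
    using that assms(2) unfolding form_vanishes_def by blast
  have dx: "form_dx d f k = 0" if "k \<le> d" for k
    by (rule vanish[OF _ assms(3) that]) (unfold form_dx_def, intro K_mult of_nat_K assms(1))
  have dy: "form_dy f k = 0" if "k \<le> d" for k
    by (rule vanish[OF _ assms(4) that]) (unfold form_dy_def, intro K_mult of_nat_K assms(1))
  show ?thesis
  proof (cases "k \<le> d")
    case True
    hence "Suc d - k \<noteq> 0" by simp
    thus ?thesis using dx[OF True] unfolding form_dx_def by (metis mult_eq_0_iff of_nat_K_eq_0_iff)
  next
    case False
    hence "k = Suc d" using assms(5) by simp
    thus ?thesis using dy[of d] unfolding form_dy_def by (metis le_refl mult_eq_0_iff nat.simps(3) of_nat_K_eq_0_iff)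
  qed
qed

end

context simple_difference_algebra
begin

lemma tensor_form_left:
  assumes "\<And>k. f k \<in> K"
  shows "tensor.form f n (tens x 1) (tens y 1) = tens (form f n x y) 1"
  using assms by (simp add: tensor.form_def form_def tens_power tens_mult tens_\<kappa>_def tens_sum)

text \<open>The coefficients sit in the left entry, where \<open>T\<close> pulls them out; what is
  left is \<open>T 1\<close> times the vanishing form.\<close>

lemma tensor_form_right:
  assumes f: "\<And>k. f k \<in> K" and 0: "form f n x y = 0"
  shows "tensor.form f n (tens 1 x) (tens 1 y) \<in> tensor_kernel"
  unfolding tensor_kernel_def
proof (intro CollectI allI impI)
  fix T assume T: "K_linear T"
  have lift_sum: "tens_lift T id (sum F A) = (\<Sum>i\<in>A. tens_lift T id (F i))"
    for F :: "nat \<Rightarrow> 'a monoid_algebra" and A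
    by (induction A rule: infinite_finite_induct) (auto simp: tens_lift_add K_linearD[OF T])
  have "tens_lift T id (tensor.form f n (tens 1 x) (tens 1 y)) =
      (\<Sum>k\<le>n. T (\<kappa> (f k) * 1) * (x ^ (n - k) * y ^ k))"
    by (simp add: tensor.form_def tens_power tens_mult tens_\<kappa>_def lift_sum tens_lift_tens
        K_linearD[OF T])
  also have "\<dots> = T 1 * form f n x y"
    unfolding K_linearD(2)[OF T f] form_def sum_distrib_left by (simp add: ac_simps)
  finally show "tens_lift T id (tensor.form f n (tens 1 x) (tens 1 y)) = 0"
    using 0 by simp
qed

text \<open>The annihilator of \<open>L\<close> in the tensor square is stable because the
  endomorphism multiplies \<open>L\<close> by a unit.\<close>

lemma kernel_quotient_stable:
  assumes L: "tens_\<psi> L - e * L \<in> tensor_kernel" "e' * e = 1"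
  shows "tensor.stable_ideal {f. f * L \<in> tensor_kernel}"
proof -
  have "tens_\<psi> f * L \<in> tensor_kernel" if "f * L \<in> tensor_kernel" for f
  proof -
    have "tens_\<psi> (f * L) \<in> tensor_kernel"
      using that tensor_kernel_stable by (auto simp: tensor.stable_ideal_def)
    hence "tens_\<psi> f * tens_\<psi> L \<in> tensor_kernel" by (simp add: tensor.\<psi>_mult)
    moreover have "tens_\<psi> f * (tens_\<psi> L - e * L) \<in> tensor_kernel" by (intro ker.mult_mem L)
    ultimately have "tens_\<psi> f * tens_\<psi> L - tens_\<psi> f * (tens_\<psi> L - e * L) \<in> tensor_kernel"
      by (rule ker.diff_mem)
    from ker.mult_mem[OF this, of e'] have "(e' * e) * (tens_\<psi> f * L) \<in> tensor_kernel"
      by (simp add: algebra_simps)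
    thus ?thesis by (simp add: L)
  qed
  thus ?thesis
    unfolding tensor.stable_ideal_def ring_ideal_iff
    by (auto simp: distrib_right mult.assoc intro: ker.add_mem ker.mult_mem)
qed

end

context second_order_pv
begin

text \<open>The Casoratian of \<open>y\<close> with \<open>q\<close> is \<open>v\<close> times a
  unit, and with \<open>p\<close> it is \<open>v'\<close> times a unit up to sign; one of them is
  invertible.\<close>

lemma solution_unimodular:
  assumes y: "y = scalar v * p + scalar v' * q" and nz: "v \<noteq> 0 \<or> v' \<noteq> 0"
  obtains \<alpha> \<beta> where "\<alpha> * y + \<beta> * \<psi> y = 1"
proof -
  have \<psi>y: "\<psi> y = scalar v * \<psi> p + scalar v' * \<psi> q"
    by (simp add: y \<psi>_add \<psi>_mult \<psi>_scalar)
  from nz show ?thesis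
  proof
    assume v: "v \<noteq> 0"
    have "scalar (inverse v) * d * \<psi> q * y + - (scalar (inverse v) * d * q) * \<psi> y =
        (scalar (inverse v) * scalar v) * ((p * \<psi> q - q * \<psi> p) * d)"
      unfolding \<psi>y unfolding y by (simp add: algebra_simps)
    also have "\<dots> = 1" by (simp only: scalar_inverse[OF v] casoratian mult_1)
    finally show ?thesis by (rule that)
  next
    assume v: "v' \<noteq> 0"
    have "- (scalar (inverse v') * d * \<psi> p) * y + scalar (inverse v') * d * p * \<psi> y =
        (scalar (inverse v') * scalar v') * ((p * \<psi> q - q * \<psi> p) * d)"
      unfolding \<psi>y unfolding y by (simp add: algebra_simps)
    also have "\<dots> = 1" by (simp only: scalar_inverse[OF v] casoratian mult_1)
    finally show ?thesis by (rule that)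
  qed
qed

lemma solution_combination: "solution (scalar v * p + scalar v' * q)"
  by (simp add: solution_def \<psi>_add \<psi>_mult \<psi>_scalar eq_p eq_q algebra_simps)

text \<open>
  The element \<open>L = y \<otimes> \<psi> y - \<psi> y \<otimes> y\<close> of the tensor square vanishes under every automorphism that
  preserves the line of \<open>y\<close>. Suppose \<open>y\<close> and \<open>\<psi> y\<close> are independent over \<open>K\<close>. If no form over
  \<open>K\<close> vanishes at \<open>(y, \<psi> y)\<close>, then \<open>L\<close> is not nilpotent and can be kept nonzero. Otherwise take a
  form \<open>F\<close> of least degree; at the second copy of \<open>(y, \<psi> y)\<close> it factors as \<open>L F'\<close>, and an
  automorphism killing the annihilator of \<open>L\<close> forces the partial derivatives of \<open>F\<close> to vanish
  at \<open>(y, \<psi> y)\<close>, against minimality.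
\<close>

lemma invariant_line_dependent:
  assumes y: "y = scalar v * p + scalar v' * q" and nz: "v \<noteq> 0 \<or> v' \<noteq> 0"
    and eigen: "\<And>\<sigma> c11 c12 c21 c22. \<sigma> \<in> galois_automorphisms K \<kappa> \<psi> \<Longrightarrow>
      \<sigma> p = scalar c11 * p + scalar c21 * q \<Longrightarrow> \<sigma> q = scalar c12 * p + scalar c22 * q \<Longrightarrow>
      c11 * c22 - c12 * c21 \<noteq> 0 \<Longrightarrow> \<exists>\<mu>. \<sigma> y = scalar \<mu> * y"
  shows "form_vanishes 1 y (\<psi> y)"
proof (rule ccontr)
  assume indep: "\<not> form_vanishes 1 y (\<psi> y)"
  define L where "L = wronskian y y"
  have L: "L = tens y (\<psi> y) - tens (\<psi> y) y" by (simp add: L_def wronskian_def)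
  have sol: "solution y" unfolding y by (rule solution_combination)
  have L\<psi>: "tens_\<psi> L - tens_\<kappa> b * L \<in> tensor_kernel"
    unfolding L_def by (rule wronskian_kernel[OF sol sol])
  have unit: "tens_\<kappa> b * tens_\<kappa> (inverse b) = 1" "tens_\<kappa> (inverse b) * tens_\<kappa> b = 1"
    using tensor.\<kappa>_inverse[OF b_K b_nz] by (simp_all add: mult.commute)
  obtain \<alpha> \<beta> where \<alpha>\<beta>: "\<alpha> * y + \<beta> * \<psi> y = 1" using solution_unimodular[OF y nz] .
  have lift_diff: "tens_lift id \<sigma> (f - g) = tens_lift id \<sigma> f - tens_lift id \<sigma> g"
    for \<sigma> :: "'a \<Rightarrow> 'a" and f g
    using tens_lift_add[of id \<sigma> "f - g" g] by simp
  have lift_L: "tens_lift id \<sigma> L = 0" if "\<sigma> \<in> galois_automorphisms K \<kappa> \<psi>" "\<sigma> y = scalar \<mu> * y" for \<sigma> \<mu>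
    using that by (simp add: L lift_diff tens_lift_tens galois_action \<psi>_mult \<psi>_scalar ac_simps)
  show False
  proof (cases "\<exists>n. form_vanishes n y (\<psi> y)")
    case False
    \<comment> \<open>Here \<open>L\<close> itself can serve as the element \<open>s\<close> to be
      kept nonzero.\<close>
    hence "L ^ n \<notin> tensor_kernel" for n
      using wronskian_power_in_kernel unfolding L by blast
    from specialization[OF tensor_kernel_stable subset_refl this L\<psi> unit(1)]
    obtain \<sigma> c11 c12 c21 c22 where
      "\<sigma> \<in> galois_automorphisms K \<kappa> \<psi>" "\<sigma> p = scalar c11 * p + scalar c21 * q"
      "\<sigma> q = scalar c12 * p + scalar c22 * q" "c11 * c22 - c12 * c21 \<noteq> 0"
      "tens_lift id \<sigma> L \<noteq> 0" by metis
    thus False using eigen lift_L by blast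
  next
    case True
    define n where "n = (LEAST n. form_vanishes n y (\<psi> y))"
    have n: "form_vanishes n y (\<psi> y)" unfolding n_def using True by (metis LeastI)
    have min: "\<not> form_vanishes k y (\<psi> y)" if "k < n" for k
      using not_less_Least that unfolding n_def by blast
    have "n \<noteq> 0"
    proof
      assume "n = 0"
      then obtain f :: "nat \<Rightarrow> 'k" where "\<forall>k. f k \<in> K" "f 0 \<noteq> 0" "\<kappa> (f 0) = 0"
        using n by (auto simp: form_vanishes_def form_def)
      thus False by (simp add: \<kappa>_eq_0_iff)
    qed
    then obtain l where l: "n = Suc l" by (cases n) auto
    obtain f where f: "\<And>k. f k \<in> K" "\<exists>k\<le>Suc l. f k \<noteq> 0" "form f (Suc l) y (\<psi> y) = 0"
      using n unfolding l form_vanishes_def by blast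
    define J where "J = {f. f * L \<in> tensor_kernel}"
    have J: "tensor.stable_ideal J" unfolding J_def using kernel_quotient_stable[OF L\<psi> unit(2)] .
    have kernel_J: "tensor_kernel \<subseteq> J"
      using tensor_kernel_stable
      by (auto simp: J_def tensor.stable_ideal_def ring_ideal_iff mult.commute[of _ L])
    \<comment> \<open>Independence of \<open>y\<close> and \<open>\<psi> y\<close> implies that
      \<open>L\<close> is not zero in the tensor square, so 1 does not annihilate it.\<close>
    have "1 ^ k \<notin> J" for k
      using wronskian_power_in_kernel[of y "\<psi> y" 1] indep unfolding L J_def by auto
    moreover have "tens_\<psi> 1 - 1 * 1 \<in> J"
      using J by (simp add: tensor.\<psi>_one tensor.stable_ideal_def ring_ideal_iff)
    ultimately obtain \<sigma> c11 c12 c21 c22 where \<sigma>: "\<sigma> \<in> galois_automorphisms K \<kappa> \<psi>"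
      "\<sigma> p = scalar c11 * p + scalar c21 * q"
      "\<sigma> q = scalar c12 * p + scalar c22 * q" "c11 * c22 - c12 * c21 \<noteq> 0"
      and lift_J: "\<And>f. f \<in> J \<Longrightarrow> tens_lift id \<sigma> f = 0"
      using specialization[OF J kernel_J, of 1 1 1] by (metis mult_1)
    from eigen[OF \<sigma>] obtain \<mu> where \<mu>: "\<sigma> y = scalar \<mu> * y" by blast
    \<comment> \<open>The pairs \<open>(y, \<psi> y)\<close> and
      \<open>(- \<beta>, \<alpha>)\<close> have determinant 1; \<open>N\<close> and \<open>L\<close>
      are the coordinates of the right-hand copy of \<open>(y, \<psi> y)\<close> in this
      basis.\<close>
    define N where "N = tens \<alpha> y + tens \<beta> (\<psi> y)"
    have lift_mult: "tens_lift id \<sigma> (f * g) = tens_lift id \<sigma> f * tens_lift id \<sigma> g" for f g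
      by (rule tens_lift_mult) (use \<sigma>(1) in \<open>auto simp: galois_action\<close>)
    have lift_add: "tens_lift id \<sigma> (f + g) = tens_lift id \<sigma> f + tens_lift id \<sigma> g" for f g
      by (rule tens_lift_add) auto
    have lift_power: "tens_lift id \<sigma> (f ^ k) = tens_lift id \<sigma> f ^ k" for f k
    proof (induction k)
      case 0
      have "tens_lift id \<sigma> (tens 1 1) = 1"
        by (subst tens_lift_tens) (auto simp: galois_action(3)[OF \<sigma>(1)])
      thus ?case by (simp only: power_0 tens_one)
    qed (simp only: power_Suc lift_mult)
    have "tens_lift id \<sigma> N = scalar \<mu> * (\<alpha> * y + \<beta> * \<psi> y)"
      using \<sigma>(1) by (simp add: N_def lift_add tens_lift_tens \<mu> galois_action \<psi>_mult \<psi>_scalar algebra_simps)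
    hence lift_N: "tens_lift id \<sigma> N = scalar \<mu>" using \<alpha>\<beta> by simp
    have "\<mu> \<noteq> 0"
    proof
      assume "\<mu> = 0"
      hence "\<sigma> y = 0" "\<sigma> (\<psi> y) = 0" using \<mu> galois_action(6)[OF \<sigma>(1)] by auto
      hence "\<sigma> (\<alpha> * y + \<beta> * \<psi> y) = 0" by (simp add: galois_action[OF \<sigma>(1)])
      thus False using \<alpha>\<beta> galois_action(3)[OF \<sigma>(1)] by simp
    qed
    have left: "tens 1 y = tens (\<alpha> * y + \<beta> * \<psi> y) y" "tens 1 (\<psi> y) = tens (\<alpha> * y + \<beta> * \<psi> y) (\<psi> y)"
      by (simp_all add: \<alpha>\<beta>)
    have X: "tens 1 y = tens y 1 * N + tens (- \<beta>) 1 * L"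
      "tens 1 (\<psi> y) = tens (\<psi> y) 1 * N + tens \<alpha> 1 * L"
      unfolding left
      by (simp_all add: N_def L distrib_left right_diff_distrib tens_mult tens_add tens_uminus ac_simps)
    define F1 F2 where "F1 = form (form_dx l f) l y (\<psi> y)" and "F2 = form (form_dy f) l y (\<psi> y)"
    \<comment> \<open>The derivative of the form in the direction
      \<open>(- \<beta>, \<alpha>)\<close>. The cofactor of \<open>L\<close> in the form lies in
      \<open>J\<close>; \<sigma> sends \<open>L\<close> to 0 and \<open>N\<close> to
      \<open>scalar \<mu>\<close>, which leaves \<open>scalar \<mu> ^ l * g = 0\<close>.\<close>
    define g where "g = \<alpha> * F2 - \<beta> * F1"
    obtain h where h: "tensor.form f (Suc l) (tens y 1 * N + tens (- \<beta>) 1 * L)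
        (tens (\<psi> y) 1 * N + tens \<alpha> 1 * L) = tensor.form f (Suc l) (tens y 1) (tens (\<psi> y) 1) * N ^ Suc l +
      L * (N ^ l * (tens (- \<beta>) 1 * tensor.form (form_dx l f) l (tens y 1) (tens (\<psi> y) 1) +
        tens \<alpha> 1 * tensor.form (form_dy f) l (tens y 1) (tens (\<psi> y) 1)) + L * h)"
      using tensor.form_taylor[of f, OF f(1)] by blast
    have "form_dx l f k \<in> K" "form_dy f k \<in> K" for k
      unfolding form_dx_def form_dy_def by (intro K_mult of_nat_K f(1))+
    note left_forms = tensor_form_left[of f, OF f(1)] tensor_form_left[of "form_dx l f", OF this(1)]
      tensor_form_left[of "form_dy f", OF this(2)]
    have "tens (- \<beta>) 1 * tens F1 1 + tens \<alpha> 1 * tens F2 1 = tens g 1"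
      by (simp add: g_def tens_mult tens_diff tens_uminus)
    hence "tensor.form f (Suc l) (tens 1 y) (tens 1 (\<psi> y)) = L * (N ^ l * tens g 1 + L * h)"
      unfolding X h left_forms f(3) F1_def[symmetric] F2_def[symmetric] by simp
    hence "N ^ l * tens g 1 + L * h \<in> J"
      using tensor_form_right[of f, OF f(1,3)] by (simp add: J_def mult.commute)
    hence "scalar \<mu> ^ l * g = 0"
      using lift_J[of "N ^ l * tens g 1 + L * h"] lift_L[OF \<sigma>(1) \<mu>] galois_action(3)[OF \<sigma>(1)]
      by (simp add: lift_add lift_mult lift_power lift_N tens_lift_tens)
    moreover have "scalar (inverse \<mu>) ^ l * scalar \<mu> ^ l = 1"
      using \<open>\<mu> \<noteq> 0\<close> by (metis power_mult_distrib power_one scalar_inverse)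
    ultimately have g0: "g = 0"
      using mult.assoc[of "scalar (inverse \<mu>) ^ l" "scalar \<mu> ^ l" g] by simp
    have euler: "y * F1 + \<psi> y * F2 = 0"
      using form_euler[of f y l "\<psi> y", OF f(1)] f(3) by (simp add: F1_def F2_def)
    \<comment> \<open>\<open>g = 0\<close> and Euler's identity are two linear equations for
      \<open>F1\<close> and \<open>F2\<close> with determinant 1.\<close>
    have "F1 = F1 * (\<alpha> * y + \<beta> * \<psi> y)" "F2 = F2 * (\<alpha> * y + \<beta> * \<psi> y)" by (simp_all add: \<alpha>\<beta>)
    hence "F1 = \<alpha> * (y * F1 + \<psi> y * F2) - \<psi> y * g" "F2 = \<beta> * (y * F1 + \<psi> y * F2) + y * g"
      by (simp_all add: g_def algebra_simps)
    hence "F1 = 0" "F2 = 0" using euler g0 by auto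
    hence "f k = 0" if "k \<le> Suc l" for k
      using form_derivatives_zero[of f l y "\<psi> y", OF f(1) min[of l]] that
      by (simp add: l F1_def F2_def)
    thus False using f(2) by blast
  qed
qed

text \<open>The dependence can be solved for \<open>\<psi> y\<close> because \<open>y\<close> is
  nonzero; the second-order equation for \<open>y\<close> then becomes the Riccati equation for the
  quotient.\<close>

lemma riccati_of_invariant_line:
  assumes y: "y = scalar v * p + scalar v' * q" and nz: "v \<noteq> 0 \<or> v' \<noteq> 0"
    and eigen: "\<And>\<sigma> c11 c12 c21 c22. \<sigma> \<in> galois_automorphisms K \<kappa> \<psi> \<Longrightarrow>
      \<sigma> p = scalar c11 * p + scalar c21 * q \<Longrightarrow> \<sigma> q = scalar c12 * p + scalar c22 * q \<Longrightarrow>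
      c11 * c22 - c12 * c21 \<noteq> 0 \<Longrightarrow> \<exists>\<mu>. \<sigma> y = scalar \<mu> * y"
  shows "\<exists>u\<in>K. (\<phi> u + a) * u = - b \<and> \<psi> y = \<kappa> u * y"
proof -
  obtain \<alpha> \<beta> where \<alpha>\<beta>: "\<alpha> * y + \<beta> * \<psi> y = 1" using solution_unimodular[OF y nz] .
  have "y \<noteq> 0" using \<alpha>\<beta> by auto
  have "form_vanishes 1 y (\<psi> y)"
    by (rule invariant_line_dependent[OF y nz]) (rule eigen; assumption)
  then obtain f :: "nat \<Rightarrow> 'k" where f: "\<And>k. f k \<in> K" "f 0 \<noteq> 0 \<or> f 1 \<noteq> 0"
      "\<kappa> (f 0) * y + \<kappa> (f 1) * \<psi> y = 0"
    by (auto simp: form_vanishes_def form_def le_Suc_eq)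
  have "f 1 \<noteq> 0"
  proof
    assume "f 1 = 0"
    thus False using f \<kappa>_cancel[OF f(1)[of 0], of y] \<open>y \<noteq> 0\<close> by simp
  qed
  define u where "u = - f 0 / f 1"
  have u: "u \<in> K" unfolding u_def by (intro K_closed f)
  have \<kappa>u: "\<kappa> u = - (\<kappa> (inverse (f 1)) * \<kappa> (f 0))"
    using f(1) by (simp add: u_def divide_inverse \<kappa>_mult K_inverse \<kappa>_uminus K_mult mult.commute)
  have "\<kappa> (inverse (f 1)) * (\<kappa> (f 0) * y + \<kappa> (f 1) * \<psi> y) =
      (\<kappa> (inverse (f 1)) * \<kappa> (f 1)) * \<psi> y - \<kappa> u * y"
    unfolding \<kappa>u by (simp add: algebra_simps)
  also have "\<dots> = \<psi> y - \<kappa> u * y" using \<kappa>_inverse[OF f(1) \<open>f 1 \<noteq> 0\<close>] by simp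
  finally have "\<kappa> (inverse (f 1)) * (\<kappa> (f 0) * y + \<kappa> (f 1) * \<psi> y) = \<psi> y - \<kappa> u * y" .
  hence \<psi>y: "\<psi> y = \<kappa> u * y" using f(3) by simp
  have in_K: "\<phi> u * u + a * u + b \<in> K" by (intro K_add K_mult \<phi>_K u a_K b_K)
  have "\<kappa> (\<phi> u * u + a * u + b) * y = \<psi> (\<psi> y) + \<kappa> a * \<psi> y + \<kappa> b * y"
    by (simp add: \<psi>y \<psi>_mult \<psi>_\<kappa> u \<kappa>_add \<kappa>_mult K_add K_mult \<phi>_K a_K b_K distrib_left distrib_right ac_simps)
  also have "\<dots> = 0" using solution_combination[of v v'] by (simp add: solution_def y[symmetric])
  finally have "\<phi> u * u + a * u + b = 0"
    using \<kappa>_cancel[OF in_K] \<open>y \<noteq> 0\<close> by blast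
  hence "(\<phi> u + a) * u = - b" by (simp add: distrib_right eq_neg_iff_add_eq_0)
  with u \<psi>y show ?thesis by blast
qed

text \<open>A solution \<open>u\<close> factors the operator as (\<phi> - b/u)(\<phi> - u), so
  \<open>\<psi> p - \<kappa> u * p\<close> and \<open>\<psi> q - \<kappa> u * q\<close> are
  multiplied by the same element b/u under \<open>\<psi>\<close>. One of them is nonzero by the
  Casoratian, hence a unit, and the ratio of the other to it is constant.\<close>

lemma left_eigenvector_of_riccati:
  assumes u: "u \<in> K" "(\<phi> u + a) * u = - b"
  obtains l l' w w' where "l \<noteq> 0 \<or> l' \<noteq> 0" "w' * w = 1"
    "\<psi> p - \<kappa> u * p = scalar l * w" "\<psi> q - \<kappa> u * q = scalar l' * w"
proof -
  have "u \<noteq> 0" using u(2) b_nz by auto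
  define r where "r = b / u"
  have r: "r \<in> K" unfolding r_def by (intro K_divide b_K u)
  have ru: "r * u = b" using \<open>u \<noteq> 0\<close> by (simp add: r_def)
  have "(\<phi> u + a) * u = - r * u" using u(2) ru by simp
  hence "\<phi> u + a = - r"
    using mult_right_cancel[OF \<open>u \<noteq> 0\<close>, of "\<phi> u + a" "- r"] by blast
  hence a\<phi>u: "a + \<phi> u = - r" by (simp only: add.commute)
  have key: "\<psi> (\<psi> x - \<kappa> u * x) = \<kappa> r * (\<psi> x - \<kappa> u * x)"
    if x: "\<psi> (\<psi> x) = - \<kappa> a * \<psi> x - \<kappa> b * x" for x
  proof -
    have "\<psi> (\<psi> x - \<kappa> u * x) = - \<kappa> (a + \<phi> u) * \<psi> x - \<kappa> (r * u) * x"
      unfolding ru using x u(1) by (simp add: \<psi>_diff \<psi>_mult \<psi>_\<kappa> \<kappa>_add a_K \<phi>_K algebra_simps)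
    also have "\<dots> = \<kappa> r * (\<psi> x - \<kappa> u * x)"
      unfolding a\<phi>u using r u(1) by (simp add: \<kappa>_uminus \<kappa>_mult algebra_simps)
    finally show ?thesis .
  qed
  define w1 w2 where "w1 = \<psi> p - \<kappa> u * p" and "w2 = \<psi> q - \<kappa> u * q"
  have w1: "\<psi> w1 = \<kappa> r * w1" unfolding w1_def by (rule key[OF eq_p])
  have w2: "\<psi> w2 = \<kappa> r * w2" unfolding w2_def by (rule key[OF eq_q])
  show ?thesis
  proof (cases "w1 = 0")
    case False
    from ex_unit[OF this w1] obtain w' where w': "w' * w1 = 1" by blast
    have "\<psi> w' * (\<kappa> r * w1) = 1" using arg_cong[OF w', of \<psi>] by (simp add: \<psi>_mult w1 \<psi>_one)
    have "\<psi> (w2 * w') = \<kappa> r * (w2 * (w' * w1)) * \<psi> w'" by (simp add: \<psi>_mult w2 w')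
    also have "\<dots> = (w2 * w') * (\<psi> w' * (\<kappa> r * w1))" by (simp only: ac_simps)
    finally have "\<psi> (w2 * w') = w2 * w'" using \<open>\<psi> w' * (\<kappa> r * w1) = 1\<close> by simp
    from constant_scalar[OF this] obtain c where c: "w2 * w' = scalar c" by blast
    have "w2 = scalar c * w1" unfolding c[symmetric] by (simp add: mult.assoc w')
    show ?thesis
      by (rule that[of 1 c w' w1, folded w1_def w2_def])
         (simp_all add: \<open>w2 = scalar c * w1\<close> w')
  next
    case True
    have "w2 \<noteq> 0"
    proof
      assume "w2 = 0"
      with True have "p * \<psi> q - q * \<psi> p = 0" by (simp add: w1_def w2_def ac_simps)
      thus False using casoratian by simp
    qed
    from ex_unit[OF this w2] obtain w' where "w' * w2 = 1" by blast
    thus ?thesis by (intro that[of 0 1 w' w2, folded w1_def w2_def]) (simp_all add: True)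
  qed
qed

text \<open>Eliminating \<open>\<sigma> w\<close> shows that the row (l, l') times the matrix of
  \<sigma> is proportional to (l, l'); the cross product says so without an eigenvalue.\<close>

lemma left_eigenvector_invariant:
  assumes \<sigma>: "\<sigma> \<in> galois_automorphisms K \<kappa> \<psi>" "\<sigma> p = scalar c11 * p + scalar c21 * q"
      "\<sigma> q = scalar c12 * p + scalar c22 * q"
    and u: "u \<in> K" and w: "w' * w = 1" "\<psi> p - \<kappa> u * p = scalar l * w" "\<psi> q - \<kappa> u * q = scalar l' * w"
  shows "l' * (l * c11 + l' * c21) = l * (l * c12 + l' * c22)"
proof -
  note act = galois_action[OF \<sigma>(1)]
  have act_diff: "\<sigma> (x - y) = \<sigma> x - \<sigma> y" for x y
    using act(1)[of "x - y" y] by simp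
  have "\<sigma> (\<psi> p - \<kappa> u * p) = scalar c11 * (\<psi> p - \<kappa> u * p) + scalar c21 * (\<psi> q - \<kappa> u * q)"
    "\<sigma> (\<psi> q - \<kappa> u * q) = scalar c12 * (\<psi> p - \<kappa> u * p) + scalar c22 * (\<psi> q - \<kappa> u * q)"
    by (simp_all add: act act_diff \<sigma> u \<psi>_add \<psi>_mult \<psi>_scalar algebra_simps)
  hence "scalar l * \<sigma> w = (scalar c11 * scalar l + scalar c21 * scalar l') * w"
    "scalar l' * \<sigma> w = (scalar c12 * scalar l + scalar c22 * scalar l') * w"
    unfolding w by (simp_all add: act j_K distrib_right mult.assoc)
  hence "scalar l' * ((scalar c11 * scalar l + scalar c21 * scalar l') * w) =
      scalar l * ((scalar c12 * scalar l + scalar c22 * scalar l') * w)"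
    by (metis mult.left_commute)
  hence "scalar (l' * (l * c11 + l' * c21) - l * (l * c12 + l' * c22)) * w = 0"
    by (simp add: scalar_diff scalar_mult scalar_add algebra_simps)
  hence "l' * (l * c11 + l' * c21) - l * (l * c12 + l' * c22) = 0"
    using \<kappa>_cancel[OF j_K] w(1) by (metis j_eq_0_iff mult_zero_right zero_neq_one)
  thus ?thesis by simp
qed

text \<open>The determinant of the two rows is \<open>\<kappa> (v - u)\<close> times the Casoratian,
  which is a unit.\<close>

lemma left_eigenvectors_independent:
  assumes "u \<in> K" "v \<in> K" "u \<noteq> v"
    "\<psi> p - \<kappa> u * p = scalar l * w" "\<psi> q - \<kappa> u * q = scalar l' * w"
    "\<psi> p - \<kappa> v * p = scalar k * x" "\<psi> q - \<kappa> v * q = scalar k' * x"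
  shows "l * k' \<noteq> l' * k"
proof
  assume eq: "l * k' = l' * k"
  have "\<kappa> (v - u) * (p * \<psi> q - q * \<psi> p) =
      (\<psi> p - \<kappa> u * p) * (\<psi> q - \<kappa> v * q) - (\<psi> q - \<kappa> u * q) * (\<psi> p - \<kappa> v * p)"
    using assms(1,2) by (simp add: \<kappa>_diff algebra_simps)
  also have "\<dots> = (scalar (l * k') - scalar (l' * k)) * (w * x)"
    unfolding assms by (simp add: scalar_mult algebra_simps)
  finally have "\<kappa> (v - u) * (p * \<psi> q - q * \<psi> p) = 0" using eq by simp
  hence "\<kappa> (v - u) * ((p * \<psi> q - q * \<psi> p) * d) = 0" by (metis mult.assoc mult_zero_left)
  thus False using assms(1-3) by (simp add: casoratian \<kappa>_eq_0_iff K_diff)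
qed

end

section \<open>Symmetries of the Riccati equation\<close>

context difference_field
begin

definition riccati :: "'k \<Rightarrow> 'k \<Rightarrow> 'k set" where
  "riccati a b = {u \<in> K. (\<phi> u + a) * u = - b}"

text \<open>A quotient of two solutions of \<phi> x = r x is fixed by \<phi>, hence complex: the
  solutions in \<open>K\<close> form at most a line.\<close>

lemma constant_ratio:
  assumes "x \<in> K" "y \<in> K" "r \<noteq> 0" "\<phi> x = r * x" "\<phi> y = r * y"
  obtains c where "x = j c * y" | "y = 0"
proof (cases "y = 0")
  case False
  have "\<phi> (x / y) = x / y" using assms by (simp add: \<phi>_divide)
  then obtain c where "x / y = j c" using constants K_divide assms by blast
  hence "x = j c * y" using False by (simp add: field_simps)
  thus ?thesis by (rule that)
qed (rule that)

end


text \<open>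
  In the coordinate \<open>x = 1 / (u - u\<^sub>1)\<close> attached to one solution \<open>u\<^sub>1\<close>, the Riccati equation becomes
  an affine equation with nonzero constant term. Hence three solutions make the solution set
  a projective line over the complex numbers.
\<close>

locale riccati_chart = difference_field K \<phi> j
  for K :: "'k::field set" and \<phi> :: "'k \<Rightarrow> 'k" and j :: "complex \<Rightarrow> 'k" +
  fixes a b u1 :: 'k
  assumes b_K: "b \<in> K" and b_nz: "b \<noteq> 0" and u1: "u1 \<in> riccati a b"
begin

lemma riccati_nz: "u \<in> riccati a b \<Longrightarrow> u \<noteq> 0"
  using b_nz by (auto simp: riccati_def)

lemma riccati_iff: "u \<noteq> 0 \<Longrightarrow> u \<in> riccati a b \<longleftrightarrow> u \<in> K \<and> \<phi> u = - a - b / u"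
proof -
  assume "u \<noteq> 0"
  have "(\<phi> u + a) * u = - b \<longleftrightarrow> \<phi> u + a = - b / u"
    by (simp only: nonzero_eq_divide_eq[OF \<open>u \<noteq> 0\<close>])
  also have "X + a = - Y \<longleftrightarrow> X = - a - Y" for X Y
    by (simp only: eq_diff_eq eq_neg_iff_add_eq_0 add.assoc add.commute[of Y a])
  from this[of "\<phi> u" "b / u"] have "\<phi> u + a = - b / u \<longleftrightarrow> \<phi> u = - a - b / u" by simp
  finally show ?thesis by (auto simp: riccati_def)
qed

lemma u1': "u1 \<in> K" "u1 \<noteq> 0" "\<phi> u1 = - a - b / u1"
  using u1 riccati_nz[OF u1] riccati_iff by (auto simp: riccati_def)

lemma chart:
  assumes "x \<noteq> 0"
  shows "u1 + 1 / x \<in> riccati a b \<longleftrightarrow> x \<in> K \<and> \<phi> x = u1\<^sup>2 / b * x + u1 / b"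
proof -
  have K: "u1 + 1 / x \<in> K \<longleftrightarrow> x \<in> K"
  proof
    assume "u1 + 1 / x \<in> K"
    hence "1 / (u1 + 1 / x - u1) \<in> K" by (intro K_divide K_diff K_one u1'(1))
    thus "x \<in> K" by simp
  qed (auto intro!: K_add K_divide u1')
  have rhs: "u1\<^sup>2 / b * x + u1 / b = u1 * (u1 * x + 1) / b"
    by (simp add: power2_eq_square algebra_simps add_divide_distrib)
  show ?thesis
  proof (cases "u1 * x + 1 = 0")
    \<comment> \<open>This is the value 0 of the unknown, which is never a solution; on the affine
      side it would force \<open>\<phi> x = 0\<close>.\<close>
    case True
    hence "u1 + 1 / x = 0" using assms by (simp add: field_simps)
    hence "u1 + 1 / x \<notin> riccati a b" using riccati_nz by metis
    moreover have "\<phi> x \<noteq> 0" using assms by simp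
    ultimately show ?thesis unfolding rhs using True by simp
  next
    case False
    define w where "w = u1 * x + 1"
    have w: "w \<noteq> 0" using False by (simp add: w_def)
    have u: "u1 + 1 / x = w / x" using assms by (simp add: w_def add_divide_distrib)
    have nz: "u1 + 1 / x \<noteq> 0" unfolding u using assms w by simp
    have "(- a - b / u1 + X = - a - Y) \<longleftrightarrow> X = b / u1 - Y" for X Y by (auto simp: algebra_simps)
    hence "\<phi> (u1 + 1 / x) = - a - b / (u1 + 1 / x) \<longleftrightarrow> 1 / \<phi> x = b / u1 - b / (u1 + 1 / x)"
      by (simp only: \<phi>_add \<phi>_divide \<phi>_one u1'(3))
    also have "b / u1 - b / (u1 + 1 / x) = (b * w - b * (u1 * x)) / (u1 * w)"
      unfolding u using assms w u1'(2) by (simp add: field_simps)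
    also have "b * w - b * (u1 * x) = b" by (simp add: w_def algebra_simps)
    also have "1 / X = b / Y \<longleftrightarrow> X = Y / b" if "X \<noteq> 0" "Y \<noteq> 0" for X Y
      using that b_nz by (auto simp: field_simps)
    hence "1 / \<phi> x = b / (u1 * w) \<longleftrightarrow> \<phi> x = u1 * (u1 * x + 1) / b"
      using assms w u1'(2) by (simp add: w_def)
    finally show ?thesis unfolding rhs using K riccati_iff[OF nz] by simp
  qed
qed

lemma chart':
  assumes "u \<in> riccati a b" "u \<noteq> u1"
  defines "x \<equiv> 1 / (u - u1)"
  shows "x \<noteq> 0" "x \<in> K" "\<phi> x = u1\<^sup>2 / b * x + u1 / b" "u = u1 + 1 / x"
proof -
  show x: "x \<noteq> 0" and u: "u = u1 + 1 / x" using assms(2) by (auto simp: x_def)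
  show "x \<in> K" "\<phi> x = u1\<^sup>2 / b * x + u1 / b" using chart[OF x] assms(1) u by auto
qed

text \<open>The constant term \<open>u1 / b\<close> is not 0, so no element of the line is 0 and
  each one gives a solution.\<close>

lemma chart_line:
  assumes "x \<in> K" "\<phi> x = u1\<^sup>2 / b * x + u1 / b" "d \<in> K" "\<phi> d = u1\<^sup>2 / b * d"
  shows "x + j c * d \<noteq> 0" "u1 + 1 / (x + j c * d) \<in> riccati a b"
proof -
  have K: "x + j c * d \<in> K" by (intro K_closed assms)
  have eq: "\<phi> (x + j c * d) = u1\<^sup>2 / b * (x + j c * d) + u1 / b"
    by (simp add: \<phi>_add \<phi>_mult \<phi>_j assms distrib_left mult.left_commute)
  show nz: "x + j c * d \<noteq> 0"
  proof
    assume "x + j c * d = 0"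
    thus False using eq u1'(2) b_nz by simp
  qed
  show "u1 + 1 / (x + j c * d) \<in> riccati a b" using chart[OF nz] K eq by blast
qed

lemma ratio_nz: "u1\<^sup>2 / b \<noteq> 0"
  using u1'(2) b_nz by simp

lemma chart_difference:
  assumes "\<phi> x = u1\<^sup>2 / b * x + u1 / b" "\<phi> y = u1\<^sup>2 / b * y + u1 / b"
  shows "\<phi> (x - y) = u1\<^sup>2 / b * (x - y)"
  using assms by (simp add: \<phi>_diff right_diff_distrib)

end


text \<open>An abstract translation by a lattice vector: it fixes \<open>a\<close> and
  \<open>b\<close> and therefore acts on the solutions.\<close>

locale riccati_symmetry = difference_field K \<phi> j
  for K :: "'k::field set" and \<phi> :: "'k \<Rightarrow> 'k" and j :: "complex \<Rightarrow> 'k" +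
  fixes A :: "'k \<Rightarrow> 'k" and a b :: 'k
  assumes bK: "b \<in> K" and bnz: "b \<noteq> 0"
    and A_K: "x \<in> K \<Longrightarrow> A x \<in> K"
    and A_add: "A (x + y) = A x + A y" and A_mult: "A (x * y) = A x * A y" and A_one: "A 1 = 1"
    and A_\<phi>: "A (\<phi> x) = \<phi> (A x)" and A_j: "A (j c) = j c" and A_a: "A a = a" and A_b: "A b = b"
begin

lemma A_zero [simp]: "A 0 = 0"
  using A_j[of 0] by simp

lemma A_uminus: "A (- x) = - A x"
  using A_add[of "-x" x] by (simp add: eq_neg_iff_add_eq_0)

lemma A_diff: "A (x - y) = A x - A y"
  using A_add[of x "-y"] by (simp add: A_uminus)

lemma A_eq_0_iff [simp]: "A x = 0 \<longleftrightarrow> x = 0"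
  by (metis A_mult A_one A_zero mult_zero_left right_inverse zero_neq_one)

lemma A_eq_iff [simp]: "A x = A y \<longleftrightarrow> x = y"
  using A_eq_0_iff[of "x - y"] by (simp add: A_diff)

lemma A_inverse: "A (inverse x) = inverse (A x)"
  by (metis A_eq_0_iff A_mult A_one inverse_unique inverse_zero right_inverse)

lemma A_divide: "A (x / y) = A x / A y"
  by (simp add: divide_inverse A_mult A_inverse)

lemma A_riccati: "u \<in> riccati a b \<Longrightarrow> A u \<in> riccati a b"
proof -
  assume u: "u \<in> riccati a b"
  hence "A ((\<phi> u + a) * u) = A (- b)" by (simp add: riccati_def)
  thus ?thesis using u by (simp add: riccati_def A_K A_mult A_add A_uminus A_\<phi> A_a A_b)
qed

lemma chart_at: "u1 \<in> riccati a b \<Longrightarrow> riccati_chart K \<phi> j a b u1"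
  by unfold_locales (use bK bnz in auto)

text \<open>
  In the chart at a moved solution \<open>u\<^sub>1\<close>, with origin at \<open>A u\<^sub>1\<close>, fixed solutions correspond
  to the complex roots of a quadratic equation.
\<close>

lemma ex_fixed_solution:
  assumes "{u1, u2, u3} \<subseteq> riccati a b" "distinct [u1, u2, u3]"
  shows "\<exists>u \<in> riccati a b. A u = u"
proof (cases "A u1 = u1")
  case False
  have S: "u1 \<in> riccati a b" using assms by auto
  interpret riccati_chart K \<phi> j a b u1 by (rule chart_at[OF S])
  obtain v where v: "v \<in> riccati a b" "v \<noteq> u1" "v \<noteq> A u1" using assms by auto
  define x y where "x = 1 / (A u1 - u1)" and "y = 1 / (v - u1)"
  note x = chart'[OF A_riccati[OF S] False, folded x_def]
  note y = chart'[OF v(1,2), folded y_def]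
  define d where "d = y - x"
  have d: "d \<in> K" "d \<noteq> 0" "\<phi> d = u1\<^sup>2 / b * d"
    unfolding d_def using x y v(3) chart_difference[OF y(3) x(3)] by (auto intro: K_diff)
  define r where "r = (A u1)\<^sup>2 / b"
  have Ad: "\<phi> (A d) = r * A d"
    unfolding r_def A_\<phi>[symmetric] d(3) by (simp add: A_mult A_divide A_b power2_eq_square)
  have r: "r \<noteq> 0" using riccati_nz[OF A_riccati[OF S]] bnz by (simp add: r_def)
  \<comment> \<open>Since \<open>A u1 = u1 + 1 / x\<close>, the constant term of the affine equation
    for \<open>x\<close> can be absorbed.\<close>
  have \<phi>x: "\<phi> x = u1 * A u1 / b * x"
  proof -
    have "(u1 + 1 / x) * x = u1 * x + 1" using x(1) by (simp add: distrib_right)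
    hence "u1 * (u1 + 1 / x) / b * x = u1 * (u1 * x + 1) / b" by (metis mult.assoc times_divide_eq_left)
    also have "\<dots> = u1\<^sup>2 / b * x + u1 / b"
      by (simp add: power2_eq_square algebra_simps add_divide_distrib)
    finally have "u1\<^sup>2 / b * x + u1 / b = u1 * (u1 + 1 / x) / b * x" by simp
    thus ?thesis using x(3,4) by simp
  qed
  \<comment> \<open>With y' = x + z d, the solution u1 + 1/y' is fixed if 1/x + 1/(A y') = 1/y'.
    Cleared of denominators, this is a quadratic equation in z with coefficients d A(d), d (A(x) +
    x) and x^2; their ratios turn out to be the constants 1, \<open>P\<close> and
    \<open>Q\<close>.\<close>
  have "\<phi> (A x + x) = r * (A x + x)"
  proof -
    have *: "x * (A u1 - u1) = 1" using False by (simp add: x_def)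
    have \<phi>Ax: "\<phi> (A x) = r * A x + A u1 / b"
      unfolding A_\<phi>[symmetric] x(3) by (simp only: A_add A_mult A_divide A_b power2_eq_square r_def)
    have "\<phi> (A x + x) = r * A x + A u1 / b + u1 * A u1 / b * x"
      by (simp only: \<phi>_add \<phi>Ax \<phi>x)
    also have "A u1 / b = (x * (A u1 - u1)) * A u1 / b" by (simp add: *)
    also have "r * A x + (x * (A u1 - u1)) * A u1 / b + u1 * A u1 / b * x = r * (A x + x)"
      by (simp add: r_def power2_eq_square algebra_simps add_divide_distrib diff_divide_distrib)
    finally show ?thesis .
  qed
  then obtain P where P: "A x + x = j P * A d"
    using constant_ratio[of "A x + x" "A d" r] x d Ad r by (auto intro: K_add A_K)
  have "\<phi> (x\<^sup>2) = u1\<^sup>2 / b * r * x\<^sup>2"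
    by (simp add: power2_eq_square \<phi>_mult \<phi>x r_def)
  moreover have "\<phi> (d * A d) = u1\<^sup>2 / b * r * (d * A d)" by (simp add: \<phi>_mult d Ad)
  ultimately obtain Q where Q: "x\<^sup>2 = j Q * (d * A d)"
    using constant_ratio[of "x\<^sup>2" "d * A d" "u1\<^sup>2 / b * r"] x d r ratio_nz
    by (auto simp: power2_eq_square intro: K_mult A_K)
  obtain z where "z\<^sup>2 + P * z + Q = 0"
  proof -
    have "\<not> constant (poly [:Q, P, 1:])" by (simp add: constant_degree)
    then obtain z where "poly [:Q, P, 1:] z = 0" using fundamental_theorem_of_algebra by metis
    hence "z\<^sup>2 + P * z + Q = 0" by (simp add: algebra_simps power2_eq_square)
    thus ?thesis by (rule that)
  qed
  hence "j (z\<^sup>2 + P * z + Q) = 0" by simp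
  hence "j z * j z + j P * j z + j Q = 0" by (simp only: j_add j_mult power2_eq_square)
  moreover have "(j z * d) * (j z * A d) + (j z * d) * (A x + x) + x\<^sup>2 =
      (j z * j z + j P * j z + j Q) * (d * A d)"
    unfolding P Q by (simp add: algebra_simps)
  ultimately have quad: "(j z * d) * (j z * A d) + (j z * d) * (A x + x) + x * x = 0"
    by (simp add: power2_eq_square)
  define y' where "y' = x + j z * d"
  have y': "y' \<noteq> 0" "u1 + 1 / y' \<in> riccati a b"
    unfolding y'_def using chart_line[OF x(2,3) d(1,3)] by auto
  have Ay': "A y' = A x + j z * A d" by (simp add: y'_def A_add A_mult A_j)
  have "y' * A y' + y' * x = x * A y'"
    unfolding Ay' unfolding y'_def using quad by (simp add: algebra_simps)
  hence "1 / x + 1 / A y' = 1 / y'"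
    using x(1) y'(1) by (simp add: field_simps)
  moreover have "A (u1 + 1 / y') = A u1 + 1 / A y'" by (simp add: A_add A_divide A_one)
  ultimately have "A (u1 + 1 / y') = u1 + 1 / y'" using x(4) by (metis add.assoc)
  thus ?thesis using y'(2) by blast
qed (use assms in auto)

text \<open>With a fixed solution at infinity, the others are x + z d and the symmetry acts by z
  \<mapsto> e + l z. If l is not 1, this has a fixed point; if l = 1, it is a translation, which is
  trivial because it has finite order.\<close>

lemma ex_two_fixed_solutions:
  assumes "{u1, u2, u3} \<subseteq> riccati a b" "distinct [u1, u2, u3]"
    and order: "\<And>u. u \<in> riccati a b \<Longrightarrow> \<exists>n>0. (A ^^ n) u = u"
  shows "\<exists>u \<in> riccati a b. \<exists>v \<in> riccati a b. u \<noteq> v \<and> A u = u \<and> A v = v"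
proof -
  obtain u where u: "u \<in> riccati a b" "A u = u" using ex_fixed_solution[OF assms(1,2)] by blast
  interpret riccati_chart K \<phi> j a b u by (rule chart_at[OF u(1)])
  obtain v w where vw: "v \<in> riccati a b" "w \<in> riccati a b" "v \<noteq> u" "w \<noteq> u" "v \<noteq> w"
    using assms(1,2) by (metis distinct_length_2_or_more insert_subset)
  define x y where "x = 1 / (v - u)" and "y = 1 / (w - u)"
  note x = chart'[OF vw(1,3), folded x_def]
  note y = chart'[OF vw(2,4), folded y_def]
  define d where "d = y - x"
  have d: "d \<in> K" "d \<noteq> 0" "\<phi> d = u\<^sup>2 / b * d"
    unfolding d_def using x y vw(5) chart_difference[OF y(3) x(3)] by (auto intro: K_diff)
  have A_ratio: "A (u\<^sup>2 / b) = u\<^sup>2 / b" by (simp add: A_divide A_mult power2_eq_square u A_b)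
  have A_ub: "A (u / b) = u / b" by (simp add: A_divide u A_b)
  have "\<phi> (A d) = u\<^sup>2 / b * A d" unfolding A_\<phi>[symmetric] d(3) by (simp only: A_mult A_ratio)
  then obtain l where l: "A d = j l * d"
    using constant_ratio[of "A d" d "u\<^sup>2 / b"] d ratio_nz A_K by metis
  have "\<phi> (A x) = u\<^sup>2 / b * A x + u / b"
    unfolding A_\<phi>[symmetric] x(3) by (simp only: A_add A_mult[of "u\<^sup>2 / b"] A_ratio A_ub)
  from chart_difference[OF this x(3)] obtain e where "A x - x = j e * d"
    using constant_ratio[of "A x - x" d "u\<^sup>2 / b"] d ratio_nz x K_diff A_K by metis
  hence Ax: "A x = x + j e * d" by (simp add: algebra_simps)
  show ?thesis
  proof (cases "l = 1")
    case True
    obtain n where n: "n > 0" "(A ^^ n) v = v" using order vw(1) by blast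
    have "(A ^^ k) x = x + j (of_nat k * e) * d" for k
      by (induction k) (auto simp: Ax A_add A_mult A_j l True j_one j_add j_mult algebra_simps)
    moreover have "(A ^^ k) x = 1 / ((A ^^ k) v - u)" for k
      by (induction k) (auto simp: x_def A_divide A_diff A_one u)
    ultimately have "x = x + j (of_nat n * e) * d" using n(2) by (metis x_def)
    hence "e = 0" using d n(1) by simp
    hence "A (u + 1 / x) = u + 1 / x" by (simp add: A_add A_divide A_one u Ax)
    hence "A v = v" using x(4) by simp
    thus ?thesis using u vw by blast
  next
    case False
    define c where "c = e / (1 - l)"
    have c: "e + c * l = c" using False by (simp add: c_def field_simps)
    define x' where "x' = x + j c * d"
    have x': "x' \<noteq> 0" "u + 1 / x' \<in> riccati a b"
      unfolding x'_def using chart_line[OF x(2,3) d(1,3)] by auto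
    have "A x' = x + j (e + c * l) * d"
      by (simp add: x'_def A_add A_mult A_j Ax l j_add j_mult algebra_simps)
    hence "A x' = x'" by (simp add: c x'_def)
    hence "A (u + 1 / x') = u + 1 / x'" by (simp add: A_add A_divide A_one u)
    moreover have "u + 1 / x' \<noteq> u" using x'(1) by simp
    ultimately show ?thesis using u x'(2) by metis
  qed
qed

text \<open>A homography with three fixed points is the identity: with one of them at infinity and
  the other two as affine frame, the coordinate of \<open>u\<close> is a complex number, which
  \<open>A\<close> preserves.\<close>

lemma three_fixed_solutions:
  assumes S: "u1 \<in> riccati a b" "u2 \<in> riccati a b" "u3 \<in> riccati a b" "distinct [u1, u2, u3]"
    and A: "A u1 = u1" "A u2 = u2" "A u3 = u3" and u: "u \<in> riccati a b"
  shows "A u = u"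
proof (cases "u = u1")
  case False
  interpret riccati_chart K \<phi> j a b u1 by (rule chart_at[OF S(1)])
  have "u2 \<noteq> u1" "u3 \<noteq> u1" "u2 \<noteq> u3" using S by auto
  define x y z where "x = 1 / (u2 - u1)" and "y = 1 / (u3 - u1)" and "z = 1 / (u - u1)"
  note x = chart'[OF S(2) \<open>u2 \<noteq> u1\<close>, folded x_def]
  note y = chart'[OF S(3) \<open>u3 \<noteq> u1\<close>, folded y_def]
  note z = chart'[OF u False, folded z_def]
  have "y - x \<noteq> 0" using x(4) y(4) \<open>u2 \<noteq> u3\<close> by auto
  then obtain c where "z - x = j c * (y - x)"
    using constant_ratio[of "z - x" "y - x" "u1\<^sup>2 / b"] ratio_nz
      chart_difference[OF z(3) x(3)] chart_difference[OF y(3) x(3)] x y z K_diff by metis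
  hence zc: "z = x + j c * (y - x)" by (simp add: algebra_simps)
  have "A x = x" "A y = y" by (simp_all add: x_def y_def A_divide A_diff A_one A)
  hence "A z = z" by (simp add: zc A_add A_mult A_diff A_j)
  hence "A (u1 + 1 / z) = u1 + 1 / z" by (simp add: A_add A_divide A_one A)
  thus ?thesis using z(4) by simp
qed (use A in simp)

lemma permutes_pair:
  assumes "u \<noteq> v" "A u \<in> {u, v}" "A v \<in> {u, v}"
  shows "A (A u) = u" "A (A v) = v"
  using assms A_eq_iff[of u v] by auto

end


locale riccati_symmetries =
  A: riccati_symmetry K \<phi> j A a b + B: riccati_symmetry K \<phi> j B a b
  for K :: "'k::field set" and \<phi> :: "'k \<Rightarrow> 'k" and j :: "complex \<Rightarrow> 'k"
    and A B :: "'k \<Rightarrow> 'k" and a b :: 'k +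
  assumes commute: "A (B x) = B (A x)"
    and orderA: "u \<in> A.riccati a b \<Longrightarrow> \<exists>n>0. (A ^^ n) u = u"
    and orderB: "u \<in> A.riccati a b \<Longrightarrow> \<exists>n>0. (B ^^ n) u = u"
begin

lemma ex_two_invariant_solutions:
  assumes u: "u \<in> A.riccati a b" and v: "v \<in> A.riccati a b" and "u \<noteq> v"
  shows "\<exists>u\<in>A.riccati a b. \<exists>v\<in>A.riccati a b. u \<noteq> v \<and>
     A (A u) = u \<and> A (A v) = v \<and> B (B u) = u \<and> B (B v) = v"
proof (cases "A.riccati a b \<subseteq> {u, v}")
  case True
  hence "A u \<in> {u, v}" "A v \<in> {u, v}" "B u \<in> {u, v}" "B v \<in> {u, v}"
    using A.A_riccati[OF u] A.A_riccati[OF v] B.A_riccati[OF u] B.A_riccati[OF v] by auto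
  hence "A (A u) = u \<and> A (A v) = v \<and> B (B u) = u \<and> B (B v) = v"
    using A.permutes_pair[OF \<open>u \<noteq> v\<close>] B.permutes_pair[OF \<open>u \<noteq> v\<close>] by simp
  thus ?thesis using u v \<open>u \<noteq> v\<close> by blast
next
  case False
  then obtain w where w: "w \<in> A.riccati a b" "w \<noteq> u" "w \<noteq> v" by blast
  hence three: "{u, v, w} \<subseteq> A.riccati a b" "distinct [u, v, w]" using u v \<open>u \<noteq> v\<close> by auto
  obtain f g where fg: "f \<in> A.riccati a b" "g \<in> A.riccati a b" "f \<noteq> g" "A f = f" "A g = g"
    using A.ex_two_fixed_solutions[OF three orderA] by blast
  show ?thesis
  proof (cases "\<exists>h\<in>A.riccati a b. h \<noteq> f \<and> h \<noteq> g \<and> A h = h")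
    \<comment> \<open>A third fixed solution makes \<open>A\<close> the identity on all solutions,
      so two solutions fixed by \<open>B\<close> will do.\<close>
    case True
    hence "\<forall>u\<in>A.riccati a b. A u = u" using A.three_fixed_solutions[OF fg(1,2)] fg by auto
    moreover obtain f' g' where "f' \<in> A.riccati a b" "g' \<in> A.riccati a b" "f' \<noteq> g'"
        "B f' = f'" "B g' = g'"
      using B.ex_two_fixed_solutions[OF three orderB] by blast
    ultimately show ?thesis by (intro bexI[of _ f'] bexI[of _ g']) auto
  next
    case False
    have "B f \<in> {f, g}" "B g \<in> {f, g}"
      using False B.A_riccati[OF fg(1)] B.A_riccati[OF fg(2)] commute[of f] commute[of g] fg by auto
    hence "B (B f) = f" "B (B g) = g" using B.permutes_pair[OF fg(3)] by simp_all
    thus ?thesis using fg by (intro bexI[of _ f] bexI[of _ g]) auto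
  qed
qed

end

section \<open>The base field\<close>

lemma eventually_at_shift:
  fixes z h :: complex
  assumes "eventually P (at (z + h))"
  shows "eventually (\<lambda>w. P (w + h)) (at z)"
proof -
  have "filtermap (\<lambda>w. w + h) (at z) = at (z + h)"
    using filtermap_at_shift[of "-h" z] by simp
  thus ?thesis using assms by (metis eventually_filtermap)
qed

lemma mero_fun_shift: "mero_fun (shift h f) z = mero_fun f (z + h)"
  by (simp add: shift.rep_eq)

lemma shift_add: "shift h (f + g) = shift h f + shift h g"
proof (rule mero_eqI)
  fix z
  show "eventually (\<lambda>w. mero_fun (shift h (f + g)) w = mero_fun (shift h f + shift h g) w) (at z)"
    using eventually_at_shift[OF mero_fun_add[of f g "z + h"]] mero_fun_add[of "shift h f" "shift h g" z]
    by eventually_elim (simp add: mero_fun_shift)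
qed

lemma shift_mult: "shift h (f * g) = shift h f * shift h g"
proof (rule mero_eqI)
  fix z
  show "eventually (\<lambda>w. mero_fun (shift h (f * g)) w = mero_fun (shift h f * shift h g) w) (at z)"
    using eventually_at_shift[OF mero_fun_mult[of f g "z + h"]] mero_fun_mult[of "shift h f" "shift h g" z]
    by eventually_elim (simp add: mero_fun_shift)
qed

lemma mero_fun_eqI: "(\<And>z. mero_fun f z = mero_fun g z) \<Longrightarrow> f = g"
  by (simp add: mero_fun_inject[symmetric] fun_eq_iff)

lemma shift_const: "shift h (mero_const c) = mero_const c"
  by (rule mero_fun_eqI) (simp add: mero_fun_shift mero_const.rep_eq)

lemma mero_const_1: "mero_const 1 = 1"
  by (rule mero_fun_eqI) (simp add: one_mero.rep_eq mero_const.rep_eq)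

lemma shift_one: "shift h 1 = 1"
  using shift_const[of h 1] by (simp add: mero_const_1)

lemma shift_shift: "shift v (shift w f) = shift (v + w) f"
  by (rule mero_fun_eqI) (simp add: mero_fun_shift add.assoc)

lemma shift_0: "shift 0 f = f"
  by (rule mero_fun_eqI) (simp add: mero_fun_shift)

lemma shift_commute: "shift v (shift w f) = shift w (shift v f)"
  by (simp add: shift_shift add.commute)

lemma shift_funpow: "(shift w ^^ n) f = shift (of_nat n * w) f"
  by (induction n) (auto simp: shift_0 shift_shift algebra_simps)

lemma mero_const_add: "mero_const (c + d) = mero_const c + mero_const d"
proof (rule mero_eqI)
  fix z
  show "eventually (\<lambda>w. mero_fun (mero_const (c + d)) w = mero_fun (mero_const c + mero_const d) w) (at z)"
    using mero_fun_add[of "mero_const c" "mero_const d" z]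
    by eventually_elim (simp add: mero_const.rep_eq)
qed

lemma mero_const_mult: "mero_const (c * d) = mero_const c * mero_const d"
proof (rule mero_eqI)
  fix z
  show "eventually (\<lambda>w. mero_fun (mero_const (c * d)) w = mero_fun (mero_const c * mero_const d) w) (at z)"
    using mero_fun_mult[of "mero_const c" "mero_const d" z]
    by eventually_elim (simp add: mero_const.rep_eq)
qed

lemma periodic_mero_iff: "f \<in> periodic_mero L \<longleftrightarrow> (\<forall>w\<in>L. shift w f = f)"
  unfolding periodic_mero_def
  by (auto simp: mero_fun_inject[symmetric] mero_fun_shift fun_eq_iff)

lemma shift_inverse: "shift h (inverse f) = inverse (shift h f)"
  by (rule mero_fun_eqI) (simp add: mero_fun_shift inverse_mero.rep_eq)

lemma periodic_mero_add: "f \<in> periodic_mero L \<Longrightarrow> g \<in> periodic_mero L \<Longrightarrow> f + g \<in> periodic_mero L"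
  and periodic_mero_mult: "f \<in> periodic_mero L \<Longrightarrow> g \<in> periodic_mero L \<Longrightarrow> f * g \<in> periodic_mero L"
  and periodic_mero_inverse: "f \<in> periodic_mero L \<Longrightarrow> inverse f \<in> periodic_mero L"
  by (auto simp: periodic_mero_iff shift_add shift_mult shift_inverse)

lemma periodic_mero_shift: "f \<in> periodic_mero L \<Longrightarrow> shift h f \<in> periodic_mero L"
  by (auto simp: periodic_mero_iff shift_commute[of _ h])

lemma lattice_mult_of_nat: "w \<in> lattice \<tau> \<Longrightarrow> of_nat n * w \<in> lattice \<tau>"
proof -
  assume "w \<in> lattice \<tau>"
  then obtain k l :: int where "w = of_int k + of_int l * \<tau>" by (auto simp: lattice_def)
  hence "of_nat n * w = of_int (int n * k) + of_int (int n * l) * \<tau>"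
    by (simp add: algebra_simps)
  thus ?thesis unfolding lattice_def by blast
qed

lemma periodic_mero_scaled:
  assumes "f \<in> periodic_mero (scaled k (lattice \<tau>))"
  shows "f \<in> periodic_mero (scaled (k * l) (lattice \<tau>))"
proof -
  have "scaled (k * l) (lattice \<tau>) \<subseteq> scaled k (lattice \<tau>)"
    using lattice_mult_of_nat by (auto simp: scaled_def mult.assoc)
  thus ?thesis using assms by (auto simp: periodic_mero_def)
qed

lemma base_field_common_period:
  assumes "f \<in> base_field (lattice \<tau>)" "g \<in> base_field (lattice \<tau>)"
  obtains k where "k \<ge> 1" "f \<in> periodic_mero (scaled k (lattice \<tau>))"
    "g \<in> periodic_mero (scaled k (lattice \<tau>))"
proof -
  from assms obtain k l where "k \<ge> 1" "f \<in> periodic_mero (scaled k (lattice \<tau>))"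
    "l \<ge> 1" "g \<in> periodic_mero (scaled l (lattice \<tau>))"
    by (auto simp: base_field_def)
  thus ?thesis using that[of "k * l"] periodic_mero_scaled[of f k \<tau> l] periodic_mero_scaled[of g l \<tau> k]
    by (simp add: mult.commute)
qed

lemma base_fieldI: "k \<ge> 1 \<Longrightarrow> f \<in> periodic_mero (scaled k L) \<Longrightarrow> f \<in> base_field L"
  by (auto simp: base_field_def)

lemma bounded_parallelogram:
  "bounded ((\<lambda>(x, y). of_real x + of_real y * \<tau>) ` ({0..r} \<times> {0..r}))" for r :: real and \<tau> :: complex
  by (intro compact_imp_bounded compact_continuous_image)
     (auto intro!: continuous_intros compact_Times simp: case_prod_unfold)

text \<open>
  Reducing the multiples of \<open>h\<close> modulo \<open>k \<Lambda>\<close> gives infinitely many periods in a bounded set, so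
  the periods accumulate.
\<close>

lemma shift_invariant_constant:
  assumes \<tau>: "Im \<tau> > 0" and h: "\<forall>n::nat. n \<ge> 1 \<longrightarrow> of_nat n * h \<notin> lattice \<tau>"
    and f: "f \<in> base_field (lattice \<tau>)" "shift h f = f"
  shows "f \<in> range mero_const"
proof -
  obtain k where k: "k \<ge> 1" "f \<in> periodic_mero (scaled k (lattice \<tau>))"
    using f(1) by (auto simp: base_field_def)
  \<comment> \<open>The real coordinates of the multiples of \<open>h\<close> in the basis 1,
    \<open>\<tau>\<close>; floors after division by \<open>k\<close> select the period to
    subtract.\<close>
  define y x :: "nat \<Rightarrow> real" where "y = (\<lambda>n. Im (of_nat n * h) / Im \<tau>)"
    and "x = (\<lambda>n. Re (of_nat n * h) - y n * Re \<tau>)"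
  have nh: "of_nat n * h = of_real (x n) + of_real (y n) * \<tau>" for n
    using \<tau> by (simp add: complex_eq_iff x_def y_def)
  define c e :: "nat \<Rightarrow> int" where "c = (\<lambda>n. \<lfloor>x n / k\<rfloor>)" and "e = (\<lambda>n. \<lfloor>y n / k\<rfloor>)"
  define w where "w = (\<lambda>n. of_int (c n) + of_int (e n) * \<tau>)"
  have w: "w n \<in> lattice \<tau>" for n by (auto simp: w_def lattice_def)
  define p where "p = (\<lambda>n. of_nat n * h - of_nat k * w n)"
  have "p n \<in> (\<lambda>(x, y). of_real x + of_real y * \<tau>) ` ({0..real k} \<times> {0..real k})" for n
  proof -
    have bd: "0 \<le> t - real k * of_int \<lfloor>t / k\<rfloor> \<and> t - real k * of_int \<lfloor>t / k\<rfloor> \<le> k" for t :: real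
    proof -
      define F where "F = \<lfloor>t / k\<rfloor>"
      have "of_int F \<le> t / k" "t / k \<le> of_int F + 1" unfolding F_def by linarith+
      thus ?thesis using k(1) unfolding F_def[symmetric] by (simp add: field_simps)
    qed
    have "p n = of_real (x n - k * c n) + of_real (y n - k * e n) * \<tau>"
      unfolding p_def nh by (simp add: w_def algebra_simps)
    thus ?thesis using bd[of "x n"] bd[of "y n"]
      by (auto simp: c_def e_def intro!: image_eqI[of _ _ "(x n - k * c n, y n - k * e n)"])
  qed
  hence "bounded (range p)" by (intro bounded_subset[OF bounded_parallelogram]) blast
  \<comment> \<open>Two equal reduced multiples would put a positive multiple of \<open>h\<close>
    into the lattice.\<close>
  have "inj p"
  proof (rule linorder_injI)
    fix n l :: nat assume "n < l"
    show "p n \<noteq> p l"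
    proof
      assume "p n = p l"
      hence "of_nat (l - n) * h = of_nat k * w l - of_nat k * w n"
        using \<open>n < l\<close> by (simp add: p_def of_nat_diff algebra_simps)
      also have "\<dots> = of_int (int k * (c l - c n)) + of_int (int k * (e l - e n)) * \<tau>"
        by (simp add: w_def algebra_simps)
      also have "\<dots> \<in> lattice \<tau>" unfolding lattice_def by blast
      finally show False using h \<open>n < l\<close> by (metis Suc_leI One_nat_def zero_less_diff)
    qed
  qed
  hence "infinite (range p)" using finite_imageD infinite_UNIV_nat by blast
  with \<open>bounded (range p)\<close> obtain z where z: "z islimpt range p"
    using bounded_infinite_imp_islimpt[of "range p" "range p"] by blast
  have per: "mero_fun f (p n) = mero_fun f 0" for n
  proof -
    have "shift (of_nat k * w n) f = f"
      using k(2) w[of n] by (auto simp: periodic_mero_iff scaled_def)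
    moreover have "shift (of_nat n * h) f = f"
      unfolding shift_funpow[symmetric] by (induction n) (auto simp: f(2))
    ultimately have "mero_fun f (p n + of_nat k * w n) = mero_fun f (p n)"
      "mero_fun f (0 + of_nat n * h) = mero_fun f 0"
      by (metis mero_fun_shift)+
    thus ?thesis by (simp add: p_def)
  qed
  define g where "g = f + - mero_const (mero_fun f 0)"
  have "g = 0"
  proof (rule ccontr)
    assume "g \<noteq> 0"
    \<comment> \<open>The limit point may be a pole of \<open>f\<close>; the comparison takes place
      on a punctured neighbourhood.\<close>
    have "eventually (\<lambda>v. mero_fun f v \<noteq> mero_fun f 0) (at z)"
      using mero_fun_nonzero[OF \<open>g \<noteq> 0\<close>, of z] mero_fun_add[of f "- mero_const (mero_fun f 0)" z]
      by eventually_elim (auto simp: g_def uminus_mero.rep_eq mero_const.rep_eq)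
    hence "eventually (\<lambda>v. v \<notin> range p) (at z)"
      by eventually_elim (use per in auto)
    thus False using z by (simp add: islimpt_iff_eventually)
  qed
  hence "f = mero_const (mero_fun f 0)" by (simp add: g_def eq_neg_iff_add_eq_0 add_eq_0_iff2)
  thus ?thesis by blast
qed

lemma base_field_difference_field:
  assumes "Im \<tau> > 0" "\<forall>n::nat. n \<ge> 1 \<longrightarrow> of_nat n * h \<notin> lattice \<tau>"
  shows "difference_field (base_field (lattice \<tau>)) (shift h) mero_const"
proof
  fix f g assume fg: "f \<in> base_field (lattice \<tau>)" "g \<in> base_field (lattice \<tau>)"
  obtain k where k: "k \<ge> 1" "f \<in> periodic_mero (scaled k (lattice \<tau>))"
    "g \<in> periodic_mero (scaled k (lattice \<tau>))"
    by (rule base_field_common_period[OF fg])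
  show "f + g \<in> base_field (lattice \<tau>)" "f * g \<in> base_field (lattice \<tau>)"
    using k by (auto intro: base_fieldI periodic_mero_add periodic_mero_mult)
next
  fix f assume "f \<in> base_field (lattice \<tau>)"
  thus "inverse f \<in> base_field (lattice \<tau>)" "shift h f \<in> base_field (lattice \<tau>)"
    by (auto simp: base_field_def intro: periodic_mero_inverse periodic_mero_shift)
next
  show "mero_const c \<in> base_field (lattice \<tau>)" for c
    by (rule base_fieldI[of 1]) (auto simp: periodic_mero_iff shift_const)
next
  show "f \<in> range mero_const" if "f \<in> base_field (lattice \<tau>)" "shift h f = f" for f
    using shift_invariant_constant[OF assms that] .
qed (simp_all add: shift_add shift_mult shift_one mero_const_1 mero_const_add mero_const_mult shift_const)

lemma lattice_generators: "1 \<in> lattice \<tau>" "\<tau> \<in> lattice \<tau>"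
  unfolding lattice_def by (rule CollectI, rule exI[of _ 1], rule exI[of _ 0], simp)
    (rule CollectI, rule exI[of _ 0], rule exI[of _ 1], simp)

lemma shift_of_int:
  assumes "shift w f = f"
  shows "shift (of_int n * w) f = f"
proof -
  have nat: "shift (of_nat k * w) f = f" for k
    unfolding shift_funpow[symmetric] by (induction k) (auto simp: assms)
  show ?thesis
  proof (cases "n \<ge> 0")
    case True
    thus ?thesis using nat[of "nat n"] by simp
  next
    case False
    hence "shift (of_int n * w) (shift (of_nat (nat (- n)) * w) f) = f"
      by (simp add: shift_shift shift_0 algebra_simps)
    thus ?thesis by (simp add: nat)
  qed
qed

text \<open>The doubled lattice is generated by 2 and 2 \<tau>, the periods expressed by the squares
  of the two translations.\<close>

lemma periodic_mero_2I:
  assumes "shift 1 (shift 1 f) = f" "shift \<tau> (shift \<tau> f) = f"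
  shows "f \<in> periodic_mero (scaled 2 (lattice \<tau>))"
  unfolding periodic_mero_iff
proof
  fix v assume "v \<in> scaled 2 (lattice \<tau>)"
  then obtain m n :: int where v: "v = of_int m * (1 + 1) + of_int n * (\<tau> + \<tau>)"
    by (auto simp: scaled_def lattice_def algebra_simps)
  have "shift (of_int m * (1 + 1)) f = f" "shift (of_int n * (\<tau> + \<tau>)) f = f"
    using assms by (auto intro!: shift_of_int simp: shift_shift)
  thus "shift v f = f" unfolding v by (simp add: shift_shift[symmetric])
qed

lemma base_field_shift_order:
  assumes "f \<in> base_field (lattice \<tau>)" "w \<in> lattice \<tau>"
  shows "\<exists>n>0. (shift w ^^ n) f = f"
proof -
  obtain k where "k \<ge> 1" "f \<in> periodic_mero (scaled k (lattice \<tau>))"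
    using assms(1) by (auto simp: base_field_def)
  thus ?thesis using assms(2)
    by (intro exI[of _ k]) (auto simp: shift_funpow periodic_mero_iff scaled_def)
qed

section \<open>Reducibility\<close>

no_notation fps_nth (infixl \<open>$\<close> 75)

section \<open>Eigenvectors of matrix groups of degree two\<close>

lemma matrix_inv_mult:
  assumes "invertible P"
  shows "P ** matrix_inv P = mat 1" "matrix_inv P ** P = mat 1"
  using assms someI_ex[of "\<lambda>A'. P ** A' = mat 1 \<and> A' ** P = mat 1"]
  unfolding invertible_def matrix_inv_def by auto

lemma invertible_matrix_inv: "invertible P \<Longrightarrow> invertible (matrix_inv P)"
  using matrix_inv_mult unfolding invertible_def by blast

lemma matrix_mult_2:
  "(A ** B) $ i $ k = A $ i $ 1 * B $ 1 $ k + A $ i $ 2 * B $ 2 $ k"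
  for A B :: "'a::semiring_1^2^2"
  by (simp add: matrix_matrix_mult_def sum_2)

text \<open>Column \<open>k\<close> of the identity
  \<open>C ** matrix_inv P = matrix_inv P ** A\<close>, in which one off-diagonal entry of
  \<open>A\<close> drops out.\<close>

lemma right_eigenvector_of_conjugate:
  fixes A C P :: "'a::field^2^2"
  assumes P: "invertible P" and A: "A = P ** C ** matrix_inv P" "A $ l $ k = 0" "{k, l} = {1, 2}"
  shows "C $ i $ 1 * matrix_inv P $ 1 $ k + C $ i $ 2 * matrix_inv P $ 2 $ k =
    A $ k $ k * matrix_inv P $ i $ k"
proof -
  have "matrix_inv P ** A = (matrix_inv P ** P) ** C ** matrix_inv P"
    by (simp add: A(1) matrix_mul_assoc)
  hence "C ** matrix_inv P = matrix_inv P ** A" by (simp add: matrix_inv_mult[OF P])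
  hence "(C ** matrix_inv P) $ i $ k = (matrix_inv P ** A) $ i $ k" by simp
  moreover have "k = 1 \<and> l = 2 \<or> k = 2 \<and> l = 1"
    using A(3) exhaust_2 by (metis doubleton_eq_iff)
  ultimately show ?thesis using A(2) by (auto simp: matrix_mult_2 mult.commute)
qed

text \<open>If A is the conjugate, A P = P C is solved for A by Cramer's rule; each off-diagonal
  entry is a cross product that vanishes when the corresponding row of \<open>P\<close> is a left
  eigenvector.\<close>

lemma conjugate_entry_zero:
  fixes C P :: "complex^2^2"
  assumes nz: "r * l' \<noteq> r' * l" and P: "P = vector [vector [r, r'], vector [l, l']]"
  shows "invertible P"
    and "l' * (l * C $ 1 $ 1 + l' * C $ 2 $ 1) = l * (l * C $ 1 $ 2 + l' * C $ 2 $ 2) \<Longrightarrow>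
      (P ** C ** matrix_inv P) $ 2 $ 1 = 0"
    and "r' * (r * C $ 1 $ 1 + r' * C $ 2 $ 1) = r * (r * C $ 1 $ 2 + r' * C $ 2 $ 2) \<Longrightarrow>
      (P ** C ** matrix_inv P) $ 1 $ 2 = 0"
proof -
  show inv: "invertible P"
    using nz by (simp add: invertible_det_nz det_2 P)
  define A where "A = P ** C ** matrix_inv P"
  have "A ** P = P ** C ** (matrix_inv P ** P)" by (simp add: A_def matrix_mul_assoc)
  hence AP: "A ** P = P ** C" by (simp add: matrix_inv_mult[OF inv])
  have e: "A $ i $ 1 * r + A $ i $ 2 * l = (P ** C) $ i $ 1"
    "A $ i $ 1 * r' + A $ i $ 2 * l' = (P ** C) $ i $ 2" for i
    unfolding AP[symmetric] by (simp_all add: matrix_mult_2 P)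
  have "A $ i $ 1 * (r * l' - r' * l) = (P ** C) $ i $ 1 * l' - (P ** C) $ i $ 2 * l"
    "A $ i $ 2 * (r * l' - r' * l) = (P ** C) $ i $ 2 * r - (P ** C) $ i $ 1 * r'" for i
    unfolding e[symmetric] by (simp_all add: algebra_simps)
  from this(1)[of 2] this(2)[of 1] nz
  show "l' * (l * C $ 1 $ 1 + l' * C $ 2 $ 1) = l * (l * C $ 1 $ 2 + l' * C $ 2 $ 2) \<Longrightarrow>
      (P ** C ** matrix_inv P) $ 2 $ 1 = 0"
    "r' * (r * C $ 1 $ 1 + r' * C $ 2 $ 1) = r * (r * C $ 1 $ 2 + r' * C $ 2 $ 2) \<Longrightarrow>
      (P ** C ** matrix_inv P) $ 1 $ 2 = 0"
    unfolding A_def[symmetric] by (auto simp: matrix_mult_2 P mult.commute)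
qed

lemma reducible_right_eigenvector:
  fixes G :: "(complex^2^2) set"
  assumes "reducible G"
  obtains v v' where "v \<noteq> 0 \<or> v' \<noteq> 0"
    "\<And>C. C \<in> G \<Longrightarrow> \<exists>\<mu>. C $ 1 $ 1 * v + C $ 1 $ 2 * v' = \<mu> * v \<and> C $ 2 $ 1 * v + C $ 2 $ 2 * v' = \<mu> * v'"
proof -
  obtain P :: "complex^2^2" where P: "invertible P"
    "\<And>C. C \<in> G \<Longrightarrow> (P ** C ** matrix_inv P) $ 2 $ 1 = 0"
    using assms by (auto simp: reducible_def conjugate_into_def)
  have "(P ** matrix_inv P) $ 1 $ 1 = 1" by (simp add: matrix_inv_mult[OF P(1)] mat_def)
  hence "matrix_inv P $ 1 $ 1 \<noteq> 0 \<or> matrix_inv P $ 2 $ 1 \<noteq> 0" by (auto simp: matrix_mult_2)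
  thus ?thesis
  proof (rule that)
    fix C assume "C \<in> G"
    from right_eigenvector_of_conjugate[OF P(1) refl P(2)[OF this]]
    show "\<exists>\<mu>. C $ 1 $ 1 * matrix_inv P $ 1 $ 1 + C $ 1 $ 2 * matrix_inv P $ 2 $ 1 = \<mu> * matrix_inv P $ 1 $ 1 \<and>
      C $ 2 $ 1 * matrix_inv P $ 1 $ 1 + C $ 2 $ 2 * matrix_inv P $ 2 $ 1 = \<mu> * matrix_inv P $ 2 $ 1"
      by blast
  qed
qed

lemma completely_reducible_right_eigenvectors:
  fixes G :: "(complex^2^2) set"
  assumes "completely_reducible G"
  obtains v v' w w' where "v * w' \<noteq> v' * w"
    "\<And>C. C \<in> G \<Longrightarrow> \<exists>\<mu>. C $ 1 $ 1 * v + C $ 1 $ 2 * v' = \<mu> * v \<and> C $ 2 $ 1 * v + C $ 2 $ 2 * v' = \<mu> * v'"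
    "\<And>C. C \<in> G \<Longrightarrow> \<exists>\<mu>. C $ 1 $ 1 * w + C $ 1 $ 2 * w' = \<mu> * w \<and> C $ 2 $ 1 * w + C $ 2 $ 2 * w' = \<mu> * w'"
proof -
  obtain P :: "complex^2^2" where P: "invertible P"
    "\<And>C. C \<in> G \<Longrightarrow> (P ** C ** matrix_inv P) $ 2 $ 1 = 0"
    "\<And>C. C \<in> G \<Longrightarrow> (P ** C ** matrix_inv P) $ 1 $ 2 = 0"
    using assms by (auto simp: completely_reducible_def conjugate_into_def)
  let ?Q = "matrix_inv P"
  have "det ?Q \<noteq> 0" using invertible_matrix_inv[OF P(1)] by (simp add: invertible_det_nz)
  hence "?Q $ 1 $ 1 * ?Q $ 2 $ 2 \<noteq> ?Q $ 2 $ 1 * ?Q $ 1 $ 2" by (simp add: det_2 mult.commute)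
  thus ?thesis
  proof (rule that)
    fix C assume C: "C \<in> G"
    show "\<exists>\<mu>. C $ 1 $ 1 * ?Q $ 1 $ 1 + C $ 1 $ 2 * ?Q $ 2 $ 1 = \<mu> * ?Q $ 1 $ 1 \<and>
      C $ 2 $ 1 * ?Q $ 1 $ 1 + C $ 2 $ 2 * ?Q $ 2 $ 1 = \<mu> * ?Q $ 2 $ 1"
      using right_eigenvector_of_conjugate[OF P(1) refl P(2)[OF C]] by blast
    show "\<exists>\<mu>. C $ 1 $ 1 * ?Q $ 1 $ 2 + C $ 1 $ 2 * ?Q $ 2 $ 2 = \<mu> * ?Q $ 1 $ 2 \<and>
      C $ 2 $ 1 * ?Q $ 1 $ 2 + C $ 2 $ 2 * ?Q $ 2 $ 2 = \<mu> * ?Q $ 2 $ 2"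
      using right_eigenvector_of_conjugate[OF P(1) refl P(3)[OF C]] by blast
  qed
qed

lemma reducible_of_left_eigenvector:
  fixes G :: "(complex^2^2) set"
  assumes "\<And>C. C \<in> G \<Longrightarrow> invertible C" and nz: "l \<noteq> 0 \<or> l' \<noteq> 0"
    and l: "\<And>C. C \<in> G \<Longrightarrow> l' * (l * C $ 1 $ 1 + l' * C $ 2 $ 1) = l * (l * C $ 1 $ 2 + l' * C $ 2 $ 2)"
  shows "reducible G"
proof -
  \<comment> \<open>The left eigenvector becomes the second row of the conjugating matrix; any
    independent first row completes it.\<close>
  obtain r r' where r: "r * l' \<noteq> r' * l"
  proof (cases "l' = 0")
    case True
    thus ?thesis using that[of 0 1] nz by simp
  next
    case False
    thus ?thesis using that[of 1 0] by simp
  qed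
  note P = conjugate_entry_zero[OF r refl]
  show ?thesis
    unfolding reducible_def conjugate_into_def
    using assms(1) P(1) P(2)[OF l] invertible_matrix_inv[OF P(1)]
    by (intro exI[of _ "vector [vector [r, r'], vector [l, l']]"]) (auto intro!: invertible_mult)
qed

lemma completely_reducible_of_left_eigenvectors:
  fixes G :: "(complex^2^2) set"
  assumes "\<And>C. C \<in> G \<Longrightarrow> invertible C" and nz: "r * l' \<noteq> r' * l"
    and r: "\<And>C. C \<in> G \<Longrightarrow> r' * (r * C $ 1 $ 1 + r' * C $ 2 $ 1) = r * (r * C $ 1 $ 2 + r' * C $ 2 $ 2)"
    and l: "\<And>C. C \<in> G \<Longrightarrow> l' * (l * C $ 1 $ 1 + l' * C $ 2 $ 1) = l * (l * C $ 1 $ 2 + l' * C $ 2 $ 2)"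
  shows "completely_reducible G"
proof -
  note P = conjugate_entry_zero[OF nz refl]
  show ?thesis
    unfolding completely_reducible_def conjugate_into_def
    using assms(1) P(1) P(2)[OF l] P(3)[OF r] invertible_matrix_inv[OF P(1)]
    by (intro exI[of _ "vector [vector [r, r'], vector [l, l']]"]) (auto intro!: invertible_mult)
qed

section \<open>The Galois group of a second-order equation\<close>

lemma picard_vessiot_second_order:
  assumes df: "difference_field K \<phi> j" and ab: "a \<in> K" "b \<in> K" "b \<noteq> 0"
    and pv: "picard_vessiot K \<phi> (companion_matrix a b) \<iota> \<Phi> (U :: 'r::comm_ring_1^2^2)"
  obtains d where "second_order_pv K \<phi> j \<iota> \<Phi> a b (U $ 1 $ 1) (U $ 1 $ 2) d"
    "\<Phi> (U $ 1 $ 1) = U $ 2 $ 1" "\<Phi> (U $ 1 $ 2) = U $ 2 $ 2"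
proof -
  interpret difference_field K \<phi> j by fact
  have hom: "ring_hom_on K \<iota>" and aut: "ring_aut \<Phi>" and ext: "\<forall>x\<in>K. \<Phi> (\<iota> x) = \<iota> (\<phi> x)"
    and inv: "invertible U" and sys: "map_matrix \<Phi> U = map_matrix \<iota> (companion_matrix a b) ** U"
    and gen: "is_subring hull (\<iota> ` K \<union> {U $ i $ j | i j. True} \<union> {d. d * det U = 1}) = UNIV"
    and simp: "\<And>I. module.subspace (*) I \<Longrightarrow> \<Phi> ` I \<subseteq> I \<Longrightarrow> I = {0} \<or> I = UNIV"
    using pv by (auto simp: picard_vessiot_def)
  interpret difference_algebra K \<phi> j \<iota> \<Phi>
    by unfold_locales (use hom aut ext in \<open>auto simp: ring_hom_on_def ring_aut_def\<close>)
  obtain U' where "U ** U' = mat 1" using inv by (auto simp: invertible_def)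
  hence "det U * det U' = 1" by (metis det_I det_mul)
  define d where "d = det U'"
  have d: "(U $ 1 $ 1 * U $ 2 $ 2 - U $ 1 $ 2 * U $ 2 $ 1) * d = 1"
    using \<open>det U * det U' = 1\<close> by (simp add: d_def det_2)
  have entry: "\<Phi> (U $ i $ k) = (map_matrix \<iota> (companion_matrix a b) ** U) $ i $ k" for i k
    unfolding sys[symmetric] by simp
  have \<Phi>U: "\<Phi> (U $ 1 $ k) = U $ 2 $ k" "\<Phi> (U $ 2 $ k) = - \<iota> a * U $ 2 $ k - \<iota> b * U $ 1 $ k" for k
    using ab by (simp_all add: entry matrix_mult_2 companion_matrix_def \<kappa>_one \<kappa>_uminus)
  have "second_order_pv K \<phi> j \<iota> \<Phi> a b (U $ 1 $ 1) (U $ 1 $ 2) d"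
  proof unfold_locales
    show "bij \<Phi>" using aut by (simp add: ring_aut_def)
    show "J = {0} \<or> J = UNIV" if "stable_ideal J" for J
      using simp that by (auto simp: stable_ideal_def)
    show "S = UNIV" if S: "is_subring S" "\<iota> ` K \<subseteq> S"
        "{U $ 1 $ 1, U $ 1 $ 2, \<Phi> (U $ 1 $ 1), \<Phi> (U $ 1 $ 2), d} \<subseteq> S" for S
    proof -
      have "U $ i $ k \<in> S" for i k
        using S(3) exhaust_2[of i] exhaust_2[of k] by (auto simp: \<Phi>U)
      \<comment> \<open>An inverse of \<open>det U\<close> is unique, so besides \<open>K\<close>
        and the entries of \<open>U\<close> only \<open>d\<close> generates.\<close>
      moreover have "e = d" if "e * det U = 1" for e
      proof -
        have "e = (e * det U) * d"
          using \<open>det U * det U' = 1\<close> by (simp only: mult.assoc d_def mult_1_right)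
        thus ?thesis using that by simp
      qed
      ultimately have "\<iota> ` K \<union> {U $ i $ j | i j. True} \<union> {d. d * det U = 1} \<subseteq> S"
        using S by auto
      from hull_minimal[of _ _ is_subring, OF this S(1)] show ?thesis using gen by auto
    qed
  qed (use ab d in \<open>simp_all add: \<Phi>U\<close>)
  thus ?thesis using that \<Phi>U by blast
qed

lemma galois_groupD:
  assumes "C \<in> galois_group K \<iota> \<Phi> (U :: 'r::comm_ring_1^2^2)"
  obtains \<sigma> where "\<sigma> \<in> galois_automorphisms K \<iota> \<Phi>"
    "\<sigma> (U $ 1 $ 1) = \<iota> (mero_const (C $ 1 $ 1)) * U $ 1 $ 1 + \<iota> (mero_const (C $ 2 $ 1)) * U $ 1 $ 2"
    "\<sigma> (U $ 1 $ 2) = \<iota> (mero_const (C $ 1 $ 2)) * U $ 1 $ 1 + \<iota> (mero_const (C $ 2 $ 2)) * U $ 1 $ 2"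
proof -
  from assms obtain \<sigma> where \<sigma>: "\<sigma> \<in> galois_automorphisms K \<iota> \<Phi>" "map_matrix \<sigma> U = U ** map_matrix (\<iota> \<circ> mero_const) C"
    by (auto simp: galois_group_def)
  have "\<sigma> (U $ 1 $ k) = (U ** map_matrix (\<iota> \<circ> mero_const) C) $ 1 $ k" for k
    unfolding \<sigma>(2)[symmetric] by simp
  with \<sigma>(1) show ?thesis using that by (simp add: matrix_mult_2 mult.commute)
qed

lemma galois_groupI:
  fixes U :: "'r::comm_ring_1^2^2"
  assumes pv: "second_order_pv K \<phi> mero_const \<iota> \<Phi> a b (U $ 1 $ 1) (U $ 1 $ 2) d"
    and \<Phi>U: "\<Phi> (U $ 1 $ 1) = U $ 2 $ 1" "\<Phi> (U $ 1 $ 2) = U $ 2 $ 2"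
    and \<sigma>: "\<sigma> \<in> galois_automorphisms K \<iota> \<Phi>"
    "\<sigma> (U $ 1 $ 1) = \<iota> (mero_const c11) * U $ 1 $ 1 + \<iota> (mero_const c21) * U $ 1 $ 2"
    "\<sigma> (U $ 1 $ 2) = \<iota> (mero_const c12) * U $ 1 $ 1 + \<iota> (mero_const c22) * U $ 1 $ 2"
    "c11 * c22 - c12 * c21 \<noteq> 0"
  shows "vector [vector [c11, c12], vector [c21, c22]] \<in> galois_group K \<iota> \<Phi> U"
proof -
  interpret second_order_pv K \<phi> mero_const \<iota> \<Phi> a b "U $ 1 $ 1" "U $ 1 $ 2" d by fact
  let ?C = "vector [vector [c11, c12], vector [c21, c22]] :: complex^2^2"
  have "\<sigma> (U $ 2 $ 1) = \<Phi> (\<sigma> (U $ 1 $ 1))" "\<sigma> (U $ 2 $ 2) = \<Phi> (\<sigma> (U $ 1 $ 2))"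
    using galois_action(6)[OF \<sigma>(1)] \<Phi>U by metis+
  hence "map_matrix \<sigma> U = U ** map_matrix (\<iota> \<circ> mero_const) ?C"
    by (simp add: vec_eq_iff forall_2 matrix_mult_2 \<sigma> \<psi>_add \<psi>_mult \<psi>_scalar \<Phi>U mult.commute)
  moreover have "invertible ?C" using \<sigma>(4) by (simp add: invertible_det_nz det_2)
  ultimately show ?thesis using \<sigma>(1) by (auto simp: galois_group_def)
qed

text \<open>The criterion with solutions anywhere in \<open>K\<close>; the period lattice enters
  afterwards, through the symmetries of the Riccati equation.\<close>

lemma galois_group_reducibility:
  fixes U :: "'r::comm_ring_1^2^2"
  assumes df: "difference_field K \<phi> mero_const" and ab: "a \<in> K" "b \<in> K" "b \<noteq> 0"
    and pv: "picard_vessiot K \<phi> (companion_matrix a b) \<iota> \<Phi> U"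
    and G: "G = galois_group K \<iota> \<Phi> U"
  shows "reducible G \<longleftrightarrow> (\<exists>u\<in>K. (\<phi> u + a) * u = - b)"
    and "completely_reducible G \<longleftrightarrow> (\<exists>u\<in>K. \<exists>v\<in>K. u \<noteq> v \<and> (\<phi> u + a) * u = - b \<and> (\<phi> v + a) * v = - b)"
proof -
  obtain d where so: "second_order_pv K \<phi> mero_const \<iota> \<Phi> a b (U $ 1 $ 1) (U $ 1 $ 2) d"
    and \<Phi>U: "\<Phi> (U $ 1 $ 1) = U $ 2 $ 1" "\<Phi> (U $ 1 $ 2) = U $ 2 $ 2"
    using picard_vessiot_second_order[OF df ab pv] by blast
  define p q where "p = U $ 1 $ 1" and "q = U $ 1 $ 2"
  interpret second_order_pv K \<phi> mero_const \<iota> \<Phi> a b p q d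
    using so by (simp add: p_def q_def)
  have inv: "invertible C" if "C \<in> G" for C using that by (auto simp: G galois_group_def)
  have line: "\<exists>u\<in>K. (\<phi> u + a) * u = - b \<and>
      \<Phi> (scalar v * p + scalar v' * q) = \<iota> u * (scalar v * p + scalar v' * q)"
    if nz: "v \<noteq> 0 \<or> v' \<noteq> 0" and ev: "\<And>C. C \<in> G \<Longrightarrow>
      \<exists>\<mu>. C $ 1 $ 1 * v + C $ 1 $ 2 * v' = \<mu> * v \<and> C $ 2 $ 1 * v + C $ 2 $ 2 * v' = \<mu> * v'" for v v'
  proof -
    have eigen: "\<exists>\<mu>. \<sigma> (scalar v * p + scalar v' * q) = scalar \<mu> * (scalar v * p + scalar v' * q)"
      if \<sigma>: "\<sigma> \<in> galois_automorphisms K \<iota> \<Phi>" "\<sigma> p = scalar c11 * p + scalar c21 * q"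
        "\<sigma> q = scalar c12 * p + scalar c22 * q" "c11 * c22 - c12 * c21 \<noteq> 0" for \<sigma> c11 c12 c21 c22
    proof -
      have "vector [vector [c11, c12], vector [c21, c22]] \<in> G"
        unfolding G using galois_groupI[OF so \<Phi>U] \<sigma> by (simp add: p_def q_def)
      from ev[OF this] obtain \<mu> where \<mu>: "c11 * v + c12 * v' = \<mu> * v" "c21 * v + c22 * v' = \<mu> * v'"
        by auto
      have "\<sigma> (scalar v * p + scalar v' * q) = scalar (c11 * v + c12 * v') * p + scalar (c21 * v + c22 * v') * q"
        by (simp add: galois_action[OF \<sigma>(1)] \<sigma>(2,3) j_K scalar_add scalar_mult algebra_simps)
      also have "\<dots> = scalar \<mu> * (scalar v * p + scalar v' * q)"
        unfolding \<mu> by (simp add: scalar_mult algebra_simps)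
      finally show ?thesis by blast
    qed
    show ?thesis
      by (rule riccati_of_invariant_line[OF refl nz]) (rule eigen; assumption)
  qed
  show "reducible G \<longleftrightarrow> (\<exists>u\<in>K. (\<phi> u + a) * u = - b)"
  proof
    assume "reducible G"
    then obtain v v' where "v \<noteq> 0 \<or> v' \<noteq> 0" "\<And>C. C \<in> G \<Longrightarrow>
      \<exists>\<mu>. C $ 1 $ 1 * v + C $ 1 $ 2 * v' = \<mu> * v \<and> C $ 2 $ 1 * v + C $ 2 $ 2 * v' = \<mu> * v'"
      using reducible_right_eigenvector by blast
    from line[OF this] show "\<exists>u\<in>K. (\<phi> u + a) * u = - b" by blast
  next
    assume "\<exists>u\<in>K. (\<phi> u + a) * u = - b"
    then obtain u where u: "u \<in> K" "(\<phi> u + a) * u = - b" by blast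
    obtain l l' w w' where nz: "l \<noteq> 0 \<or> l' \<noteq> 0" and w: "w' * w = 1"
      "\<Phi> p - \<iota> u * p = scalar l * w" "\<Phi> q - \<iota> u * q = scalar l' * w"
      by (rule left_eigenvector_of_riccati[OF u])
    show "reducible G"
    proof (rule reducible_of_left_eigenvector[OF inv nz])
      fix C assume "C \<in> G"
      then obtain \<sigma> where "\<sigma> \<in> galois_automorphisms K \<iota> \<Phi>"
        "\<sigma> p = scalar (C $ 1 $ 1) * p + scalar (C $ 2 $ 1) * q"
        "\<sigma> q = scalar (C $ 1 $ 2) * p + scalar (C $ 2 $ 2) * q"
        unfolding G p_def q_def by (rule galois_groupD)
      from left_eigenvector_invariant[OF this u(1) w]
      show "l' * (l * C $ 1 $ 1 + l' * C $ 2 $ 1) = l * (l * C $ 1 $ 2 + l' * C $ 2 $ 2)" .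
    qed
  qed
  show "completely_reducible G \<longleftrightarrow>
    (\<exists>u\<in>K. \<exists>v\<in>K. u \<noteq> v \<and> (\<phi> u + a) * u = - b \<and> (\<phi> v + a) * v = - b)"
  proof
    assume "completely_reducible G"
    then obtain v v' w w' where indep: "v * w' \<noteq> v' * w"
      and v: "\<And>C. C \<in> G \<Longrightarrow>
        \<exists>\<mu>. C $ 1 $ 1 * v + C $ 1 $ 2 * v' = \<mu> * v \<and> C $ 2 $ 1 * v + C $ 2 $ 2 * v' = \<mu> * v'"
      and w: "\<And>C. C \<in> G \<Longrightarrow>
        \<exists>\<mu>. C $ 1 $ 1 * w + C $ 1 $ 2 * w' = \<mu> * w \<and> C $ 2 $ 1 * w + C $ 2 $ 2 * w' = \<mu> * w'"
      by (rule completely_reducible_right_eigenvectors) (erule that; blast)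
    have "v \<noteq> 0 \<or> v' \<noteq> 0" "w \<noteq> 0 \<or> w' \<noteq> 0" using indep by auto
    from line[OF this(1) v] line[OF this(2) w] obtain s t where
      s: "s \<in> K" "(\<phi> s + a) * s = - b"
        "\<Phi> (scalar v * p + scalar v' * q) = \<iota> s * (scalar v * p + scalar v' * q)"
      and t: "t \<in> K" "(\<phi> t + a) * t = - b"
        "\<Phi> (scalar w * p + scalar w' * q) = \<iota> t * (scalar w * p + scalar w' * q)" by blast
    \<comment> \<open>Equal quotients would make the Casoratian of two independent combinations of
      \<open>p\<close> and \<open>q\<close> vanish, but it is a nonzero scalar times a unit.\<close>
    have "s \<noteq> t"
    proof
      assume "s = t"
      define y z where "y = scalar v * p + scalar v' * q" and "z = scalar w * p + scalar w' * q"
      have "scalar (v * w' - v' * w) * (p * \<Phi> q - q * \<Phi> p) = y * \<Phi> z - z * \<Phi> y"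
        by (simp add: y_def z_def \<psi>_add \<psi>_mult \<psi>_scalar scalar_diff scalar_mult algebra_simps)
      also have "\<dots> = 0"
        using s(3) t(3) \<open>s = t\<close> unfolding y_def[symmetric] z_def[symmetric]
        by (simp add: mult.left_commute)
      finally have "scalar (v * w' - v' * w) * ((p * \<Phi> q - q * \<Phi> p) * d) = 0"
        by (metis mult.assoc mult_zero_left)
      thus False using indep unfolding casoratian by simp
    qed
    thus "\<exists>u\<in>K. \<exists>v\<in>K. u \<noteq> v \<and> (\<phi> u + a) * u = - b \<and> (\<phi> v + a) * v = - b"
      using s t by blast
  next
    assume "\<exists>u\<in>K. \<exists>v\<in>K. u \<noteq> v \<and> (\<phi> u + a) * u = - b \<and> (\<phi> v + a) * v = - b"
    then obtain u v where u: "u \<in> K" "(\<phi> u + a) * u = - b" and v: "v \<in> K" "(\<phi> v + a) * v = - b"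
      and "u \<noteq> v" by blast
    obtain l l' w w' where "l \<noteq> 0 \<or> l' \<noteq> 0" and w: "w' * w = 1"
      "\<Phi> p - \<iota> u * p = scalar l * w" "\<Phi> q - \<iota> u * q = scalar l' * w"
      by (rule left_eigenvector_of_riccati[OF u])
    obtain k k' x x' where "k \<noteq> 0 \<or> k' \<noteq> 0" and x: "x' * x = 1"
      "\<Phi> p - \<iota> v * p = scalar k * x" "\<Phi> q - \<iota> v * q = scalar k' * x"
      by (rule left_eigenvector_of_riccati[OF v])
    have nz: "l * k' \<noteq> l' * k"
      by (rule left_eigenvectors_independent[OF u(1) v(1) \<open>u \<noteq> v\<close> w(2,3) x(2,3)])
    show "completely_reducible G"
    proof (rule completely_reducible_of_left_eigenvectors[OF inv nz])
      fix C assume "C \<in> G"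
      then obtain \<sigma> where \<sigma>: "\<sigma> \<in> galois_automorphisms K \<iota> \<Phi>"
        "\<sigma> p = scalar (C $ 1 $ 1) * p + scalar (C $ 2 $ 1) * q"
        "\<sigma> q = scalar (C $ 1 $ 2) * p + scalar (C $ 2 $ 2) * q"
        unfolding G p_def q_def by (rule galois_groupD)
      show "l' * (l * C $ 1 $ 1 + l' * C $ 2 $ 1) = l * (l * C $ 1 $ 2 + l' * C $ 2 $ 2)"
        by (rule left_eigenvector_invariant[OF \<sigma> u(1) w])
      show "k' * (k * C $ 1 $ 1 + k' * C $ 2 $ 1) = k * (k * C $ 1 $ 2 + k' * C $ 2 $ 2)"
        by (rule left_eigenvector_invariant[OF \<sigma> v(1) x])
    qed
  qed
qed

theorem theorem4p4:
  fixes \<tau> h :: complex and a b :: mero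
    and \<iota> :: "mero \<Rightarrow> 'r::comm_ring_1" and \<Phi> :: "'r \<Rightarrow> 'r" and U :: "'r^2^2"
    and \<Lambda> :: "complex set" and G :: "(complex^2^2) set"
  assumes "\<Lambda> = lattice \<tau>" and "Im \<tau> > 0"
    and "\<forall>n::nat. n \<ge> 1 \<longrightarrow> of_nat n * h \<notin> \<Lambda>"
    and "a \<in> periodic_mero \<Lambda>" and "b \<in> periodic_mero \<Lambda>" and "b \<noteq> 0"
    and "picard_vessiot (base_field \<Lambda>) (shift h) (companion_matrix a b) \<iota> \<Phi> U"
    and "G = galois_group (base_field \<Lambda>) \<iota> \<Phi> U"
  shows "(reducible G \<longleftrightarrow>
            (\<exists>u \<in> periodic_mero (scaled 2 \<Lambda>). (shift h u + a) * u = - b)) \<and>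
         (completely_reducible G \<longleftrightarrow>
            (\<exists>u \<in> periodic_mero (scaled 2 \<Lambda>). \<exists>v \<in> periodic_mero (scaled 2 \<Lambda>). u \<noteq> v \<and>
               (shift h u + a) * u = - b \<and> (shift h v + a) * v = - b))"
proof -
  note \<Lambda> = assms(1)
  have df: "difference_field (base_field \<Lambda>) (shift h) mero_const"
    using base_field_difference_field assms(2,3) unfolding \<Lambda> by blast
  interpret difference_field "base_field \<Lambda>" "shift h" mero_const by (rule df)
  have "scaled 1 \<Lambda> = \<Lambda>" by (auto simp: scaled_def)
  hence ab: "a \<in> base_field \<Lambda>" "b \<in> base_field \<Lambda>"
    using base_fieldI[of 1 _ \<Lambda>] assms(4,5) by simp_all
  have sub: "periodic_mero (scaled 2 \<Lambda>) \<subseteq> base_field \<Lambda>"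
    using base_fieldI[of 2 _ \<Lambda>] by auto
  have symmetry: "riccati_symmetry (base_field \<Lambda>) (shift h) mero_const (shift w) a b"
    if "w \<in> \<Lambda>" for w
  proof unfold_locales
    show "shift w x \<in> base_field \<Lambda>" if "x \<in> base_field \<Lambda>" for x
      using that by (auto simp: base_field_def intro: periodic_mero_shift)
    show "shift w a = a" "shift w b = b" using assms(4,5) \<open>w \<in> \<Lambda>\<close> by (auto simp: periodic_mero_iff)
  qed (use ab assms(6) in \<open>simp_all add: shift_add shift_mult shift_one shift_const shift_commute[of w h]\<close>)
  have gen: "1 \<in> \<Lambda>" "\<tau> \<in> \<Lambda>" unfolding \<Lambda> by (rule lattice_generators)+
  interpret A: riccati_symmetry "base_field \<Lambda>" "shift h" mero_const "shift 1" a b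
    by (rule symmetry[OF gen(1)])
  interpret B: riccati_symmetry "base_field \<Lambda>" "shift h" mero_const "shift \<tau>" a b
    by (rule symmetry[OF gen(2)])
  interpret riccati_symmetries "base_field \<Lambda>" "shift h" mero_const "shift 1" "shift \<tau>" a b
  proof unfold_locales
    fix u assume "u \<in> riccati a b"
    hence "u \<in> base_field \<Lambda>" by (simp add: riccati_def)
    thus "\<exists>n>0. (shift 1 ^^ n) u = u" "\<exists>n>0. (shift \<tau> ^^ n) u = u"
      using base_field_shift_order gen unfolding \<Lambda> by blast+
  qed (rule shift_commute)
  have two: "\<exists>u\<in>periodic_mero (scaled 2 \<Lambda>). \<exists>v\<in>periodic_mero (scaled 2 \<Lambda>). u \<noteq> v \<and>
      u \<in> riccati a b \<and> v \<in> riccati a b"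
    if uv: "u \<in> riccati a b" "v \<in> riccati a b" "u \<noteq> v" for u v
    using ex_two_invariant_solutions[OF uv] periodic_mero_2I[of _ \<tau>] unfolding \<Lambda> by blast
  \<comment> \<open>A unique solution is fixed by both translations; if there are more, the
    statement for two provides one.\<close>
  have one: "\<exists>u\<in>periodic_mero (scaled 2 \<Lambda>). u \<in> riccati a b" if u: "u \<in> riccati a b" for u
  proof (cases "riccati a b = {u}")
    case True
    hence "shift 1 u = u" "shift \<tau> u = u" using A.A_riccati[OF u] B.A_riccati[OF u] by auto
    hence "u \<in> periodic_mero (scaled 2 \<Lambda>)" unfolding \<Lambda> by (intro periodic_mero_2I) simp_all
    thus ?thesis using u by blast
  next
    case False
    then obtain v where "v \<in> riccati a b" "u \<noteq> v" using u by blast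
    thus ?thesis using two[OF u] by blast
  qed
  have ric: "u \<in> riccati a b \<longleftrightarrow> u \<in> base_field \<Lambda> \<and> (shift h u + a) * u = - b" for u
    by (simp add: riccati_def)
  note red = galois_group_reducibility[OF df ab assms(6,7,8)]
  show ?thesis
    unfolding red
  proof (intro conjI iffI)
    show "\<exists>u\<in>periodic_mero (scaled 2 \<Lambda>). (shift h u + a) * u = - b"
      if "\<exists>u\<in>base_field \<Lambda>. (shift h u + a) * u = - b"
      using that one unfolding ric by blast
    show "\<exists>u\<in>base_field \<Lambda>. (shift h u + a) * u = - b"
      if "\<exists>u\<in>periodic_mero (scaled 2 \<Lambda>). (shift h u + a) * u = - b"
      using that sub by blast
    show "\<exists>u\<in>periodic_mero (scaled 2 \<Lambda>). \<exists>v\<in>periodic_mero (scaled 2 \<Lambda>). u \<noteq> v \<and>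
        (shift h u + a) * u = - b \<and> (shift h v + a) * v = - b"
      if uv: "\<exists>u\<in>base_field \<Lambda>. \<exists>v\<in>base_field \<Lambda>. u \<noteq> v \<and>
        (shift h u + a) * u = - b \<and> (shift h v + a) * v = - b"
    proof -
      from uv obtain u v where "u \<in> riccati a b" "v \<in> riccati a b" "u \<noteq> v"
        unfolding ric by blast
      from two[OF this] show ?thesis unfolding ric by blast
    qed
    show "\<exists>u\<in>base_field \<Lambda>. \<exists>v\<in>base_field \<Lambda>. u \<noteq> v \<and>
        (shift h u + a) * u = - b \<and> (shift h v + a) * v = - b"
      if "\<exists>u\<in>periodic_mero (scaled 2 \<Lambda>). \<exists>v\<in>periodic_mero (scaled 2 \<Lambda>). u \<noteq> v \<and>
        (shift h u + a) * u = - b \<and> (shift h v + a) * v = - b"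
      using that sub by blast
  qed
qed

end
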